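(* Let $(p_n)_{n\ge 2}$ be positive integers and let $(\sigma_n)_{n\ge2}$, $(\Delta_n)_{n\ge 2}$ be positive reals (write $p=p_n$, $\sigma=\sigma_n$). Define $\bar\Delta_n>0$ by $$\bar{\Delta}^{2}_{n} = \sigma^{2}\left(1+\sqrt{1+\frac{2p}{n\log n}}\right)\log n .$$ (i) If for some $\epsilon>0$ one has $\Delta_n\ge \bar\Delta_n(1+\epsilon)$ for all $n$, then the estimator $\eta^{k}$ (spectral initialization followed by $k$ iterations, as defined in the context) with $k=\lfloor 3\log n\rfloor$ achieves exact recovery for $(\Omega_{\Delta_n})_{n\ge2}$. (ii) If for some $\epsilon>0$ one has $\Delta_n\le\bar\Delta_n(1-\epsilon)$ for all $n$, then exact recovery is impossible for $(\Omega_{\Delta_n})_{n\ge2}$.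
   Context: Model: for $n\ge 2$, $p\ge1$, $\sigma>0$, one observes $Y_i=\boldsymbol\theta\eta_i+\sigma\xi_i\in\mathbf R^p$, $i=1,\dots,n$, where $\boldsymbol\theta\in\mathbf R^p$ and $\eta\in\{-1,1\}^n$ are unknown and $\xi_1,\dots,\xi_n$ are i.i.d. standard Gaussian vectors in $\mathbf R^p$. $Y$ is the $p\times n$ matrix with columns $Y_1,\dots,Y_n$; $\mathbf E_{(\boldsymbol\theta,\eta)}$ is expectation under the law of $Y$. $\|\cdot\|$ is the Euclidean norm. For $\Delta>0$, $\Omega_\Delta=\{\boldsymbol\theta\in\mathbf R^p:\|\boldsymbol\theta\|\ge\Delta\}\times\{-1,1\}^n$. An estimator is a measurable function of $Y$ with values in $\{-1,1\}^n$. Loss: $r(\hat\eta,\eta)=\min_{\nu\in\{-1,1\}}\sum_{j=1}^n|\hat\eta_j-\nu\eta_j|$. Exact recovery: an estimator $\hat\eta$ (one for each $n$) achieves exact recovery for $(\Omega_{\Delta_n})_{n\ge2}$ if $\lim_{n\to\infty}\sup_{(\boldsymbol\theta,\eta)\in\Omega_{\Delta_n}}\mathbf E_{(\boldsymbol\theta,\eta)}r(\hat\eta,\eta)=0$. Exact recovery is impossible if $\liminf_{n\to\infty}\inf_{\tilde\eta}\sup_{(\boldsymbol\theta,\eta)\in\Omega_{\Delta_n}}\mathbf E_{(\boldsymbol\theta,\eta)}r(\tilde\eta,\eta)>0$, the infimum being over all estimators. Estimator $\eta^k$: for a square matrix $M$, $\mathbf H(M)=M-\mathrm{diag}(M)$,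 where $\mathrm{diag}(M)$ is the diagonal matrix with the same diagonal as $M$. Let $\hat v$ be an eigenvector of $\mathbf H(Y^\top Y)$ for its top (largest) eigenvalue, $\eta^0=\mathrm{sign}(\hat v)$, and $\eta^{j+1}=\mathrm{sign}(\mathbf H(Y^\top Y)\eta^j)$ for $j\ge0$; $\mathrm{sign}$ is applied entrywise, with any fixed convention $\mathrm{sign}(0)\in\{-1,1\}$. *)

theory Defs
  imports "HOL-Probability.Probability" "Jordan_Normal_Form.Char_Poly"
begin

text \<open>Vectors and matrices are the dimension-carrying \<^typ>\<open>real vec\<close> and \<^typ>\<open>real mat\<close>, because
  the dimensions \<open>p\<close> and \<open>n\<close> vary along a sequence. Indices start at 0.\<close>

definition data_space :: "nat \<Rightarrow> nat \<Rightarrow> real mat measure" where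
  "data_space p n = vimage_algebra (carrier_mat p n)
     (\<lambda>Y. restrict (($$) Y) ({..<p} \<times> {..<n})) (\<Pi>\<^sub>M _\<in>{..<p} \<times> {..<n}. borel)"

text \<open>The coordinate \<open>(i, j)\<close> of the noise is coordinate \<open>i\<close> of \<open>\<xi>\<^sub>j\<close>: i.i.d. standard Gaussian
  vectors in dimension \<open>p\<close> are the same as \<open>p * n\<close> independent standard normal coordinates.\<close>

definition noise :: "nat \<Rightarrow> nat \<Rightarrow> (nat \<times> nat \<Rightarrow> real) measure" where
  "noise p n = (\<Pi>\<^sub>M _\<in>{..<p} \<times> {..<n}. std_normal_distribution)"

definition data_law :: "nat \<Rightarrow> nat \<Rightarrow> real \<Rightarrow> real vec \<Rightarrow> real vec \<Rightarrow> real mat measure" where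
  "data_law p n \<sigma> \<theta> \<eta> = distr (noise p n) (data_space p n)
     (\<lambda>\<xi>. mat p n (\<lambda>(i, j). vec_index \<theta> i * vec_index \<eta> j + \<sigma> * \<xi> (i, j)))"

definition eucl_norm :: "real vec \<Rightarrow> real" where
  "eucl_norm v = sqrt (scalar_prod v v)"

definition sign_vecs :: "nat \<Rightarrow> real vec set" where
  "sign_vecs n = {v \<in> carrier_vec n. \<forall>j<n. vec_index v j \<in> {-1, 1}}"

definition param_space :: "nat \<Rightarrow> nat \<Rightarrow> real \<Rightarrow> (real vec \<times> real vec) set" where
  "param_space p n \<Delta> = {\<theta> \<in> carrier_vec p. eucl_norm \<theta> \<ge> \<Delta>} \<times> sign_vecs n"

definition estimators :: "nat \<Rightarrow> nat \<Rightarrow> (real mat \<Rightarrow> real vec) set" where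
  "estimators p n = measurable (data_space p n) (count_space (sign_vecs n))"

definition loss :: "nat \<Rightarrow> real vec \<Rightarrow> real vec \<Rightarrow> real" where
  "loss n a b = (MIN \<nu>\<in>{-1, 1}. \<Sum>j<n. \<bar>vec_index a j - \<nu> * vec_index b j\<bar>)"

text \<open>The loss is nonnegative, so its expectation is taken in \<^typ>\<open>ennreal\<close>, where suprema and infima
  always exist.\<close>

definition risk ::
    "nat \<Rightarrow> nat \<Rightarrow> real \<Rightarrow> (real mat \<Rightarrow> real vec) \<Rightarrow> real vec \<Rightarrow> real vec \<Rightarrow> ennreal" where
  "risk p n \<sigma> T \<theta> \<eta> = (\<integral>\<^sup>+ Y. ennreal (loss n (T Y) \<eta>) \<partial>data_law p n \<sigma> \<theta> \<eta>)"

definition max_risk :: "nat \<Rightarrow> nat \<Rightarrow> real \<Rightarrow> real \<Rightarrow> (real mat \<Rightarrow> real vec) \<Rightarrow> ennreal" where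
  "max_risk p n \<sigma> \<Delta> T = (SUP (\<theta>, \<eta>)\<in>param_space p n \<Delta>. risk p n \<sigma> T \<theta> \<eta>)"

definition achieves_exact_recovery ::
    "(nat \<Rightarrow> nat) \<Rightarrow> (nat \<Rightarrow> real) \<Rightarrow> (nat \<Rightarrow> real) \<Rightarrow> (nat \<Rightarrow> real mat \<Rightarrow> real vec) \<Rightarrow> bool" where
  "achieves_exact_recovery p \<sigma> \<Delta> T \<longleftrightarrow>
     (\<forall>n\<ge>2. T n \<in> estimators (p n) n) \<and>
     (\<lambda>n. max_risk (p n) n (\<sigma> n) (\<Delta> n) (T n)) \<longlonglongrightarrow> 0"

definition exact_recovery_impossible ::
    "(nat \<Rightarrow> nat) \<Rightarrow> (nat \<Rightarrow> real) \<Rightarrow> (nat \<Rightarrow> real) \<Rightarrow> bool" where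
  "exact_recovery_impossible p \<sigma> \<Delta> \<longleftrightarrow>
     liminf (\<lambda>n. INF T\<in>estimators (p n) n. max_risk (p n) n (\<sigma> n) (\<Delta> n) T) > 0"

definition hollow :: "real mat \<Rightarrow> real mat" where
  "hollow M = M - mat_diag (dim_row M) (\<lambda>i. M $$ (i, i))"

definition hollow_gram :: "real mat \<Rightarrow> real mat" where
  "hollow_gram Y = hollow (transpose_mat Y * Y)"

definition top_eigenvector :: "real mat \<Rightarrow> real vec \<Rightarrow> bool" where
  "top_eigenvector M v \<longleftrightarrow> (\<exists>l. eigenvector M v l \<and> (\<forall>m. eigenvalue M m \<longrightarrow> m \<le> l))"

text \<open>A top eigenvector is determined only up to a scalar, or less if the eigenvalue is multiple, so
  its choice is a function \<open>v\<close> of the data, required to be measurable in order that the resulting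
  procedure be an estimator.\<close>

definition spectral_choice :: "nat \<Rightarrow> nat \<Rightarrow> (real mat \<Rightarrow> real vec) \<Rightarrow> bool" where
  "spectral_choice p n v \<longleftrightarrow>
     (\<forall>Y\<in>carrier_mat p n. top_eigenvector (hollow_gram Y) (v Y)) \<and>
     (\<forall>j<n. (\<lambda>Y. vec_index (v Y) j) \<in> borel_measurable (data_space p n))"

text \<open>The parameter \<open>s\<close> is the conventional value of the sign of 0.\<close>

definition sign_conv :: "real \<Rightarrow> real \<Rightarrow> real" where
  "sign_conv s x = (if x = 0 then s else sgn x)"

fun eta_iter :: "real \<Rightarrow> (real mat \<Rightarrow> real vec) \<Rightarrow> nat \<Rightarrow> real mat \<Rightarrow> real vec" where
  "eta_iter s v 0 Y = map_vec (sign_conv s) (v Y)"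
| "eta_iter s v (Suc k) Y = map_vec (sign_conv s) (hollow_gram Y *\<^sub>v eta_iter s v k Y)"

definition critical_sep :: "nat \<Rightarrow> nat \<Rightarrow> real \<Rightarrow> real" where
  "critical_sep p n \<sigma> =
     sqrt (\<sigma>\<^sup>2 * (1 + sqrt (1 + 2 * real p / (real n * ln (real n)))) * ln (real n))"

end

theory Submission
  imports Defs "HOL-Real_Asymp.Real_Asymp"
begin

text \<open>Write \<open>X = \<parallel>\<theta>\<parallel>\<^sup>2 / \<sigma>\<^sup>2\<close>, \<open>q = p / n\<close> and \<open>l = ln n\<close>. If all labels but one are known, the
remaining label is decided by comparing its observation with the mean of the others, and this is
wrong with probability about \<open>exp (- X\<^sup>2 / (2 (X + q)))\<close>. The critical separation is the one at
which this probability is \<open>1 / n\<close>: its value of \<open>X\<close> is the root \<open>x\<close> of \<open>x\<^sup>2 = 2 l (x + q)\<close> (lemma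
\<open>crit_square\<close>). A constant factor above or below it therefore changes the expected number of such
errors from \<open>o(1)\<close> to a positive power of \<open>n\<close>. The two halves of the theorem say that nothing else
goes wrong, and that this cannot be avoided.

\<^bold>\<open>Impossibility.\<close> The loss dominates, up to the factor \<open>1 / n\<close>, the number of pairs whose relative
sign is wrong (\<open>loss_ge_pairs\<close>). This removes the minimum over the global sign, and as each pair
only poses a test between a labelling and the same labelling with one coordinate flipped, the
Bayes risk under uniform labels is at least \<open>(n - 1) / 2\<close> times the overlap \<open>\<integral> min f g\<close> of two such
densities (\<open>sum_loss_ge_min_density\<close>): expected errors add up over the coordinates. The overlap is
bounded below in terms of the affinities \<open>\<integral> f\<^bsup>1/2+s\<^esup> g\<^bsup>1/2-s\<^esup>\<close> for \<open>s\<close> near \<open>0\<close>, which lose only a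
factor \<open>exp (O (sqrt l))\<close> (\<open>min_density_bound\<close>). They are explicit in two cases. If \<open>p\<close> is small
compared with \<open>n l\<close>, the term \<open>q\<close> is negligible and a fixed centre \<open>\<theta>\<close> suffices. Otherwise \<open>\<theta>\<close> is given
a centred Gaussian prior; then the density of the data depends on the labels only through a
quadratic form (\<open>affinity_gaussian_center\<close>), the exponent comes out as \<open>X\<^sup>2 / (2 (X + q))\<close>, and
since \<open>p\<close> is large the prior puts negligible mass on centres shorter than \<open>\<Delta>\<close>.

\<^bold>\<open>Recovery.\<close> With \<open>\<kappa> = \<parallel>\<theta>\<parallel>\<^sup>2\<close>, the hollow Gram matrix is \<open>H = \<kappa> (\<eta> \<eta>\<^sup>T - I) + Z\<close>. A union bound over a
grid of \<open>exp (O n)\<close> points shows that \<open>Z\<close> has norm at most \<open>\<tau> n \<kappa>\<close> for any fixed \<open>\<tau>\<close>, outside an event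
of exponentially small probability (\<open>noise_form_mgf\<close>, \<open>form_bounded_if_grid\<close>): above the critical
separation this asks for a deviation larger by \<open>sqrt l\<close> than the typical one. On this event
everything is deterministic. The top eigenvector is close to a multiple of \<open>\<eta>\<close>, so that few of its
signs are wrong (\<open>spectral_sign_errors\<close>). As long as \<open>h\<close> is a small fraction of \<open>n\<close>, one iteration
maps \<open>h\<close> wrong labels to at most \<open>N + h / 9\<close>, where \<open>N\<close> counts the labels \<open>i\<close> whose margin \<open>\<eta>\<^sub>i (H \<eta>)\<^sub>i\<close>
is below a small fraction of its mean (\<open>sign_power_iteration_step\<close>). After \<open>3 ln n\<close> iterations the
loss is \<open>O(N)\<close> up to a vanishing term, and a Chernoff bound for the margin gives \<open>E N \<rightarrow> 0\<close>
(\<open>margin_mgf\<close>, \<open>risk_bound\<close>).\<close>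

section \<open>Gaussian integrals\<close>

abbreviation "SN \<equiv> std_normal_distribution"

lemma prob_space_SN: "prob_space SN"
  by (rule prob_space_normal_density) simp

interpretation SN: product_prob_space "\<lambda>_::'i. SN" UNIV
  by (simp add: product_prob_space_def product_prob_space_axioms_def product_sigma_finite_def
      prob_space_SN prob_space_imp_sigma_finite)

lemma sets_SN [measurable_cong, simp]: "sets SN = sets borel" by simp

lemma space_SN [simp]: "space SN = UNIV" by simp

lemma nn_integral_SN:
  "f \<in> borel_measurable borel \<Longrightarrow>
    (\<integral>\<^sup>+z. f z \<partial>SN) = (\<integral>\<^sup>+z. ennreal (std_normal_density z) * f z \<partial>lborel)"
  by (subst nn_integral_density) auto

text \<open>Completing the square; all exponential moments below reduce to this integral.\<close>

lemma gaussian_integral: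
  fixes a b :: real
  assumes "a < 1"
  shows "(\<integral>\<^sup>+z. ennreal (exp (b * z + a * z\<^sup>2 / 2)) \<partial>SN)
     = ennreal (exp (b\<^sup>2 / (2 * (1 - a))) / sqrt (1 - a))"
proof -
  define s where "s = 1 / sqrt (1 - a)"
  define \<mu> where "\<mu> = b / (1 - a)"
  have s: "s > 0" "s\<^sup>2 = 1 / (1 - a)"
    using assms by (auto simp: s_def power_divide)
  have *: "std_normal_density z * exp (b * z + a * z\<^sup>2 / 2)
      = (exp (b\<^sup>2 / (2 * (1 - a))) * s) * normal_density \<mu> s z" for z
  proof -
    have "- z\<^sup>2 / 2 + (b * z + a * z\<^sup>2 / 2) = b\<^sup>2 / (2 * (1 - a)) + - (z - \<mu>)\<^sup>2 / (2 * s\<^sup>2)"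
    proof -
      define c where "c = 1 - a"
      have c: "a = 1 - c" "b = \<mu> * c" "c \<noteq> 0"
        using assms by (auto simp: \<mu>_def c_def)
      have s2: "s\<^sup>2 = 1 / c" using s(2) by (simp add: c_def)
      show ?thesis unfolding s2 c(1,2) using c(3)
        by (simp add: power2_eq_square field_simps)
    qed
    then have E: "exp (- z\<^sup>2 / 2) * exp (b * z + a * z\<^sup>2 / 2)
        = exp (b\<^sup>2 / (2 * (1 - a))) * exp (- (z - \<mu>)\<^sup>2 / (2 * s\<^sup>2))"
      by (simp only: exp_add[symmetric])
    have q: "1 / sqrt (2 * pi) = 1 / sqrt (2 * pi * s\<^sup>2) * s"
      using s(1) by (simp add: real_sqrt_mult)
    have "std_normal_density z * exp (b * z + a * z\<^sup>2 / 2)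
        = 1 / sqrt (2 * pi) * (exp (- z\<^sup>2 / 2) * exp (b * z + a * z\<^sup>2 / 2))"
      by (simp only: std_normal_density_def mult.assoc)
    also have "\<dots> = 1 / sqrt (2 * pi)
        * (exp (b\<^sup>2 / (2 * (1 - a))) * exp (- (z - \<mu>)\<^sup>2 / (2 * s\<^sup>2)))"
      by (simp only: E)
    also have "\<dots> = 1 / sqrt (2 * pi * s\<^sup>2) * s
        * (exp (b\<^sup>2 / (2 * (1 - a))) * exp (- (z - \<mu>)\<^sup>2 / (2 * s\<^sup>2)))"
      by (simp only: q)
    finally show ?thesis by (simp only: normal_density_def mult_ac)
  qed
  have "(\<integral>\<^sup>+z. ennreal (exp (b * z + a * z\<^sup>2 / 2)) \<partial>SN)
      = (\<integral>\<^sup>+z. ennreal (std_normal_density z * exp (b * z + a * z\<^sup>2 / 2)) \<partial>lborel)"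
    by (subst nn_integral_SN) (auto simp: ennreal_mult')
  also have "\<dots> = (\<integral>\<^sup>+z. ennreal (exp (b\<^sup>2 / (2 * (1
      - a))) * s) * ennreal (normal_density \<mu> s z) \<partial>lborel)"
    unfolding * using s by (simp add: ennreal_mult)
  also have "\<dots> = ennreal (exp (b\<^sup>2 / (2 * (1 - a))) * s) * 1"
    using s(1) by (simp add: nn_integral_cmult nn_integral_eq_integral)
  finally show ?thesis by (simp add: s_def)
qed

lemma shift_density:
  "distr SN borel (\<lambda>z. z + a) = density SN (\<lambda>z. ennreal (exp (a * z - a\<^sup>2 / 2)))"
proof -
  have "distributed SN lborel (\<lambda>z. z) std_normal_density"
    unfolding distributed_def by (auto simp: distr_id2)
  from prob_space.normal_density_affine[OF prob_space_SN, OF this, of 1 a]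
  have "distributed SN lborel (\<lambda>z. a + z) (normal_density a 1)" by simp
  then have "distr SN lborel (\<lambda>z. a + z) = density lborel (normal_density a 1)"
    by (simp add: distributed_def)
  moreover have "distr SN lborel (\<lambda>z. a + z) = distr SN borel (\<lambda>z. z + a)"
    by (intro distr_cong) (auto simp: add.commute)
  moreover have "density lborel (\<lambda>z. ennreal (normal_density a 1 z))
     = density SN (\<lambda>z. ennreal (exp (a * z - a\<^sup>2 / 2)))"
  proof (subst density_density_eq, simp, simp, rule density_cong)
    show "AE z in lborel. ennreal (normal_density a 1 z) =
        ennreal (std_normal_density z) * ennreal (exp (a * z - a\<^sup>2 / 2))"
    proof (rule AE_I2)
      fix z
      have "- (z - a)\<^sup>2 / 2 = - z\<^sup>2 / 2 + (a * z - a\<^sup>2 / 2)"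
        by (simp add: field_simps power2_eq_square)
      then have "exp (- (z - a)\<^sup>2 / 2) = exp (- z\<^sup>2 / 2) * exp (a * z - a\<^sup>2 / 2)"
        by (simp only: exp_add[symmetric])
      then show "ennreal (normal_density a 1 z) =
        ennreal (std_normal_density z) * ennreal (exp (a * z - a\<^sup>2 / 2))"
        by (simp add: ennreal_mult'[symmetric] normal_density_def)
    qed
  qed auto
  ultimately show ?thesis by simp
qed

lemma nn_integral_shift:
  assumes "f \<in> borel_measurable borel"
  shows "(\<integral>\<^sup>+z. f (z + a) \<partial>SN) = (\<integral>\<^sup>+z. ennreal (exp (a * z - a\<^sup>2 / 2)) * f z \<partial>SN)"
proof -
  have "(\<integral>\<^sup>+z. f (z + a) \<partial>SN) = (\<integral>\<^sup>+z. f z \<partial>distr SN borel (\<lambda>z. z + a))"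
    using assms by (subst nn_integral_distr) auto
  also have "\<dots> = (\<integral>\<^sup>+z. ennreal (exp (a * z - a\<^sup>2 / 2)) * f z \<partial>SN)"
    unfolding shift_density using assms by (subst nn_integral_density) auto
  finally show ?thesis .
qed

text \<open>Coordinatewise shifts of a product Gaussian: this turns the law of the data into a density
with respect to pure noise, so that laws for different labels live on one space.\<close>

lemma cameron_martin:
  fixes a :: "'i \<Rightarrow> real"
  assumes I: "finite I" and f [measurable]: "f \<in> borel_measurable (PiM I (\<lambda>_. SN))"
  shows "(\<integral>\<^sup>+x. f (\<lambda>i\<in>I. x i + a i) \<partial>PiM I (\<lambda>_. SN))
     = (\<integral>\<^sup>+x. ennreal (exp (\<Sum>i\<in>I. a i * x i - (a i)\<^sup>2 / 2)) * f x \<partial>PiM I (\<lambda>_. SN))"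
  using I f
proof (induction I arbitrary: f rule: finite_induct)
  case empty
  then show ?case by (simp add: PiM_empty nn_integral_count_space_finite)
next
  case (insert i I)
  note [measurable] = insert.prems
  let ?w = "\<lambda>x. ennreal (exp (\<Sum>j\<in>I. a j * x j - (a j)\<^sup>2 / 2))"
  let ?v = "\<lambda>y. ennreal (exp (a i * y - (a i)\<^sup>2 / 2))"
  have upd: "(\<lambda>j\<in>insert i I. (x(i := y)) j + a j) = (\<lambda>j\<in>I. x j + a j)(i := y + a i)" for x y
    using insert.hyps by (auto simp: restrict_def fun_eq_iff)
  have eI: "(\<Sum>j\<in>insert i I. a j * (x(i := y)) j - (a j)\<^sup>2 / 2)
      = (a i * y - (a i)\<^sup>2 / 2) + (\<Sum>j\<in>I. a j * x j - (a j)\<^sup>2 / 2)" for x y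
  proof -
    have "(\<Sum>j\<in>I. a j * (x(i := y)) j - (a j)\<^sup>2 / 2) = (\<Sum>j\<in>I. a j * x j - (a j)\<^sup>2 / 2)"
      using insert.hyps by (intro sum.cong) auto
    then show ?thesis using insert.hyps by simp
  qed
  have [measurable]: "(\<lambda>(x, y). x(i := y)) \<in> PiM I (\<lambda>_. SN) \<Otimes>\<^sub>M borel \<rightarrow>\<^sub>M PiM (insert i I) (\<lambda>_. SN)"
    using measurable_add_dim[of i I "\<lambda>_. SN"] by simp
  have slice: "(\<lambda>y. f (x(i := y))) \<in> borel_measurable borel" if "x \<in> space (PiM I (\<lambda>_. SN))" for x
  proof -
    have "(\<lambda>y. (\<lambda>(x, y). x(i := y)) (x, y)) \<in> borel \<rightarrow>\<^sub>M PiM (insert i I) (\<lambda>_. SN)"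
      using that by measurable
    then show ?thesis by (auto intro!: measurable_compose[OF _ insert.prems])
  qed
  have "(\<integral>\<^sup>+x. f (\<lambda>j\<in>insert i I. x j + a j) \<partial>PiM (insert i I) (\<lambda>_. SN))
      = (\<integral>\<^sup>+x. (\<integral>\<^sup>+y. f ((\<lambda>j\<in>I. x j + a j)(i := y + a i)) \<partial>SN) \<partial>PiM I (\<lambda>_. SN))"
    proof (subst SN.product_nn_integral_insert[OF insert.hyps])
    show "(\<lambda>x. f (\<lambda>j\<in>insert i I. x j + a j)) \<in> borel_measurable (PiM (insert i I) (\<lambda>_. SN))"
      by measurable
  qed (simp only: upd)
  also have "\<dots> = (\<integral>\<^sup>+x. (\<integral>\<^sup>+y. ?v y * f ((\<lambda>j\<in>I. x j + a j)(i := y)) \<partial>SN) \<partial>PiM I (\<lambda>_. SN))"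
    by (intro nn_integral_cong nn_integral_shift slice) (auto simp: space_PiM)
  also have "\<dots> = (\<integral>\<^sup>+x. ?w x * (\<integral>\<^sup>+y. ?v y * f (x(i := y)) \<partial>SN) \<partial>PiM I (\<lambda>_. SN))"
    by (rule insert.IH) measurable
  also have "\<dots> = (\<integral>\<^sup>+x. (\<integral>\<^sup>+y. ?w x * (?v y * f (x(i := y))) \<partial>SN) \<partial>PiM I (\<lambda>_. SN))"
  proof (intro nn_integral_cong nn_integral_cmult[symmetric])
    fix x assume "x \<in> space (PiM I (\<lambda>_::'i. SN))"
    note slice[OF this, measurable]
    show "(\<lambda>y. ?v y * f (x(i := y))) \<in> borel_measurable SN" by measurable
  qed
  also have "\<dots> = (\<integral>\<^sup>+x. (\<integral>\<^sup>+y. ennreal (exp (\<Sum>j\<in>insert i I. a j * (x(i := y)) j - (a j)\<^sup>2 / 2))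
        * f (x(i := y)) \<partial>SN) \<partial>PiM I (\<lambda>_. SN))"
    by (intro nn_integral_cong) (simp only: eI exp_add ennreal_mult'[OF exp_ge_zero] mult_ac)
  also have "\<dots> = (\<integral>\<^sup>+x. ennreal (exp (\<Sum>j\<in>insert i I. a j * x j - (a j)\<^sup>2 / 2)) * f x
      \<partial>PiM (insert i I) (\<lambda>_. SN))"
    using insert.hyps by (subst SN.product_nn_integral_insert) auto
  finally show ?case .
qed

lemma indep_coordinates:
  assumes "finite I" "I \<noteq> {}"
  shows "prob_space.indep_vars (PiM I (\<lambda>_. SN)) (\<lambda>_. borel) (\<lambda>i x. x i) I"
proof -
  interpret P: prob_space "PiM I (\<lambda>_. SN)" by (intro prob_space_PiM prob_space_SN)
  have *: "distr (PiM I (\<lambda>_. SN)) borel (\<lambda>x. x i) = SN" if "i \<in> I" for i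
  proof -
    have "distr (PiM I (\<lambda>_. SN)) SN (\<lambda>x. x i) = SN"
      using that assms prob_space_SN by (intro distr_PiM_component) auto
    moreover have "distr (PiM I (\<lambda>_. SN)) SN (\<lambda>x. x i) = distr (PiM I (\<lambda>_. SN)) borel (\<lambda>x. x i)"
      by (intro distr_cong) auto
    ultimately show ?thesis by simp
  qed
  have "distr (PiM I (\<lambda>_. SN)) (PiM I (\<lambda>_. borel)) (\<lambda>x. \<lambda>i\<in>I. x i)
      = distr (PiM I (\<lambda>_. SN)) (PiM I (\<lambda>_. SN)) (\<lambda>x. x)"
    by (intro distr_cong sets_PiM_cong) (auto simp: space_PiM)
  also have "\<dots> = PiM I (\<lambda>i. distr (PiM I (\<lambda>_. SN)) borel (\<lambda>x. x i))"
    unfolding distr_id by (intro PiM_cong) (auto simp: *)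
  finally show ?thesis
    using assms by (subst P.indep_vars_iff_distr_eq_PiM') auto
qed

text \<open>A linear form of independent standard normal variables is normal; vanishing coefficients
are dropped first, since the density of a degenerate normal variable does not exist.\<close>

lemma gaussian_linear_form:
  fixes c :: "'i \<Rightarrow> real"
  assumes J: "finite J" "J \<subseteq> I" "finite I" and g [measurable]: "g \<in> borel_measurable borel"
  shows "(\<integral>\<^sup>+x. g (\<Sum>j\<in>J. c j * x j) \<partial>PiM I (\<lambda>_. SN))
     = (\<integral>\<^sup>+z. g (sqrt (\<Sum>j\<in>J. (c j)\<^sup>2) * z) \<partial>SN)"
proof -
  interpret P: prob_space "PiM I (\<lambda>_. SN)" by (intro prob_space_PiM prob_space_SN)
  define J' where "J' = {j \<in> J. c j \<noteq> 0}"
  have 1: "(\<Sum>j\<in>J. c j * x j) = (\<Sum>j\<in>J'. c j * x j)" for x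
    unfolding J'_def using J by (intro sum.mono_neutral_right) auto
  have 2: "(\<Sum>j\<in>J. (c j)\<^sup>2) = (\<Sum>j\<in>J'. (c j)\<^sup>2)"
    unfolding J'_def using J by (intro sum.mono_neutral_right) auto
  show ?thesis
  proof (cases "J' = {}")
    case True
    then show ?thesis unfolding 1 2
      by (simp add: P.emeasure_space_1 prob_space.emeasure_space_1[OF prob_space_SN, simplified])
  next
    case False
    have fin: "finite J'" "J' \<subseteq> I" using J by (auto simp: J'_def)
    then have I: "I \<noteq> {}" using False by auto
    define s where "s = sqrt (\<Sum>j\<in>J'. (c j)\<^sup>2)"
    have s: "s > 0" unfolding s_def
      using fin False by (auto simp: J'_def intro!: sum_pos)
    have "P.indep_vars (\<lambda>_. borel) (\<lambda>j x. c j * x j) J'"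
      by (rule P.indep_vars_compose2[OF P.indep_vars_subset[OF indep_coordinates[OF J(3) I]
          fin(2)]]) simp
    moreover have "distributed (PiM I (\<lambda>_. SN)) lborel (\<lambda>x. c j * x j) (normal_density 0 \<bar>c j\<bar>)"
      if "j \<in> J'" for j
    proof -
      have "distr (PiM I (\<lambda>_. SN)) SN (\<lambda>x. x j) = SN"
        using that fin J prob_space_SN by (intro distr_PiM_component) auto
      moreover have "distr (PiM I (\<lambda>_. SN)) SN (\<lambda>x. x j) = distr (PiM I (\<lambda>_. SN)) lborel (\<lambda>x. x j)"
        by (intro distr_cong) auto
      ultimately have "distributed (PiM I (\<lambda>_. SN)) lborel (\<lambda>x. x j) std_normal_density"
        unfolding distributed_def using that fin by auto
      from P.normal_density_affine[OF this, of "c j" 0] show ?thesis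
        using that by (simp add: J'_def)
    qed
    ultimately have D: "distributed (PiM I (\<lambda>_. SN)) lborel (\<lambda>x. \<Sum>j\<in>J'. c j
        * x j) (normal_density 0 s)"
      using P.sum_indep_normal[of J' "\<lambda>j x. c j * x j" "\<lambda>j. \<bar>c j\<bar>" "\<lambda>_. 0"] fin False
      by (auto simp: J'_def s_def)
    have "distributed SN lborel (\<lambda>z. z) std_normal_density"
      unfolding distributed_def by (auto simp: distr_id2)
    from prob_space.normal_density_affine[OF prob_space_SN, OF this, of s 0] s
    have D': "distributed SN lborel (\<lambda>z. s * z) (normal_density 0 s)" by simp
    show ?thesis unfolding 1 2 s_def[symmetric]
      using distributed_nn_integral[OF D, of g] distributed_nn_integral[OF D', of g] by simp
  qed
qed

lemma nn_integral_row:
  fixes f :: "('b \<Rightarrow> real) \<Rightarrow> ennreal"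
  assumes "finite I" "finite B" "\<And>j. j \<in> B \<Longrightarrow> (r, j) \<in> I"
    and [measurable]: "f \<in> borel_measurable (PiM B (\<lambda>_. SN))"
  shows "(\<integral>\<^sup>+x. f (\<lambda>j\<in>B. x (r, j)) \<partial>PiM I (\<lambda>_. SN)) = (\<integral>\<^sup>+x. f x \<partial>PiM B (\<lambda>_. SN))"
proof -
  have [measurable]: "(\<lambda>x. \<lambda>j\<in>B. x (r, j)) \<in> PiM I (\<lambda>_. SN) \<rightarrow>\<^sub>M PiM B (\<lambda>_. SN)"
    using assms(3) by (intro measurable_restrict measurable_component_singleton) auto
  have "distr (PiM I (\<lambda>_. SN)) (PiM B (\<lambda>_. SN)) (\<lambda>x. \<lambda>j\<in>B. x (r, j)) = PiM B (\<lambda>_. SN)"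
    using assms(3) prob_space_SN by (intro distr_PiM_reindex) (auto simp: inj_on_def)
  then have "(\<integral>\<^sup>+x. f x \<partial>PiM B (\<lambda>_. SN))
      = (\<integral>\<^sup>+x. f x \<partial>distr (PiM I (\<lambda>_. SN)) (PiM B (\<lambda>_. SN)) (\<lambda>x. \<lambda>j\<in>B. x (r, j)))"
    by simp
  also have "\<dots> = (\<integral>\<^sup>+x. f (\<lambda>j\<in>B. x (r, j)) \<partial>PiM I (\<lambda>_. SN))"
    by (subst nn_integral_distr) auto
  finally show ?thesis by simp
qed

text \<open>The rows of the noise matrix are independent, so expectations of products over rows
factorize.\<close>

lemma nn_integral_rows:
  fixes f :: "'a \<Rightarrow> ('b \<Rightarrow> real) \<Rightarrow> ennreal"
  assumes "finite A" "finite B"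
    and "\<And>r. r \<in> A \<Longrightarrow> f r \<in> borel_measurable (PiM B (\<lambda>_. SN))"
  shows "(\<integral>\<^sup>+x. (\<Prod>r\<in>A. f r (\<lambda>j\<in>B. x (r, j))) \<partial>PiM (A \<times> B) (\<lambda>_. SN))
     = (\<Prod>r\<in>A. \<integral>\<^sup>+x. f r x \<partial>PiM B (\<lambda>_. SN))"
  using assms(1,3)
proof (induction A rule: finite_induct)
  case empty
  interpret P: prob_space "PiM {} (\<lambda>_::'a \<times> 'b. SN)" by (intro prob_space_PiM prob_space_SN)
  show ?case using P.emeasure_space_1 by simp
next
  case (insert a A)
  note [simp] = insert.hyps assms(2)
  have un: "insert a A \<times> B = A \<times> B \<union> {a} \<times> B" by auto
  have row: "(\<lambda>x. f r (\<lambda>j\<in>B. x (r, j))) \<in> borel_measurable (PiM I (\<lambda>_. SN))"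
    if "r \<in> insert a A" "\<And>j. j \<in> B \<Longrightarrow> (r, j) \<in> I" for r I
    using that(2)
    by (intro measurable_compose[OF _ insert.prems[OF that(1)]] measurable_restrict
        measurable_component_singleton) auto
  have "(\<integral>\<^sup>+x. (\<Prod>r\<in>insert a A. f r (\<lambda>j\<in>B. x (r, j))) \<partial>PiM (insert a A \<times> B) (\<lambda>_. SN))
     = (\<integral>\<^sup>+x. (\<integral>\<^sup>+y. (\<Prod>r\<in>insert a A. f r (\<lambda>j\<in>B. merge (A \<times> B) ({a} \<times> B) (x, y) (r, j)))
        \<partial>PiM ({a} \<times> B) (\<lambda>_. SN)) \<partial>PiM (A \<times> B) (\<lambda>_. SN))"
    unfolding un
    by (rule SN.product_nn_integral_fold) (auto intro!: borel_measurable_times_ennreal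
        borel_measurable_prod_ennreal row)
  also have "\<dots> = (\<integral>\<^sup>+x. (\<integral>\<^sup>+y. (\<Prod>r\<in>A. f r (\<lambda>j\<in>B. x (r, j))) * f a (\<lambda>j\<in>B. y (a, j))
        \<partial>PiM ({a} \<times> B) (\<lambda>_. SN)) \<partial>PiM (A \<times> B) (\<lambda>_. SN))"
  proof (intro nn_integral_cong)
    fix x y :: "'a \<times> 'b \<Rightarrow> real"
    have "(\<Prod>r\<in>A. f r (\<lambda>j\<in>B. merge (A \<times> B) ({a} \<times> B) (x, y) (r, j)))
        = (\<Prod>r\<in>A. f r (\<lambda>j\<in>B. x (r, j)))"
      by (intro prod.cong refl arg_cong[where f = "f _"] restrict_ext) (auto simp: merge_def)
    moreover have "f a (\<lambda>j\<in>B. merge (A \<times> B) ({a} \<times> B) (x, y) (a, j)) = f a (\<lambda>j\<in>B. y (a, j))"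
      by (intro arg_cong[where f = "f _"] restrict_ext) (auto simp: merge_def)
    ultimately show "(\<Prod>r\<in>insert a A. f r (\<lambda>j\<in>B. merge (A \<times> B) ({a} \<times> B) (x, y) (r, j)))
        = (\<Prod>r\<in>A. f r (\<lambda>j\<in>B. x (r, j))) * f a (\<lambda>j\<in>B. y (a, j))"
      by (simp add: mult.commute)
  qed
  also have "\<dots> = (\<integral>\<^sup>+x. (\<Prod>r\<in>A. f r (\<lambda>j\<in>B. x (r, j))) * (\<integral>\<^sup>+y. f a y \<partial>PiM B (\<lambda>_. SN))
        \<partial>PiM (A \<times> B) (\<lambda>_. SN))"
    by (intro nn_integral_cong, subst nn_integral_cmult)
      (auto intro!: row simp: nn_integral_row insert.prems)
  also have "\<dots> = (\<integral>\<^sup>+x. (\<Prod>r\<in>A. f r (\<lambda>j\<in>B. x (r, j))) \<partial>PiM (A \<times> B) (\<lambda>_. SN))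
      * (\<integral>\<^sup>+y. f a y \<partial>PiM B (\<lambda>_. SN))"
    by (rule nn_integral_multc) (auto intro!: borel_measurable_times_ennreal
        borel_measurable_prod_ennreal row)
  also have "\<dots> = (\<Prod>r\<in>insert a A. \<integral>\<^sup>+x. f r x \<partial>PiM B (\<lambda>_. SN))"
    using insert.prems by (subst insert.IH) (simp_all add: mult.commute)
  finally show ?case .
qed

lemma gaussian_rows:
  fixes c :: "nat \<Rightarrow> real" and f :: "nat \<Rightarrow> real \<Rightarrow> ennreal"
  assumes "\<And>r. r < p \<Longrightarrow> f r \<in> borel_measurable borel"
  shows "(\<integral>\<^sup>+x. (\<Prod>r<p. f r (\<Sum>j<n. c j * x (r, j))) \<partial>noise p n)
     = (\<Prod>r<p. \<integral>\<^sup>+z. f r (sqrt (\<Sum>j<n. (c j)\<^sup>2) * z) \<partial>SN)"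
proof -
  have "(\<integral>\<^sup>+x. (\<Prod>r<p. f r (\<Sum>j<n. c j * x (r, j))) \<partial>noise p n)
      = (\<integral>\<^sup>+x. (\<Prod>r<p. f r (\<Sum>j<n. c j * (\<lambda>j\<in>{..<n}. x (r, j)) j)) \<partial>noise p n)"
    by (intro nn_integral_cong prod.cong refl arg_cong[where f = "f _"] sum.cong) auto
  also have "\<dots> = (\<Prod>r<p. \<integral>\<^sup>+x. f r (\<Sum>j<n. c j * x j) \<partial>PiM {..<n} (\<lambda>_. SN))"
    unfolding noise_def
  proof (rule nn_integral_rows)
    fix r assume r: "r \<in> {..<p}"
    then have [measurable]: "f r \<in> borel_measurable borel" using assms by simp
    show "(\<lambda>x. f r (\<Sum>j<n. c j * x j)) \<in> borel_measurable (PiM {..<n} (\<lambda>_. SN))"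
      by measurable
  qed auto
  also have "\<dots> = (\<Prod>r<p. \<integral>\<^sup>+z. f r (sqrt (\<Sum>j<n. (c j)\<^sup>2) * z) \<partial>SN)"
    using assms by (intro prod.cong refl gaussian_linear_form) auto
  finally show ?thesis .
qed

text \<open>Entry \<open>i\<close> of a row is independent of a linear form of the other entries. This is the
geometry of testing label \<open>i\<close> when the other labels are known.\<close>

lemma gaussian_rows_split:
  fixes c :: "nat \<Rightarrow> real" and f :: "nat \<Rightarrow> real \<Rightarrow> real \<Rightarrow> ennreal"
  assumes "i < n" and f: "\<And>r. r < p \<Longrightarrow> case_prod (f r) \<in> borel_measurable (borel \<Otimes>\<^sub>M borel)"
  shows "(\<integral>\<^sup>+x. (\<Prod>r<p. f r (x (r, i)) (\<Sum>j\<in>{..<n} - {i}. c j * x (r, j))) \<partial>noise p n)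
     = (\<Prod>r<p. \<integral>\<^sup>+y. (\<integral>\<^sup>+z. f r y (sqrt (\<Sum>j\<in>{..<n} - {i}. (c j)\<^sup>2) * z) \<partial>SN) \<partial>SN)"
proof -
  let ?B = "{..<n} - {i}"
  have B: "{..<n} = insert i ?B" using assms(1) by auto
  have "(\<integral>\<^sup>+x. (\<Prod>r<p. f r (x (r, i)) (\<Sum>j\<in>?B. c j * x (r, j))) \<partial>noise p n)
      = (\<integral>\<^sup>+x. (\<Prod>r<p. (\<lambda>y. f r (y i) (\<Sum>j\<in>?B. c j * y j)) (\<lambda>j\<in>{..<n}. x (r, j))) \<partial>noise p n)"
    using assms(1) by (intro nn_integral_cong prod.cong refl) simp
  also have "\<dots> = (\<Prod>r<p. \<integral>\<^sup>+x. f r (x i) (\<Sum>j\<in>?B. c j * x j) \<partial>PiM {..<n} (\<lambda>_. SN))"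
    unfolding noise_def
  proof (rule nn_integral_rows)
    fix r assume r: "r \<in> {..<p}"
    then have [measurable]: "case_prod (f r) \<in> borel_measurable (borel \<Otimes>\<^sub>M borel)" using f by simp
    have [measurable]: "(\<lambda>x. x i) \<in> borel_measurable (PiM {..<n} (\<lambda>_. SN))"
      using assms(1) measurable_component_singleton[of i "{..<n}" "\<lambda>_. SN"] by simp
    have [measurable]: "(\<lambda>x. \<Sum>j\<in>?B. c j * x j) \<in> borel_measurable (PiM {..<n} (\<lambda>_. SN))"
      by (intro borel_measurable_sum borel_measurable_times borel_measurable_const)
        (use measurable_component_singleton[of _ "{..<n}" "\<lambda>_. SN"] in auto)
    show "(\<lambda>x. f r (x i) (\<Sum>j\<in>?B. c j * x j)) \<in> borel_measurable (PiM {..<n} (\<lambda>_. SN))"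
      by measurable
  qed auto
  also have "\<dots> = (\<Prod>r<p. \<integral>\<^sup>+y. (\<integral>\<^sup>+z. f r y (sqrt (\<Sum>j\<in>?B. (c j)\<^sup>2) * z) \<partial>SN) \<partial>SN)"
  proof (intro prod.cong refl)
    fix r assume r: "r \<in> {..<p}"
    then have [measurable]: "case_prod (f r) \<in> borel_measurable (borel \<Otimes>\<^sub>M borel)" using f by simp
    have [simp]: "i \<in> insert i ?B" by simp
    have "(\<integral>\<^sup>+x. f r (x i) (\<Sum>j\<in>?B. c j * x j) \<partial>PiM {..<n} (\<lambda>_. SN))
        = (\<integral>\<^sup>+y. (\<integral>\<^sup>+x. f r ((x(i := y)) i) (\<Sum>j\<in>?B. c j * (x(i := y)) j)
            \<partial>PiM ?B (\<lambda>_. SN)) \<partial>SN)"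
      by (subst B, rule SN.product_nn_integral_insert_rev) measurable
    also have "\<dots> = (\<integral>\<^sup>+y. (\<integral>\<^sup>+x. f r y (\<Sum>j\<in>?B. c j * x j) \<partial>PiM ?B (\<lambda>_. SN)) \<partial>SN)"
      by (intro nn_integral_cong arg_cong2[where f = "f r"] sum.cong) auto
    also have "\<dots> = (\<integral>\<^sup>+y. (\<integral>\<^sup>+z. f r y (sqrt (\<Sum>j\<in>?B. (c j)\<^sup>2) * z) \<partial>SN) \<partial>SN)"
      by (intro nn_integral_cong gaussian_linear_form) auto
    finally show "(\<integral>\<^sup>+x. f r (x i) (\<Sum>j\<in>?B. c j * x j) \<partial>PiM {..<n} (\<lambda>_. SN))
        = (\<integral>\<^sup>+y. (\<integral>\<^sup>+z. f r y (sqrt (\<Sum>j\<in>?B. (c j)\<^sup>2) * z) \<partial>SN) \<partial>SN)" .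
  qed
  finally show ?thesis .
qed

section \<open>The critical separation\<close>

text \<open>The value of \<open>\<parallel>\<theta>\<parallel>\<^sup>2 / \<sigma>\<^sup>2\<close> at the critical separation.\<close>

definition crit :: "nat \<Rightarrow> nat \<Rightarrow> real" where
  "crit p n = (1 + sqrt (1 + 2 * real p / (real n * ln (real n)))) * ln (real n)"

lemma critical_sep_crit: "critical_sep p n \<sigma> = sqrt (\<sigma>\<^sup>2 * crit p n)"
  unfolding critical_sep_def crit_def by (simp add: mult.assoc)

lemma crit_ge: "n \<ge> 2 \<Longrightarrow> 2 * ln (real n) \<le> crit p n"
  unfolding crit_def by (intro mult_right_mono) auto

lemma crit_pos: "n \<ge> 2 \<Longrightarrow> 0 < crit p n"
  using crit_ge[of n p] ln_gt_zero[of "real n"] by linarith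

text \<open>The defining quadratic equation: at the critical separation the effective signal-to-noise
ratio \<open>x\<^sup>2 / (x + p / n)\<close> equals \<open>2 ln n\<close>.\<close>

lemma crit_square:
  assumes "n \<ge> 2"
  shows "(crit p n)\<^sup>2 = 2 * ln (real n) * (crit p n + real p / real n)"
proof -
  let ?l = "ln (real n)"
  have l: "?l > 0" using assms by simp
  define w where "w = sqrt (1 + 2 * real p / (real n * ?l))"
  have w: "w\<^sup>2 = 1 + 2 * real p / (real n * ?l)"
    unfolding w_def using l by (intro real_sqrt_pow2) (simp add: add_nonneg_nonneg)
  have "((1 + w) * ?l)\<^sup>2 = ?l\<^sup>2 * (1 + 2 * w + w\<^sup>2)" by (simp add: power2_eq_square algebra_simps)
  also have "\<dots> = ?l\<^sup>2 * (2 * (1 + w)) + ?l\<^sup>2 * (2 * real p / (real n * ?l))"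
    unfolding w by (simp add: algebra_simps)
  also have "\<dots> = 2 * ?l * ((1 + w) * ?l + real p / real n)"
    using l assms by (simp add: power2_eq_square field_simps)
  finally show ?thesis by (simp add: crit_def w_def)
qed

text \<open>For \<open>x = d * crit p n\<close> with \<open>d \<le> 1\<close>, passing from \<open>d * (p / n)\<close> to \<open>p / n\<close> only increases the
right-hand side; one of the two factors \<open>d\<close> in \<open>x\<^sup>2\<close> survives as the gain \<open>c\<close>.\<close>

lemma below_crit:
  assumes "n \<ge> 2" "0 \<le> x" "x \<le> c * crit p n" "0 \<le> c" "c \<le> 1"
  shows "x\<^sup>2 \<le> 2 * c * ln (real n) * (x + real p / real n)"
proof -
  define d where "d = x / crit p n"
  have xb: "crit p n > 0" by (rule crit_pos[OF assms(1)])
  have d: "x = d * crit p n" "0 \<le> d" "d \<le> c" using assms xb by (auto simp: d_def field_simps)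
  have l: "ln (real n) \<ge> 0" using assms(1) by simp
  have "x\<^sup>2 = d * (2 * ln (real n) * (d * crit p n + d * (real p / real n)))"
    unfolding d(1) power_mult_distrib crit_square[OF assms(1)]
        by (simp add: power2_eq_square algebra_simps)
  also have "\<dots> \<le> c * (2 * ln (real n) * (d * crit p n + 1 * (real p / real n)))"
    using d assms l xb by (intro mult_mono add_mono) auto
  finally show ?thesis unfolding d(1) by (simp add: mult_ac)
qed

lemma above_crit:
  assumes "n \<ge> 2" "c * crit p n \<le> x" "1 \<le> c"
  shows "2 * c * ln (real n) * (x + real p / real n) \<le> x\<^sup>2"
proof -
  define d where "d = x / crit p n"
  have xb: "crit p n > 0" by (rule crit_pos[OF assms(1)])
  have d: "x = d * crit p n" "c \<le> d" using assms xb by (auto simp: d_def field_simps)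
  have l: "ln (real n) \<ge> 0" using assms(1) by simp
  have "2 * c * ln (real n) * (x + real p / real n)
      = c * (2 * ln (real n) * (d * crit p n + 1 * (real p / real n)))"
    unfolding d(1) by (simp add: mult_ac)
  also have "\<dots> \<le> d * (2 * ln (real n) * (d * crit p n + d * (real p / real n)))"
    using d assms l xb by (intro mult_mono add_mono mult_nonneg_nonneg) auto
  also have "\<dots> = x\<^sup>2"
    unfolding d(1) power_mult_distrib crit_square[OF assms(1)]
        by (simp add: power2_eq_square algebra_simps)
  finally show ?thesis .
qed

text \<open>In low dimension the correction for the unknown centre is negligible.\<close>

lemma crit_le_low_dim:
  assumes "n \<ge> 2" "0 \<le> d" "real p \<le> d * (real n * ln (real n))"
  shows "crit p n \<le> (2 + d) * ln (real n)"
proof -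
  have l: "ln (real n) > 0" using assms(1) by simp
  have "2 * real p / (real n * ln (real n)) \<le> 2 * d"
    using assms l by (simp add: divide_le_eq mult_ac)
  then have "1 + 2 * real p / (real n * ln (real n)) \<le> 1 + 2 * d + d * d"
    using zero_le_square[of d] by linarith
  also have "\<dots> = (1 + d)\<^sup>2" by (simp add: power2_eq_square algebra_simps)
  finally have "sqrt (1 + 2 * real p / (real n * ln (real n))) \<le> sqrt ((1 + d)\<^sup>2)"
    by (rule real_sqrt_le_mono)
  then have "1 + sqrt (1 + 2 * real p / (real n * ln (real n))) \<le> 2 + d" using assms by simp
  then show ?thesis unfolding crit_def using l by (intro mult_right_mono) auto
qed


section \<open>Data, risk and loss\<close>

lemma space_data_space: "space (data_space p n) = carrier_mat p n"
  unfolding data_space_def by (rule space_vimage_algebra)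

lemma measurable_entry [measurable]:
  assumes "i < p" "j < n"
  shows "(\<lambda>Y. Y $$ (i, j)) \<in> borel_measurable (data_space p n)"
proof -
  have "(\<lambda>Y. restrict (($$) Y) ({..<p} \<times> {..<n}))
      \<in> data_space p n \<rightarrow>\<^sub>M (\<Pi>\<^sub>M _\<in>{..<p} \<times> {..<n}. borel :: real measure)"
    unfolding data_space_def by (rule measurable_vimage_algebra1) (auto simp: space_PiM)
  moreover have "(\<lambda>f. f (i, j)) \<in> (\<Pi>\<^sub>M _\<in>{..<p} \<times> {..<n}. borel :: real measure) \<rightarrow>\<^sub>M borel"
    using assms by (intro measurable_component_singleton) auto
  ultimately have "(\<lambda>Y. restrict (($$) Y) ({..<p} \<times> {..<n}) (i, j))
      \<in> borel_measurable (data_space p n)"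
    by (rule measurable_compose)
  then show ?thesis using assms by simp
qed

lemma measurable_noise_entry [measurable]:
  "i < p \<Longrightarrow> j < n \<Longrightarrow> (\<lambda>x. x (i, j)) \<in> borel_measurable (noise p n)"
  unfolding noise_def
  using measurable_component_singleton[of "(i, j)" "{..<p} \<times> {..<n}" "\<lambda>_. SN"] by simp

lemma prob_space_noise: "prob_space (noise p n)"
  unfolding noise_def by (intro prob_space_PiM prob_space_SN)

lemma measurable_mat:
  assumes "\<And>i j. i < p \<Longrightarrow> j < n \<Longrightarrow> (\<lambda>x. f x (i, j)) \<in> borel_measurable M"
  shows "(\<lambda>x. mat p n (f x)) \<in> M \<rightarrow>\<^sub>M data_space p n"
  unfolding data_space_def
proof (rule measurable_vimage_algebra2)
  have "(\<lambda>x. \<lambda>ij\<in>{..<p} \<times> {..<n}. f x ij) \<in> M \<rightarrow>\<^sub>M (\<Pi>\<^sub>M _\<in>{..<p} \<times> {..<n}. borel)"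
    using assms by (intro measurable_restrict) auto
  moreover have "(\<lambda>x. restrict (($$) (mat p n (f x))) ({..<p} \<times> {..<n}))
      = (\<lambda>x. \<lambda>ij\<in>{..<p} \<times> {..<n}. f x ij)"
    by (intro ext restrict_ext) auto
  ultimately show "(\<lambda>x. restrict (($$) (mat p n (f x))) ({..<p} \<times> {..<n}))
      \<in> M \<rightarrow>\<^sub>M (\<Pi>\<^sub>M _\<in>{..<p} \<times> {..<n}. borel)" by simp
qed auto

lemma finite_sign_vecs: "finite (sign_vecs n)"
proof -
  have "sign_vecs n \<subseteq> (\<lambda>f. vec n f) ` ({..<n} \<rightarrow>\<^sub>E {-1, 1 :: real})"
  proof
    fix v assume v: "v \<in> sign_vecs n"
    then have "v = vec n (\<lambda>j\<in>{..<n}. vec_index v j)" "(\<lambda>j\<in>{..<n}. vec_index v j)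
        \<in> {..<n} \<rightarrow>\<^sub>E {-1, 1 :: real}"
      by (auto simp: sign_vecs_def)
    then show "v \<in> (\<lambda>f. vec n f) ` ({..<n} \<rightarrow>\<^sub>E {-1, 1 :: real})" by blast
  qed
  then show ?thesis by (rule finite_subset) (auto intro: finite_PiE)
qed

lemma sign_square:
  assumes "\<eta> \<in> sign_vecs n" "i < n" shows "(vec_index \<eta> i)\<^sup>2 = 1"
proof -
  have "vec_index \<eta> i \<in> {-1, 1}" using assms by (auto simp: sign_vecs_def)
  then show ?thesis by auto
qed

lemma sum_sign_squares:
  assumes "\<eta> \<in> sign_vecs n" "i < n"
  shows "(\<Sum>j\<in>{..<n}-{i}. (vec_index \<eta> j)\<^sup>2) = real n - 1"
proof -
  have "(\<Sum>j\<in>{..<n}-{i}. (vec_index \<eta> j)\<^sup>2) = (\<Sum>j\<in>{..<n}-{i}. 1)"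
    using assms(1) by (intro sum.cong refl sign_square) auto
  then show ?thesis using assms(2) by (simp add: of_nat_diff)
qed

lemma measurable_sign_vecs_fun:
  assumes "T \<in> estimators p n" "g \<in> M \<rightarrow>\<^sub>M data_space p n"
  shows "(\<lambda>x. h (T (g x))) \<in> borel_measurable M"
proof -
  have T: "T \<in> data_space p n \<rightarrow>\<^sub>M count_space (sign_vecs n)"
    using assms(1) by (simp add: estimators_def)
  have "h \<in> borel_measurable (count_space (sign_vecs n))" by (rule borel_measurable_count_space)
  from measurable_compose[OF measurable_compose[OF assms(2) T] this] show ?thesis .
qed

lemma risk_noise:
  assumes "T \<in> estimators p n" "\<theta> \<in> carrier_vec p"
  shows "risk p n \<sigma> T \<theta> \<eta> = (\<integral>\<^sup>+x. ennreal (loss n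
      (T (mat p n (\<lambda>(i, j). vec_index \<theta> i * vec_index \<eta> j + \<sigma> * x (i, j)))) \<eta>) \<partial>noise p n)"
proof -
  have "(\<lambda>x. mat p n (\<lambda>(i, j). vec_index \<theta> i * vec_index \<eta> j + \<sigma> * x (i, j)))
      \<in> noise p n \<rightarrow>\<^sub>M data_space p n"
    by (rule measurable_mat) (auto intro!: borel_measurable_add borel_measurable_times
        measurable_noise_entry)
  moreover have "(\<lambda>Y. ennreal (loss n (T Y) \<eta>)) \<in> borel_measurable (data_space p n)"
    by (rule measurable_sign_vecs_fun[OF assms(1) measurable_ident_sets[OF refl]])
  ultimately show ?thesis
    unfolding risk_def data_law_def by (subst nn_integral_distr) simp_all
qed

lemma estimator_sign: "T \<in> estimators p n \<Longrightarrow> Y \<in> carrier_mat p n \<Longrightarrow> T Y \<in> sign_vecs n"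
  unfolding estimators_def by (drule measurable_space) (simp_all add: space_data_space)

lemma measurable_estimator:
  assumes "\<And>Y. Y \<in> carrier_mat p n \<Longrightarrow> T Y \<in> sign_vecs n"
    and [measurable]: "\<And>j. j < n \<Longrightarrow> (\<lambda>Y. vec_index (T Y) j) \<in> borel_measurable (data_space p n)"
  shows "T \<in> estimators p n"
  unfolding estimators_def
proof (subst measurable_count_space_eq2, rule finite_sign_vecs, intro conjI ballI)
  show "T \<in> space (data_space p n) \<rightarrow> sign_vecs n" using assms(1) by (auto simp: space_data_space)
  fix a assume a: "a \<in> sign_vecs n"
  have "T -` {a} \<inter> space (data_space p n)
      = {Y \<in> space (data_space p n). \<forall>j\<in>{..<n}. vec_index (T Y) j = vec_index a j}"
    using assms(1) a by (auto simp: space_data_space sign_vecs_def intro!: eq_vecI)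
  also have "\<dots> \<in> sets (data_space p n)"
    by (intro sets.sets_Collect_finite_All) (auto intro!: measurable_equality_set)
  finally show "T -` {a} \<inter> space (data_space p n) \<in> sets (data_space p n)" .
qed

lemma loss_le_sum:
  assumes "\<nu> \<in> {-1, 1}"
  shows "loss n a b \<le> (\<Sum>j<n. \<bar>vec_index a j - \<nu> * vec_index b j\<bar>)"
  unfolding loss_def using assms by (intro Min_le imageI) simp_all

lemma loss_cases:
  obtains \<nu> where "\<nu> \<in> {-1, 1}" "loss n a b = (\<Sum>j<n. \<bar>vec_index a j - \<nu> * vec_index b j\<bar>)"
proof -
  have "loss n a b \<in> (\<lambda>\<nu>. \<Sum>j<n. \<bar>vec_index a j - \<nu> * vec_index b j\<bar>) ` {-1, 1}"
    unfolding loss_def by (intro Min_in) simp_all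
  then show ?thesis by (elim imageE) (rule that)
qed

lemma loss_le: 
  assumes "a \<in> sign_vecs n" "b \<in> sign_vecs n"
  shows "loss n a b \<le> 2 * real n"
proof -
  have "\<bar>vec_index a j - 1 * vec_index b j\<bar> \<le> 2" if "j < n" for j
  proof -
    have "vec_index a j \<in> {-1, 1}" "vec_index b j \<in> {-1, 1}"
      using that assms by (auto simp: sign_vecs_def)
    then show ?thesis by auto
  qed
  then have "(\<Sum>j<n. \<bar>vec_index a j - 1 * vec_index b j\<bar>) \<le> (\<Sum>j<n. 2)"
    by (intro sum_mono) auto
  then show ?thesis using loss_le_sum[of 1 n a b] by simp
qed

text \<open>A pair has the wrong relative sign only if one of its two labels is wrong, whatever global
sign attains the minimum in the loss.\<close>

lemma loss_ge_pairs:
  assumes a: "a \<in> sign_vecs n" and b: "b \<in> sign_vecs n" and n: "n > 0"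
  shows "(\<Sum>i<n. \<Sum>j<n. of_bool (vec_index a i * vec_index a j \<noteq> vec_index b i * vec_index b j))
      \<le> real n * loss n a b"
proof -
  obtain \<nu> :: real where nu: "\<nu> \<in> {-1, 1}" 
    and L: "loss n a b = (\<Sum>j<n. \<bar>vec_index a j - \<nu> * vec_index b j\<bar>)"
    by (rule loss_cases)
  let ?e = "\<lambda>j. of_bool (vec_index a j \<noteq> \<nu> * vec_index b j) :: real"
  have ab: "vec_index a j \<in> {-1, 1}" "vec_index b j \<in> {-1, 1}" if "j < n" for j
    using that a b by (auto simp: sign_vecs_def)
  have sgn1: "\<bar>x - w * y\<bar> = 2 * of_bool (x \<noteq> w * y)"
    if "x \<in> {-1, 1}" "w \<in> {-1, 1}" "y \<in> {-1, 1}" for x w y :: real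
    using that by (elim insertE emptyE) simp_all
  have sgn2: "(of_bool (x * x' \<noteq> y * y') :: real) \<le> of_bool (x \<noteq> w * y) + of_bool (x' \<noteq> w * y')"
    if "x \<in> {-1, 1}" "x' \<in> {-1, 1}" "y \<in> {-1, 1}" "y' \<in> {-1, 1}" "w \<in> {-1, 1}"
        for x x' y y' w :: real
    using that by (elim insertE emptyE) simp_all
  have L': "loss n a b = 2 * (\<Sum>j<n. ?e j)"
    unfolding L sum_distrib_left
  proof (rule sum.cong)
    fix j assume "j \<in> {..<n}"
    then show "\<bar>vec_index a j - \<nu> * vec_index b j\<bar> = 2 * ?e j"
      using sgn1[of "vec_index a j" \<nu> "vec_index b j"] ab[of j] nu by simp
  qed simp
  have "(\<Sum>i<n. \<Sum>j<n. of_bool (vec_index a i * vec_index a j \<noteq> vec_index b i * vec_index b j))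
     \<le> (\<Sum>i<n. \<Sum>j<n. ?e i + ?e j)"
  proof (intro sum_mono)
    fix i j assume "i \<in> {..<n}" "j \<in> {..<n}"
    then show "of_bool (vec_index a i * vec_index a j \<noteq> vec_index b i * vec_index b j)
        \<le> ?e i + ?e j"
      using sgn2[of "vec_index a i" "vec_index a j" "vec_index b i" "vec_index b j" \<nu>]
        ab[of i] ab[of j] nu by simp
  qed
  also have "\<dots> = real n * loss n a b"
    unfolding L' by (simp only: sum.distrib sum_constant card_lessThan sum_distrib_left[symmetric])
  finally show ?thesis .
qed

section \<open>Overlap of two densities\<close>

text \<open>The minimum is \<open>exp ((u + w) / 2)\<close> times \<open>exp (- \<bar>u - w\<bar> / 2)\<close>. The last factor is at least
\<open>exp (- K / 2)\<close> unless \<open>\<bar>u - w\<bar> > K\<close>, and then the error terms on the right take over.\<close>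

lemma exp_mean_le_min_exp:
  fixes u w s K :: real
  assumes "s \<ge> 0" "K \<ge> 0"
  shows "exp (- K / 2) * exp ((u + w) / 2) \<le> min (exp u) (exp w)
    + exp (- K / 2 - s * K) * (exp ((1/2 + s) * u + (1/2 - s) * w) + exp ((1/2 - s) * u + (1/2
        + s) * w))"
proof (cases "\<bar>u - w\<bar> \<le> K")
  case True
  then have "- K / 2 + (u + w) / 2 \<le> u" "- K / 2 + (u + w) / 2 \<le> w"
    by (simp_all add: abs_le_iff field_simps)
  then have "exp (- K / 2) * exp ((u + w) / 2) \<le> min (exp u) (exp w)"
    by (simp only: exp_add[symmetric] min.bounded_iff exp_le_cancel_iff)
  moreover have "0 \<le> exp (- K / 2 - s * K) * (exp ((1/2 + s) * u + (1/2 - s) * w)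
      + exp ((1/2 - s) * u + (1/2 + s) * w))"
    by (intro mult_nonneg_nonneg add_nonneg_nonneg) auto
  ultimately show ?thesis by linarith
next
  case False
  have *: "exp (- K / 2) * exp ((u + w) / 2)
      \<le> exp (- K / 2 - s * K) * exp ((1/2 + s) * a + (1/2 - s) * b)"
    if "a - b \<ge> K" "a + b = u + w" for a b
  proof -
    have "s * K \<le> s * (a - b)" using that assms by (intro mult_left_mono) auto
    then have "- K / 2 + (u + w) / 2 \<le> - K / 2 - s * K + ((1/2 + s) * a + (1/2 - s) * b)"
      using that(2) by (simp add: algebra_simps add_divide_distrib)
    then show ?thesis by (simp only: exp_add[symmetric] exp_le_cancel_iff)
  qed
  have pos: "0 \<le> min (exp u) (exp w)" "\<And>x y :: real. 0 \<le> exp x * exp y" by auto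
  consider "u - w \<ge> K" | "w - u \<ge> K" using False by linarith
  then show ?thesis
  proof cases
    case 1
    from *[OF 1 refl] pos show ?thesis unfolding distrib_left by (smt (verit))
  next
    case 2
    from *[OF 2 add.commute] pos show ?thesis unfolding distrib_left by (smt (verit))
  qed
qed

lemma ennreal_affine:
  "0 \<le> m \<Longrightarrow> 0 \<le> c \<Longrightarrow> 0 \<le> a \<Longrightarrow> 0 \<le> b \<Longrightarrow>
    ennreal m + ennreal c * (ennreal a + ennreal b) = ennreal (m + c * (a + b))"
  by (simp add: ennreal_mult)

lemma nn_integral_min_exp_ge:
  fixes u w :: "'a \<Rightarrow> real"
  assumes [measurable]: "u \<in> borel_measurable M" "w \<in> borel_measurable M"
    and sK: "s \<ge> 0" "K \<ge> 0"
    and G0: "(\<integral>\<^sup>+x. ennreal (exp ((u x + w x) / 2)) \<partial>M) = ennreal G0" "G0 \<ge> 0"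
    and G1: "(\<integral>\<^sup>+x. ennreal (exp ((1/2 + s) * u x + (1/2 - s) * w x)) \<partial>M) = ennreal G1"
      "(\<integral>\<^sup>+x. ennreal (exp ((1/2 - s) * u x + (1/2 + s) * w x)) \<partial>M) = ennreal G1" "G1 \<ge> 0"
  shows "ennreal (exp (- K / 2) * (G0 - 2 * exp (- s * K) * G1))
    \<le> (\<integral>\<^sup>+x. ennreal (min (exp (u x)) (exp (w x))) \<partial>M)" (is "_ \<le> ?B")
proof -
  let ?c = "exp (- K / 2 - s * K)"
  have "ennreal (exp (- K / 2) * G0)
      = (\<integral>\<^sup>+x. ennreal (exp (- K / 2)) * ennreal (exp ((u x + w x) / 2)) \<partial>M)"
    using G0 by (simp add: nn_integral_cmult ennreal_mult)
  also have "\<dots> \<le> (\<integral>\<^sup>+x. ennreal (min (exp (u x)) (exp (w x))) + ennreal ?c *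
      (ennreal (exp ((1/2 + s) * u x + (1/2 - s) * w x)) + ennreal (exp ((1/2 - s) * u x
          + (1/2 + s) * w x))) \<partial>M)"
  proof (intro nn_integral_mono)
    fix x
    have "ennreal (exp (- K / 2) * exp ((u x + w x) / 2)) \<le> ennreal (min (exp (u x)) (exp (w x))
      + ?c * (exp ((1/2 + s) * u x + (1/2 - s) * w x) + exp ((1/2 - s) * u x + (1/2 + s) * w x)))"
      by (intro ennreal_leI exp_mean_le_min_exp sK)
    then show "ennreal (exp (- K / 2)) * ennreal (exp ((u x + w x) / 2))
      \<le> ennreal (min (exp (u x)) (exp (w x))) + ennreal ?c *
      (ennreal (exp ((1/2 + s) * u x + (1/2 - s) * w x)) + ennreal (exp ((1/2 - s) * u x
          + (1/2 + s) * w x)))"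
      by (subst (asm) ennreal_affine[symmetric], simp, simp, simp, simp)
        (simp only: ennreal_mult'[OF exp_ge_zero])
  qed
  also have "\<dots> = ?B + ennreal ?c * (ennreal G1 + ennreal G1)"
    using G1 by (subst nn_integral_add, simp, simp, subst nn_integral_cmult, simp, subst
        nn_integral_add) simp_all
  also have "ennreal ?c * (ennreal G1 + ennreal G1)
      = ennreal (exp (- K / 2) * (2 * exp (- s * K) * G1))"
  proof -
    have "?c = exp (- K / 2) * exp (- s * K)" by (simp add: exp_add[symmetric])
    then have "?c * (G1 + G1) = exp (- K / 2) * (2 * exp (- s * K) * G1)"
        by (simp only: mult_2 mult_ac) (simp add: algebra_simps)
    moreover have "ennreal ?c * (ennreal G1 + ennreal G1) = ennreal (?c * (G1 + G1))"
      using ennreal_affine[of 0 ?c G1 G1] G1(3)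
          by (simp only: ennreal_0 add_0 exp_ge_zero order_refl)
    ultimately show ?thesis by (simp only:)
  qed
  finally have "ennreal (exp (- K / 2) * G0)
      - ennreal (exp (- K / 2) * (2 * exp (- s * K) * G1)) \<le> ?B"
    by (simp add: ennreal_minus_le_iff add.commute)
  then show ?thesis using G1(3) by (simp add: ennreal_minus right_diff_distrib)
qed

text \<open>Choice of the parameters: \<open>s\<close> is so small that the tilted affinity \<open>G1\<close> exceeds \<open>G0\<close> by a
bounded factor only, and \<open>K\<close> is a multiple of \<open>1 / s\<close>, so that \<open>exp (- s * K)\<close> beats this factor.\<close>

lemma affinity_bound:
  fixes R s K :: real
  assumes "s = 1 / sqrt (2 * l)" "K = 4 * sqrt (2 * l)" "l > 0" "R \<le> 2 * l"
    and "G0 \<ge> exp (- R / 2)" "0 \<le> G1" "G1 \<le> G0 * exp (2 * s\<^sup>2 * R)"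
  shows "exp (- 2 * sqrt (2 * l) - R / 2) / 2 \<le> exp (- K / 2) * (G0 - 2 * exp (- s * K) * G1)"
proof -
  have G0: "G0 > 0" using assms(5) exp_gt_zero[of "- R / 2"] by linarith
  have sK: "s * K = 4" using assms by simp
  have "2 * s\<^sup>2 * R = R / l" using assms by (simp add: power_divide)
  also have "\<dots> \<le> 2" using assms by (simp add: divide_le_eq)
  finally have e: "2 * s\<^sup>2 * R \<le> 2" .
  have "exp (2::real) \<ge> 4"
  proof -
    have "exp (1::real) \<ge> 2" using exp_ge_add_one_self[of 1] by simp
    then have "exp (1::real) * exp 1 \<ge> 2 * 2" by (intro mult_mono) auto
    then show ?thesis by (simp add: exp_add[symmetric])
  qed
  then have e2: "exp (- 2 :: real) \<le> 1 / 4" by (simp add: exp_minus field_simps)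
  have "exp (- s * K) * G1 \<le> exp (- 4) * (G0 * exp 2)"
    using assms(6) e sK G0
    by (intro mult_mono order.trans[OF assms(7)]) auto
  also have "\<dots> = exp (- 2) * G0" by (simp add: exp_add[symmetric] mult.commute mult.left_commute)
  also have "\<dots> \<le> 1 / 4 * G0" using e2 G0 by (intro mult_right_mono) auto
  finally have "G0 / 2 \<le> G0 - 2 * exp (- s * K) * G1" by simp
  then have "exp (- R / 2) / 2 \<le> G0 - 2 * exp (- s * K) * G1" using assms(5) by linarith
  then have "exp (- K / 2) * (exp (- R / 2) / 2) \<le> exp (- K / 2) * (G0 - 2 * exp (- s * K) * G1)"
    by (rule mult_left_mono) simp
  moreover have "exp (- K / 2) * (exp (- R / 2) / 2) = exp (- 2 * sqrt (2 * l) - R / 2) / 2"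
    using assms(2) by (simp add: exp_add[symmetric])
  ultimately show ?thesis by (simp only:)
qed

text \<open>If the Hellinger affinity \<open>G 0\<close> is at least \<open>exp (- R / 2)\<close> and the affinities \<open>G s\<close> grow at
most quadratically in the exponent, then the overlap is \<open>exp (- R / 2)\<close> up to a subpolynomial
factor. The squared Hellinger affinity alone would give the exponent \<open>R\<close> instead of \<open>R / 2\<close>, which
is not sharp.\<close>

lemma min_density_bound:
  fixes u w :: "'a \<Rightarrow> real" and G :: "real \<Rightarrow> real"
  assumes [measurable]: "u \<in> borel_measurable M" "w \<in> borel_measurable M"
    and G: "\<And>s. 4 * s\<^sup>2 \<le> 1 \<Longrightarrow>
      (\<integral>\<^sup>+x. ennreal (exp ((1/2 + s) * u x + (1/2 - s) * w x)) \<partial>M) = ennreal (G s)"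
    and sym: "\<And>s. G (- s) = G s" and nonneg: "\<And>s. 4 * s\<^sup>2 \<le> 1 \<Longrightarrow> 0 \<le> G s"
    and l: "l \<ge> 2" and R: "R \<le> 2 * l"
    and G0: "exp (- R / 2) \<le> G 0" and G1: "\<And>s. 4 * s\<^sup>2 \<le> 1 \<Longrightarrow> G s \<le> G 0 * exp (2 * s\<^sup>2 * R)"
  shows "ennreal (exp (- 2 * sqrt (2 * l) - R / 2) / 2)
    \<le> (\<integral>\<^sup>+x. ennreal (min (exp (u x)) (exp (w x))) \<partial>M)"
proof -
  define s where "s = 1 / sqrt (2 * l)"
  define K where "K = 4 * sqrt (2 * l)"
  have s: "4 * s\<^sup>2 \<le> 1" "4 * (- s)\<^sup>2 \<le> 1" using l by (simp_all add: s_def power_divide divide_le_eq)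
  have "(u x + w x) / 2 = (1/2 + 0) * u x + (1/2 - 0) * w x" for x by (simp add: field_simps)
  then have i0: "(\<integral>\<^sup>+x. ennreal (exp ((u x + w x) / 2)) \<partial>M) = ennreal (G 0)"
    using G[of 0] by (simp only:) simp
  have "ennreal (exp (- 2 * sqrt (2 * l) - R / 2) / 2)
      \<le> ennreal (exp (- K / 2) * (G 0 - 2 * exp (- s * K) * G s))"
    using l by (intro ennreal_leI affinity_bound[OF s_def K_def _ R G0 nonneg[OF s(1)] G1[OF
        s(1)]]) simp
  also have "\<dots> \<le> (\<integral>\<^sup>+x. ennreal (min (exp (u x)) (exp (w x))) \<partial>M)"
  proof (rule nn_integral_min_exp_ge)
    show "(\<integral>\<^sup>+x. ennreal (exp ((1/2 - s) * u x + (1/2 + s) * w x)) \<partial>M) = ennreal (G s)"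
      using G[OF s(2)] by (simp add: sym)
  qed (use l i0 G[OF s(1)] nonneg[of 0] nonneg[OF s(1)] in \<open>simp_all add: s_def K_def\<close>)
  finally show ?thesis .
qed

text \<open>Chernoff bound; it controls the prior mass of centres that are too short.\<close>

lemma chi_square_lower_tail:
  assumes "0 < c" "c < 1"
  shows "emeasure (PiM {..<p} (\<lambda>_. SN)) {g
      \<in> space (PiM {..<p} (\<lambda>_. SN)). (\<Sum>r<p. (g r)\<^sup>2) < real p * c}
    \<le> ennreal (exp (- real p * (1 - c)\<^sup>2 / 8))" (is "emeasure ?M ?A \<le> _")
proof -
  define m where "m = (1 - c) / 4"
  have lam: "0 < m" "m < 1/2" using assms by (auto simp: m_def)
  have [measurable]: "(\<lambda>g. g r) \<in> borel_measurable ?M" if "r \<in> {..<p}" for r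
    using measurable_component_singleton[OF that, of "\<lambda>_. SN"] by simp
  have [measurable]: "(\<lambda>g. \<Sum>r<p. (g r)\<^sup>2) \<in> borel_measurable ?M" by measurable
  have "emeasure ?M ?A = (\<integral>\<^sup>+g. indicator ?A g \<partial>?M)"
    by (rule nn_integral_indicator[symmetric]) measurable
  also have "\<dots> \<le> (\<integral>\<^sup>+g. ennreal (exp (m * (real p * c))) * (\<Prod>r<p. ennreal (exp (0 * g r
      + (- 2 * m) * (g r)\<^sup>2 / 2))) \<partial>?M)"
  proof (intro nn_integral_mono)
    fix g
    have "indicator ?A g \<le> ennreal (exp (m * (real p * c - (\<Sum>r<p. (g r)\<^sup>2))))"
    proof (cases "g \<in> ?A")
      case True
      then have "0 \<le> m * (real p * c - (\<Sum>r<p. (g r)\<^sup>2))" using lam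
          by (intro mult_nonneg_nonneg) auto
      then have "ennreal 1 \<le> ennreal (exp (m * (real p * c - (\<Sum>r<p. (g r)\<^sup>2))))"
        by (intro ennreal_leI) simp
      then show ?thesis using True by simp
    qed simp
    also have "\<dots> = ennreal (exp (m * (real p * c)) * exp (\<Sum>r<p. 0 * g r + (- 2 * m) * (g r)\<^sup>2 / 2))"
      by (simp add: exp_add[symmetric] right_diff_distrib sum_distrib_left sum_negf)
    also have "\<dots> = ennreal (exp (m * (real p * c))) * (\<Prod>r<p. ennreal (exp (0 * g r
        + (- 2 * m) * (g r)\<^sup>2 / 2)))"
      by (simp only: ennreal_mult'[OF exp_ge_zero] exp_sum finite_lessThan prod_ennreal[OF
          exp_ge_zero])
    finally show "indicator ?A g \<le> ennreal (exp (m * (real p * c))) * (\<Prod>r<p. ennreal (exp (0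
        * g r + (- 2 * m) * (g r)\<^sup>2 / 2)))" .
  qed
  also have "\<dots> = ennreal (exp (m * (real p * c))) * (\<Prod>r<p. \<integral>\<^sup>+z. ennreal (exp (0 * z
      + (- 2 * m) * z\<^sup>2 / 2)) \<partial>SN)"
    by (subst nn_integral_cmult, measurable, subst SN.product_nn_integral_prod) auto
  also have "\<dots> = ennreal (exp (m * (real p * c)) * (1 / sqrt (1 + 2 * m)) ^ p)"
    using lam by (subst gaussian_integral) (simp_all add: ennreal_mult' ennreal_power)
  also have "\<dots> \<le> ennreal (exp (m * (real p * c)) * exp (- m + 2 * m\<^sup>2) ^ p)"
  proof (intro ennreal_leI mult_left_mono power_mono)
    have "2 * m - (2 * m)\<^sup>2 \<le> ln (1 + 2 * m)"
      using lam by (intro ln_one_plus_pos_lower_bound) auto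
    then have "exp (2 * (m - 2 * m\<^sup>2)) \<le> exp (ln (1 + 2 * m))" by (simp add: power2_eq_square)
    moreover have "exp (ln (1 + 2 * m)) = 1 + 2 * m" using lam by (intro exp_ln) simp
    ultimately have "(exp (m - 2 * m\<^sup>2))\<^sup>2 \<le> 1 + 2 * m" by (simp only: exp_double)
    then have "exp (m - 2 * m\<^sup>2) \<le> sqrt (1 + 2 * m)" by (rule real_le_rsqrt)
    then have "1 / sqrt (1 + 2 * m) \<le> 1 / exp (m - 2 * m\<^sup>2)"
      using lam by (intro divide_left_mono) (auto intro!: mult_pos_pos)
    also have "\<dots> = exp (- m + 2 * m\<^sup>2)"
        by (simp add: exp_minus[symmetric] inverse_eq_divide[symmetric])
    finally show "1 / sqrt (1 + 2 * m) \<le> exp (- m + 2 * m\<^sup>2)" .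
  qed (use lam in auto)
  also have "exp (m * (real p * c)) * exp (- m + 2 * m\<^sup>2) ^ p = exp (- real p * (1 - c)\<^sup>2 / 8)"
  proof -
    have "m * (real p * c) + real p * (- m + 2 * m\<^sup>2) = - real p * (1 - c)\<^sup>2 / 8"
      unfolding m_def by (simp add: power2_eq_square field_simps)
    then show ?thesis by (simp only: exp_of_nat_mult[symmetric] exp_add[symmetric])
  qed
  finally show ?thesis .
qed

section \<open>Bayes risk under uniform labels\<close>

definition flip :: "nat \<Rightarrow> real vec \<Rightarrow> real vec" where
  "flip i v = vec (dim_vec v) (\<lambda>j. if j = i then - vec_index v j else vec_index v j)"

lemma flip_simps [simp]:
  "dim_vec (flip i v) = dim_vec v"
  "j < dim_vec v \<Longrightarrow> vec_index (flip i v) j = (if j = i then - vec_index v j else vec_index v j)"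
  by (auto simp: flip_def)

lemma flip_flip: "flip i (flip i v) = v"
  by (rule eq_vecI) simp_all

lemma flip_sign_vecs:
  assumes "v \<in> sign_vecs n"
  shows "flip i v \<in> sign_vecs n"
proof -
  have d: "dim_vec v = n" and v: "\<And>j. j < n \<Longrightarrow> vec_index v j \<in> {-1, 1}"
    using assms by (auto simp: sign_vecs_def)
  have "vec_index (flip i v) j \<in> {-1, 1}" if "j < n" for j
    using v[OF that] that d by (cases "j = i") auto
  moreover have "flip i v \<in> carrier_vec n" using d by (intro carrier_vecI) simp
  ultimately show ?thesis unfolding sign_vecs_def by blast
qed

lemma bij_betw_flip: "bij_betw (flip i) (sign_vecs n) (sign_vecs n)"
  unfolding bij_betw_def
proof (intro conjI equalityI subsetI)
  show "inj_on (flip i) (sign_vecs n)"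
    by (rule inj_on_inverseI[where g = "flip i"]) (rule flip_flip)
  show "v \<in> sign_vecs n" if "v \<in> flip i ` sign_vecs n" for v
    using that by (elim imageE) (simp only: flip_sign_vecs)
  show "v \<in> flip i ` sign_vecs n" if "v \<in> sign_vecs n" for v
    using flip_sign_vecs[OF that, of i] by (rule image_eqI[rotated]) (rule flip_flip[symmetric])
qed

text \<open>For \<open>i \<noteq> j\<close>, flipping label \<open>i\<close> turns an estimate whose relative sign at \<open>(i, j)\<close> is correct
into one whose relative sign is wrong. Summing over all labellings pairs \<open>\<eta>\<close> with \<open>flip i \<eta>\<close>, and
every estimator pays at least the smaller of the two densities.\<close>

lemma sum_loss_ge_min_density:
  fixes h :: "real vec \<Rightarrow> 'a \<Rightarrow> ennreal" and b :: real
  assumes n: "n > 0"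
    and tau: "\<And>x. x \<in> space M \<Longrightarrow> \<tau> x \<in> sign_vecs n" "\<tau> \<in> M \<rightarrow>\<^sub>M count_space (sign_vecs n)"
    and h [measurable]: "\<And>\<eta>. \<eta> \<in> sign_vecs n \<Longrightarrow> h \<eta> \<in> borel_measurable M"
    and b: "b \<ge> 0" "\<And>\<eta> i. \<eta> \<in> sign_vecs n \<Longrightarrow> i < n \<Longrightarrow>
        ennreal b \<le> (\<integral>\<^sup>+x. min (h \<eta> x) (h (flip i \<eta>) x) \<partial>M)"
  shows "ennreal (real (card (sign_vecs n)) * ((real n - 1) / 2 * b))
      \<le> (\<Sum>\<eta>\<in>sign_vecs n. \<integral>\<^sup>+x. h \<eta> x * ennreal (loss n (\<tau> x) \<eta>) \<partial>M)"
proof -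
  let ?S = "sign_vecs n" and ?N = "real (card (sign_vecs n))"
  define w where "w i j \<eta> x = (of_bool (vec_index (\<tau> x) i * vec_index (\<tau> x) j
      \<noteq> vec_index \<eta> i * vec_index \<eta> j) :: ennreal)" for i j \<eta> x
  define w' where "w' i j \<eta> x = (of_bool (vec_index (\<tau> x) i * vec_index (\<tau> x) j
      = vec_index \<eta> i * vec_index \<eta> j) :: ennreal)" for i j \<eta> x
  have meas: "(\<lambda>x. f (\<tau> x)) \<in> borel_measurable M" for f :: "real vec \<Rightarrow> ennreal"
    by (rule measurable_compose[OF tau(2) borel_measurable_count_space])
  have [measurable]: "w i j \<eta> \<in> borel_measurable M" "w' i j \<eta> \<in> borel_measurable M" for i j \<eta>
    unfolding w_def w'_def by (rule meas)+
  note fl = flip_sign_vecs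
  have pair: "ennreal (?N * b / 2) \<le> (\<Sum>\<eta>\<in>?S. \<integral>\<^sup>+x. h \<eta> x * w i j \<eta> x \<partial>M)" 
    if ij: "i < n" "j < n" "i \<noteq> j" for i j
  proof -
    let ?A = "\<Sum>\<eta>\<in>?S. \<integral>\<^sup>+x. h \<eta> x * w i j \<eta> x \<partial>M"
    have sw: "w i j (flip i \<eta>) x = w' i j \<eta> x" if "\<eta> \<in> ?S" "x \<in> space M" for \<eta> x
    proof -
      have "vec_index \<eta> k \<in> {-1, 1}" "vec_index (\<tau> x) k \<in> {-1, 1}" if "k < n" for k
        using \<open>\<eta> \<in> ?S\<close> tau(1)[OF \<open>x \<in> space M\<close>] that by (auto simp: sign_vecs_def)
      note * = this[OF ij(1)] this[OF ij(2)]
      have aux: "(y * y' \<noteq> - z * z') = (y * y' = z * z')"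
        if "y \<in> {-1, 1}" "y' \<in> {-1, 1}" "z \<in> {-1, 1}" "z' \<in> {-1, 1}" for y y' z z' :: real
        using that by (elim insertE emptyE) simp_all
      have "dim_vec \<eta> = n" using \<open>\<eta> \<in> ?S\<close> by (auto simp: sign_vecs_def)
      then show ?thesis unfolding w_def w'_def using ij aux[OF *(2,4,1,3)] by simp
    qed
    have "?A = (\<Sum>\<eta>\<in>?S. \<integral>\<^sup>+x. h (flip i \<eta>) x * w i j (flip i \<eta>) x \<partial>M)"
      by (rule sum.reindex_bij_betw[OF bij_betw_flip, symmetric])
    also have "\<dots> = (\<Sum>\<eta>\<in>?S. \<integral>\<^sup>+x. h (flip i \<eta>) x * w' i j \<eta> x \<partial>M)"
      by (intro sum.cong refl nn_integral_cong) (simp add: sw)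
    finally have "?A + ?A = (\<Sum>\<eta>\<in>?S. \<integral>\<^sup>+x. h \<eta> x * w i j \<eta> x \<partial>M)
        + (\<Sum>\<eta>\<in>?S. \<integral>\<^sup>+x. h (flip i \<eta>) x * w' i j \<eta> x \<partial>M)" by simp
    also have "\<dots> = (\<Sum>\<eta>\<in>?S. \<integral>\<^sup>+x. h \<eta> x * w i j \<eta> x + h (flip i \<eta>) x * w' i j \<eta> x \<partial>M)"
      unfolding sum.distrib[symmetric]
      by (intro sum.cong refl nn_integral_add[symmetric]) (auto simp: fl)
    finally have AA: "?A + ?A = (\<Sum>\<eta>\<in>?S. \<integral>\<^sup>+x. h \<eta> x * w i j \<eta> x + h (flip i \<eta>) x * w' i j \<eta> x \<partial>M)" .
    have "ennreal (?N * b) = (\<Sum>\<eta>\<in>?S. ennreal b)"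
      using b(1) by (simp add: ennreal_mult ennreal_of_nat_eq_real_of_nat)
    also have "\<dots> \<le> (\<Sum>\<eta>\<in>?S. \<integral>\<^sup>+x. min (h \<eta> x) (h (flip i \<eta>) x) \<partial>M)"
      using b(2) ij(1) by (intro sum_mono) simp
    also have "\<dots> \<le> ?A + ?A"
      unfolding AA by (intro sum_mono nn_integral_mono) (simp add: w_def w'_def)
    finally have "ennreal (?N * b) \<le> ?A + ?A" .
    moreover have half: "?A = ennreal (1/2) * (?A + ?A)"
    proof -
      have "ennreal (1/2) + ennreal (1/2) = ennreal (1/2 + 1/2)"
        by (rule ennreal_plus[symmetric]) simp_all
      also have "\<dots> = 1" by simp
      finally have "1 * ?A = (ennreal (1/2) + ennreal (1/2)) * ?A" by (simp only:)
      then show ?thesis by (simp only: distrib_left distrib_right mult_1)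
    qed
    ultimately have "ennreal (1/2) * ennreal (?N * b) \<le> ?A"
      by (subst half, intro mult_left_mono) simp_all
    moreover have "ennreal (1/2) * ennreal (?N * b) = ennreal (1/2 * (?N * b))"
      by (rule ennreal_mult'[symmetric]) simp
    ultimately show ?thesis by simp
  qed
  define P where "P = (SIGMA i:{..<n}. {..<n} - {i})"
  have P: "finite P" "\<And>q. q \<in> P \<Longrightarrow> fst q < n \<and> snd q < n \<and> fst q \<noteq> snd q" "real (card P)
      = n * (real n - 1)"
    using n unfolding P_def by (simp, force, simp add: of_nat_diff)
  let ?w = "\<lambda>q. w (fst q) (snd q)"
  have "ennreal (?N * ((real n - 1) / 2 * b)) = ennreal (\<Sum>q\<in>P. 1 / n * (?N * b / 2))"
    using n by (simp add: P(3) mult_ac)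
  also have "\<dots> = (\<Sum>q\<in>P. ennreal (1 / n) * ennreal (?N * b / 2))"
  proof -
    have "ennreal (\<Sum>q\<in>P. 1 / n * (?N * b / 2)) = (\<Sum>q\<in>P. ennreal (1 / n * (?N * b / 2)))"
      using b(1) by (intro sum_ennreal[symmetric]) simp
    also have "\<dots> = (\<Sum>q\<in>P. ennreal (1 / n) * ennreal (?N * b / 2))"
      by (intro sum.cong refl ennreal_mult') simp
    finally show ?thesis .
  qed
  also have "\<dots> \<le> (\<Sum>q\<in>P. ennreal (1 / n) * (\<Sum>\<eta>\<in>?S. \<integral>\<^sup>+x. h \<eta> x * ?w q \<eta> x \<partial>M))"
    using P(2) by (intro sum_mono mult_left_mono pair) auto
  also have "\<dots> = (\<Sum>q\<in>P. \<Sum>\<eta>\<in>?S. \<integral>\<^sup>+x. ennreal (1 / n) * (h \<eta> x * ?w q \<eta> x) \<partial>M)"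
    unfolding sum_distrib_left by (intro sum.cong refl nn_integral_cmult[symmetric]) measurable
  also have "\<dots> = (\<Sum>\<eta>\<in>?S. \<Sum>q\<in>P. \<integral>\<^sup>+x. ennreal (1 / n) * (h \<eta> x * ?w q \<eta> x) \<partial>M)"
    by (rule sum.swap)
  also have "\<dots> = (\<Sum>\<eta>\<in>?S. \<integral>\<^sup>+x. (\<Sum>q\<in>P. ennreal (1 / n) * (h \<eta> x * ?w q \<eta> x)) \<partial>M)"
    by (intro sum.cong refl nn_integral_sum[symmetric]) measurable
  also have "\<dots> \<le> (\<Sum>\<eta>\<in>?S. \<integral>\<^sup>+x. h \<eta> x * ennreal (loss n (\<tau> x) \<eta>) \<partial>M)"
  proof (intro sum_mono nn_integral_mono)
    fix \<eta> x assume eta: "\<eta> \<in> ?S" and x: "x \<in> space M"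
    let ?v = "\<lambda>i j. of_bool (vec_index (\<tau> x) i * vec_index (\<tau> x) j \<noteq> vec_index \<eta> i
        * vec_index \<eta> j) :: real"
    have "(\<Sum>q\<in>P. ennreal (1 / n) * ?w q \<eta> x) = (\<Sum>q\<in>P. ennreal (1 / n * ?v (fst q) (snd q)))"
      by (intro sum.cong refl) (simp add: w_def)
    also have "\<dots> = ennreal (\<Sum>q\<in>P. 1 / n * ?v (fst q) (snd q))"
      by (intro sum_ennreal) simp
    also have "\<dots> \<le> ennreal (loss n (\<tau> x) \<eta>)"
    proof (intro ennreal_leI)
      have "(\<Sum>q\<in>P. ?v (fst q) (snd q)) = (\<Sum>i<n. \<Sum>j\<in>{..<n}-{i}. ?v i j)"
        unfolding P_def by (subst sum.Sigma) (auto simp: case_prod_beta)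
      also have "\<dots> \<le> (\<Sum>i<n. \<Sum>j<n. ?v i j)"
        by (intro sum_mono sum_mono2) auto
      also have "\<dots> \<le> n * loss n (\<tau> x) \<eta>"
        by (rule loss_ge_pairs[OF tau(1)[OF x] eta n])
      finally show "(\<Sum>q\<in>P. 1 / n * ?v (fst q) (snd q)) \<le> loss n (\<tau> x) \<eta>"
        unfolding sum_distrib_left[symmetric] using n by (simp add: divide_le_eq mult.commute)
    qed
    finally have "h \<eta> x * (\<Sum>q\<in>P. ennreal (1 / n) * ?w q \<eta> x) \<le> h \<eta> x * ennreal (loss n (\<tau> x) \<eta>)"
      by (intro mult_left_mono) simp_all
    then show "(\<Sum>q\<in>P. ennreal (1 / n) * (h \<eta> x * ?w q \<eta> x)) \<le> h \<eta> x * ennreal (loss n (\<tau> x) \<eta>)"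
      by (simp only: sum_distrib_left mult.left_commute)
  qed
  finally show ?thesis .
qed

text \<open>The centre is \<open>\<sigma> * t\<close>; the density of the scaled data at labels \<open>\<eta>\<close> depends on them only
through the row sums, because squared labels are \<open>1\<close>.\<close>

lemma risk_log_density:
  assumes T: "T \<in> estimators p n" and eta: "\<eta> \<in> sign_vecs n"
  shows "risk p n \<sigma> T (vec p (\<lambda>r. \<sigma> * t r)) \<eta>
    = (\<integral>\<^sup>+x. ennreal (exp (\<Sum>r<p. t r * (\<Sum>j<n. vec_index \<eta> j * x (r, j)) - real n * (t r)\<^sup>2 / 2))
        * ennreal (loss n (T (mat p n (\<lambda>ij. \<sigma> * x ij))) \<eta>) \<partial>noise p n)"
proof -
  let ?I = "{..<p} \<times> {..<n}"
  define a where "a = (\<lambda>(r, j). t r * vec_index \<eta> j)"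
  define f where "f x = ennreal (loss n (T (mat p n (\<lambda>ij. \<sigma> * x ij))) \<eta>)" for x
  have m: "(\<lambda>x. mat p n (\<lambda>ij. \<sigma> * x ij)) \<in> noise p n \<rightarrow>\<^sub>M data_space p n"
    by (rule measurable_mat) (intro borel_measurable_times borel_measurable_const
        measurable_noise_entry)
  have f: "f \<in> borel_measurable (PiM ?I (\<lambda>_. SN))"
    unfolding f_def noise_def[symmetric] by (rule measurable_sign_vecs_fun[OF T m])
  note eta1 = sign_square[OF eta]
  have "risk p n \<sigma> T (vec p (\<lambda>r. \<sigma> * t r)) \<eta> = (\<integral>\<^sup>+x. f (\<lambda>i\<in>?I. x i + a i) \<partial>PiM ?I (\<lambda>_. SN))"
    unfolding risk_noise[OF T vec_carrier] f_def noise_def[symmetric]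
  proof (intro nn_integral_cong arg_cong[where f = "\<lambda>M. ennreal (loss n (T M) \<eta>)"] eq_matI)
    fix x i j assume "i < dim_row (mat p n (\<lambda>ij. \<sigma> * (\<lambda>i\<in>?I. x i + a i) ij))"
      "j < dim_col (mat p n (\<lambda>ij. \<sigma> * (\<lambda>i\<in>?I. x i + a i) ij))"
    then show "mat p n (\<lambda>(i, j). vec_index (vec p (\<lambda>r. \<sigma> * t r)) i * vec_index \<eta> j
        + \<sigma> * x (i, j)) $$ (i, j)
        = mat p n (\<lambda>ij. \<sigma> * (\<lambda>i\<in>?I. x i + a i) ij) $$ (i, j)"
      by (simp add: a_def algebra_simps)
  qed simp_all
  also have "\<dots> = (\<integral>\<^sup>+x. ennreal (exp (\<Sum>i\<in>?I. a i * x i - (a i)\<^sup>2 / 2)) * f x \<partial>PiM ?I (\<lambda>_. SN))"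
    by (rule cameron_martin[OF _ f]) simp
  finally have R: "risk p n \<sigma> T (vec p (\<lambda>r. \<sigma> * t r)) \<eta>
    = (\<integral>\<^sup>+x. ennreal (exp (\<Sum>i\<in>?I. a i * x i - (a i)\<^sup>2 / 2)) * f x \<partial>PiM ?I (\<lambda>_. SN))" .
  have "(\<Sum>i\<in>?I. a i * x i - (a i)\<^sup>2 / 2)
      = (\<Sum>r<p. t r * (\<Sum>j<n. vec_index \<eta> j * x (r, j)) - real n * (t r)\<^sup>2 / 2)" for x
  proof -
    have "(\<Sum>i\<in>?I. a i * x i - (a i)\<^sup>2 / 2)
        = (\<Sum>r<p. \<Sum>j<n. t r * (vec_index \<eta> j * x (r, j)) - (t r)\<^sup>2 / 2)"
      unfolding sum.cartesian_product
      by (intro sum.cong refl) (auto simp: a_def power_mult_distrib eta1)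
    also have "\<dots> = (\<Sum>r<p. t r * (\<Sum>j<n. vec_index \<eta> j * x (r, j)) - real n * (t r)\<^sup>2 / 2)"
      by (simp add: sum_subtractf sum_distrib_left)
    finally show ?thesis .
  qed
  then show ?thesis unfolding R by (simp only: f_def noise_def)
qed

lemma sum_split_flip:
  assumes "\<eta> \<in> sign_vecs n" "i < n"
  shows "(\<Sum>j<n. vec_index \<eta> j * x j) = (\<Sum>j\<in>{..<n}-{i}. vec_index \<eta> j * x j) + vec_index \<eta> i * x i"
    and "(\<Sum>j<n. vec_index (flip i \<eta>) j * x j)
        = (\<Sum>j\<in>{..<n}-{i}. vec_index \<eta> j * x j) - vec_index \<eta> i * x i"
proof -
  have d: "dim_vec \<eta> = n" using assms by (auto simp: sign_vecs_def)
  show "(\<Sum>j<n. vec_index \<eta> j * x j) = (\<Sum>j\<in>{..<n}-{i}. vec_index \<eta> j * x j) + vec_index \<eta> i * x i"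
    using assms(2) by (subst sum.remove[of _ i]) simp_all
  have "(\<Sum>j\<in>{..<n}-{i}. vec_index (flip i \<eta>) j * x j) = (\<Sum>j\<in>{..<n}-{i}. vec_index \<eta> j * x j)"
    using d by (intro sum.cong refl) simp
  then show "(\<Sum>j<n. vec_index (flip i \<eta>) j * x j)
      = (\<Sum>j\<in>{..<n}-{i}. vec_index \<eta> j * x j) - vec_index \<eta> i * x i"
    using assms(2) d by (subst sum.remove[of _ i]) simp_all
qed

lemma measurable_row_sum:
  assumes "r < p" "J \<subseteq> {..<n}"
  shows "(\<lambda>x. \<Sum>j\<in>J. c j * x (r, j)) \<in> borel_measurable (noise p n)"
  using assms
  by (intro borel_measurable_sum borel_measurable_times borel_measurable_const
      measurable_noise_entry) auto

text \<open>For a known centre the two densities differ in column \<open>i\<close> only: the geometric mean has no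
signal in this column, and the affinity is that of two normal laws at distance \<open>2 \<parallel>t\<parallel>\<close>.\<close>

lemma affinity_fixed_center:
  fixes t :: "nat \<Rightarrow> real" and p n :: nat
  assumes eta: "\<eta> \<in> sign_vecs n" and i: "i < n"
  defines "u \<equiv> (\<lambda>\<eta> x. \<Sum>r<p. t r * (\<Sum>j<n. vec_index \<eta> j * x (r, j)) - real n * (t r)\<^sup>2 / 2)"
  shows "(\<integral>\<^sup>+x. ennreal (exp ((1/2 + s) * u \<eta> x + (1/2 - s) * u (flip i \<eta>) x)) \<partial>noise p n)
      = ennreal (exp (- (1 - 4 * s\<^sup>2) * (\<Sum>r<p. (t r)\<^sup>2) / 2))"
proof -
  let ?S = "\<lambda>x r. \<Sum>j\<in>{..<n}-{i}. vec_index \<eta> j * x (r, j)"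
  let ?e = "vec_index \<eta> i"
  define f where "f r y S = ennreal (exp (t r * S
      + 2 * s * ?e * t r * y - real n * (t r)\<^sup>2 / 2))" for r y S
  have fm: "case_prod (f r) \<in> borel_measurable (borel \<Otimes>\<^sub>M borel)" for r
    unfolding f_def by measurable
  have m: "sqrt (\<Sum>j\<in>{..<n}-{i}. (vec_index \<eta> j)\<^sup>2) = sqrt (real n - 1)"
    by (simp only: sum_sign_squares[OF eta i])
  have "(1/2 + s) * u \<eta> x + (1/2 - s) * u (flip i \<eta>) x
      = (\<Sum>r<p. t r * ?S x r + 2 * s * ?e * t r * x (r, i) - real n * (t r)\<^sup>2 / 2)" for x
    unfolding u_def sum_split_flip[OF eta i] sum_distrib_left[where A
        = "{..<p}"] sum.distrib[symmetric]
    by (intro sum.cong refl) (simp add: field_simps)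
  then have "(\<integral>\<^sup>+x. ennreal (exp ((1/2 + s) * u \<eta> x + (1/2 - s) * u (flip i \<eta>) x)) \<partial>noise p n)
      = (\<integral>\<^sup>+x. (\<Prod>r<p. f r (x (r, i)) (?S x r)) \<partial>noise p n)"
    by (simp add: f_def exp_sum prod_ennreal)
  also have "\<dots> = (\<Prod>r<p. \<integral>\<^sup>+y. (\<integral>\<^sup>+z. f r y (sqrt (real n - 1) * z) \<partial>SN) \<partial>SN)"
    using i by (subst gaussian_rows_split) (simp_all only: m fm)
  also have "\<dots> = (\<Prod>r<p. ennreal (exp (- (1 - 4 * s\<^sup>2) * (t r)\<^sup>2 / 2)))"
  proof (intro prod.cong refl)
    fix r
    have z: "(\<integral>\<^sup>+z. f r y (sqrt (real n - 1) * z) \<partial>SN)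
        = ennreal (exp (- (t r)\<^sup>2 / 2)) * ennreal (exp (2 * s * ?e * t r * y))" for y
    proof -
      have "(\<integral>\<^sup>+z. f r y (sqrt (real n - 1) * z) \<partial>SN)
         = (\<integral>\<^sup>+z. ennreal (exp (2 * s * ?e * t r * y - real n * (t r)\<^sup>2 / 2))
            * ennreal (exp ((t r * sqrt (real n - 1)) * z + 0 * z\<^sup>2 / 2)) \<partial>SN)"
        by (intro nn_integral_cong) (simp add: f_def ennreal_mult'[symmetric] exp_add[symmetric]
            algebra_simps)
      also have "\<dots> = ennreal (exp (2 * s * ?e * t r * y - real n * (t r)\<^sup>2 / 2))
            * ennreal (exp ((t r)\<^sup>2 * (real n - 1) / 2))"
        using i by (subst nn_integral_cmult, simp, subst gaussian_integral) (simp_all add: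
            power_mult_distrib)
      also have "\<dots> = ennreal (exp (- (t r)\<^sup>2 / 2)) * ennreal (exp (2 * s * ?e * t r * y))"
        by (simp add: ennreal_mult'[symmetric] exp_add[symmetric] field_simps)
      finally show ?thesis .
    qed
    have "(\<integral>\<^sup>+y. ennreal (exp (2 * s * ?e * t r * y)) \<partial>SN)
        = (\<integral>\<^sup>+y. ennreal (exp ((2 * s * ?e * t r) * y + 0 * y\<^sup>2 / 2)) \<partial>SN)" by simp
    also have "\<dots> = ennreal (exp (2 * s\<^sup>2 * (t r)\<^sup>2))"
      using sign_square[OF eta i] by (subst gaussian_integral) (simp_all add: power_mult_distrib)
    finally have y: "(\<integral>\<^sup>+y. ennreal (exp (2 * s * ?e * t r * y)) \<partial>SN)
        = ennreal (exp (2 * s\<^sup>2 * (t r)\<^sup>2))" .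
    have "- (t r)\<^sup>2 / 2 + 2 * s\<^sup>2 * (t r)\<^sup>2 = - (1 - 4 * s\<^sup>2) * (t r)\<^sup>2 / 2"
      by (simp add: field_simps)
    then have "ennreal (exp (- (t r)\<^sup>2 / 2)) * ennreal (exp (2 * s\<^sup>2 * (t r)\<^sup>2))
        = ennreal (exp (- (1 - 4 * s\<^sup>2) * (t r)\<^sup>2 / 2))"
      by (simp only: ennreal_mult'[OF exp_ge_zero, symmetric] exp_add[symmetric])
    then show "(\<integral>\<^sup>+y. (\<integral>\<^sup>+z. f r y (sqrt (real n - 1) * z) \<partial>SN) \<partial>SN)
        = ennreal (exp (- (1 - 4 * s\<^sup>2) * (t r)\<^sup>2 / 2))"
      unfolding z by (subst nn_integral_cmult) (simp_all only: y, simp)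
  qed
  also have "\<dots> = ennreal (exp (- (1 - 4 * s\<^sup>2) * (\<Sum>r<p. (t r)\<^sup>2) / 2))"
    by (simp add: prod_ennreal exp_sum[symmetric] sum_distrib_left sum_divide_distrib)
  finally show ?thesis .
qed

text \<open>The function \<open>u\<close> is the logarithm of the density when the centre has a centred Gaussian
prior. In terms of \<open>S\<close>, the signed sum over the other columns, and \<open>y\<close>, the entry of column \<open>i\<close>, the
tilted exponent of a row is \<open>\<beta> / 2 * (S\<^sup>2 + y\<^sup>2 + 4 * s * S * y)\<close> up to the sign of the label: the
mixed term disappears at \<open>s = 0\<close>, which is why the affinity is explicit.\<close>

lemma affinity_gaussian_center:
  fixes \<beta> s :: real and p n :: nat
  assumes eta: "\<eta> \<in> sign_vecs n" and i: "i < n" and beta: "0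
      \<le> \<beta>" "\<beta> * real n < 1" and s: "4 * s\<^sup>2 \<le> 1"
  defines "u \<equiv> (\<lambda>\<eta> x. \<Sum>r<p. \<beta> / 2 * (\<Sum>j<n. vec_index \<eta> j * x (r, j))\<^sup>2 + ln (1 - \<beta> * real n) / 2)"
  shows "(\<integral>\<^sup>+x. ennreal (exp ((1/2 + s) * u \<eta> x + (1/2 - s) * u (flip i \<eta>) x)) \<partial>noise p n)
      = ennreal ((1 / sqrt (1 + \<beta>\<^sup>2 * (real n - 1) / (1 - \<beta> * real n) * (1 - 4 * s\<^sup>2))) ^ p)"
proof -
  let ?S = "\<lambda>x r. \<Sum>j\<in>{..<n}-{i}. vec_index \<eta> j * x (r, j)"
  let ?e = "vec_index \<eta> i"
  let ?m = "real n - 1"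
  let ?C = "sqrt (1 - \<beta> * real n)"
  define f where "f r y S = ennreal (?C * exp (\<beta> / 2 * S\<^sup>2 + 2 * s * \<beta> * ?e * y * S
      + \<beta> / 2 * y\<^sup>2))" for r :: nat and y S
  have fm: "case_prod (f r) \<in> borel_measurable (borel \<Otimes>\<^sub>M borel)" for r
    unfolding f_def by measurable
  have m: "sqrt (\<Sum>j\<in>{..<n}-{i}. (vec_index \<eta> j)\<^sup>2) = sqrt ?m"
    by (simp only: sum_sign_squares[OF eta i])
  have e2: "?e\<^sup>2 = 1" by (rule sign_square[OF eta i])
  have C: "exp (ln (1 - \<beta> * real n) / 2) = ?C"
    using beta by (simp add: ln_sqrt[symmetric])
  have b1: "\<beta> * ?m < 1" "\<beta> < 1"
  proof -
    have "\<beta> * ?m \<le> \<beta> * real n" "\<beta> * 1 \<le> \<beta> * real n" using beta i by (intro mult_left_mono; simp)+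
    then show "\<beta> * ?m < 1" "\<beta> < 1" using beta by auto
  qed
  have m0: "?m \<ge> 0" using i by simp
  have "(1/2 + s) * u \<eta> x + (1/2 - s) * u (flip i \<eta>) x
      = (\<Sum>r<p. ln (1 - \<beta> * real n) / 2 + (\<beta> / 2 * (?S x r)\<^sup>2
          + 2 * s * \<beta> * ?e * x (r, i) * ?S x r + \<beta> / 2 * (x (r, i))\<^sup>2))" for x
    unfolding u_def sum_split_flip[OF eta i] sum_distrib_left[where A
        = "{..<p}"] sum.distrib[symmetric]
  proof (intro sum.cong refl)
    fix r
    have "(1/2 + s) * (\<beta> / 2 * (S + ?e * y)\<^sup>2 + l) + (1/2 - s) * (\<beta> / 2 * (S - ?e * y)\<^sup>2 + l)
       = l + (\<beta> / 2 * S\<^sup>2 + 2 * s * \<beta> * ?e * y * S + \<beta> / 2 * (?e\<^sup>2 * y\<^sup>2))" for S y l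
      by (simp add: field_simps power2_eq_square)
    then show "(1/2 + s) * (\<beta> / 2 * (?S x r + ?e * x (r, i))\<^sup>2 + ln (1 - \<beta> * real n) / 2)
       + (1/2 - s) * (\<beta> / 2 * (?S x r - ?e * x (r, i))\<^sup>2 + ln (1 - \<beta> * real n) / 2)
       = ln (1 - \<beta> * real n) / 2 + (\<beta> / 2 * (?S x r)\<^sup>2 + 2 * s * \<beta> * ?e * x (r, i) * ?S x r
           + \<beta> / 2 * (x (r, i))\<^sup>2)"
      unfolding e2 by simp
  qed
  then have "(\<integral>\<^sup>+x. ennreal (exp ((1/2 + s) * u \<eta> x + (1/2 - s) * u (flip i \<eta>) x)) \<partial>noise p n)
      = (\<integral>\<^sup>+x. (\<Prod>r<p. f r (x (r, i)) (?S x r)) \<partial>noise p n)"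
    using beta by (simp only: exp_sum finite_lessThan exp_add C f_def) (simp add: prod_ennreal)
  also have "\<dots> = (\<Prod>r<p. \<integral>\<^sup>+y. (\<integral>\<^sup>+z. f r y (sqrt ?m * z) \<partial>SN) \<partial>SN)"
    using i by (subst gaussian_rows_split) (simp_all only: m fm)
  also have "\<dots> = (\<Prod>r<p. ennreal (1 / sqrt (1 + \<beta>\<^sup>2 * ?m / (1 - \<beta> * real n) * (1 - 4 * s\<^sup>2))))"
  proof (intro prod.cong refl)
    fix r :: nat
    define a' where "a' = \<beta> + 4 * s\<^sup>2 * \<beta>\<^sup>2 * ?m / (1 - \<beta> * ?m)"
    have Q: "(1 - \<beta> * ?m) * (1 - a')
        = (1 - \<beta> * real n) * (1 + \<beta>\<^sup>2 * ?m / (1 - \<beta> * real n) * (1 - 4 * s\<^sup>2))"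
    proof -
      have "(1 - \<beta> * ?m) * (1 - a') = (1 - \<beta> * ?m) * (1 - \<beta>) - 4 * s\<^sup>2 * \<beta>\<^sup>2 * ?m"
        using b1 unfolding a'_def by (simp add: field_simps)
      also have "\<dots> = (1 - \<beta> * real n) + \<beta>\<^sup>2 * ?m * (1 - 4 * s\<^sup>2)"
        by (simp add: algebra_simps power2_eq_square)
      also have "\<dots> = (1 - \<beta> * real n) * (1 + \<beta>\<^sup>2 * ?m / (1 - \<beta> * real n) * (1 - 4 * s\<^sup>2))"
        using beta by (simp add: distrib_left)
      finally show ?thesis .
    qed
    have rho: "0 \<le> \<beta>\<^sup>2 * ?m / (1 - \<beta> * real n) * (1 - 4 * s\<^sup>2)"
      using beta s m0 by (intro mult_nonneg_nonneg divide_nonneg_pos) auto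
    have Qpos: "(1 - \<beta> * ?m) * (1 - a') > 0"
      unfolding Q using rho beta by (intro mult_pos_pos) auto
    then have a': "a' < 1" using b1 by (simp add: zero_less_mult_iff)
    have z: "(\<integral>\<^sup>+z. f r y (sqrt ?m * z) \<partial>SN)
        = ennreal (?C / sqrt (1 - \<beta> * ?m)) * ennreal (exp (0 * y + a' * y\<^sup>2 / 2))" for y
    proof -
      have "(\<integral>\<^sup>+z. f r y (sqrt ?m * z) \<partial>SN)
         = (\<integral>\<^sup>+z. ennreal (?C * exp (\<beta> / 2 * y\<^sup>2))
            * ennreal (exp ((2 * s * \<beta> * ?e * y * sqrt ?m) * z + (\<beta> * ?m) * z\<^sup>2 / 2)) \<partial>SN)"
      proof (intro nn_integral_cong)
        fix z
        have e: "\<beta> / 2 * (sqrt ?m * z)\<^sup>2 + 2 * s * \<beta> * ?e * y * (sqrt ?m * z) + \<beta> / 2 * y\<^sup>2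
            = \<beta> / 2 * y\<^sup>2 + ((2 * s * \<beta> * ?e * y * sqrt ?m) * z + (\<beta> * ?m) * z\<^sup>2 / 2)"
          using m0 by (simp add: power_mult_distrib)
        show "f r y (sqrt ?m * z) = ennreal (?C * exp (\<beta> / 2 * y\<^sup>2))
            * ennreal (exp ((2 * s * \<beta> * ?e * y * sqrt ?m) * z + (\<beta> * ?m) * z\<^sup>2 / 2))"
          unfolding f_def e exp_add[of "\<beta> / 2 * y\<^sup>2"] mult.assoc[symmetric, of ?C]
          by (rule ennreal_mult'') simp
      qed
      also have "\<dots> = ennreal (?C * exp (\<beta> / 2 * y\<^sup>2))
            * ennreal (exp ((2 * s * \<beta> * ?e * y * sqrt ?m)\<^sup>2 / (2 * (1 - \<beta> * ?m))) / sqrt (1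
                - \<beta> * ?m))"
        using b1 by (subst nn_integral_cmult, simp, subst gaussian_integral) simp_all
      also have "\<dots> = ennreal ((?C * exp (\<beta> / 2 * y\<^sup>2))
            * (exp ((2 * s * \<beta> * ?e * y * sqrt ?m)\<^sup>2 / (2 * (1 - \<beta> * ?m))) / sqrt (1 - \<beta> * ?m)))"
        using beta by (intro ennreal_mult'[symmetric]) auto
      also have "(?C * exp (\<beta> / 2 * y\<^sup>2))
            * (exp ((2 * s * \<beta> * ?e * y * sqrt ?m)\<^sup>2 / (2 * (1 - \<beta> * ?m))) / sqrt (1 - \<beta> * ?m))
          = ?C / sqrt (1 - \<beta> * ?m) * exp (0 * y + a' * y\<^sup>2 / 2)"
      proof -
        have sq: "(2 * s * \<beta> * ?e * y * sqrt ?m)\<^sup>2 = 4 * s\<^sup>2 * \<beta>\<^sup>2 * y\<^sup>2 * ?m"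
          using m0 by (simp add: power_mult_distrib e2)
        have q: "\<beta> / 2 * y\<^sup>2 + 4 * s\<^sup>2 * \<beta>\<^sup>2 * y\<^sup>2 * ?m / (2 * d)
            = 0 * y + (\<beta> + 4 * s\<^sup>2 * \<beta>\<^sup>2 * ?m / d) * y\<^sup>2 / 2" if "d \<noteq> 0" for d
          using that by (simp add: field_simps)
        have "\<beta> / 2 * y\<^sup>2 + (2 * s * \<beta> * ?e * y * sqrt ?m)\<^sup>2 / (2 * (1 - \<beta> * ?m))
            = 0 * y + a' * y\<^sup>2 / 2"
          unfolding a'_def sq by (rule q) (use b1 in simp)
        then have "exp (\<beta> / 2 * y\<^sup>2) * exp ((2 * s * \<beta> * ?e * y * sqrt ?m)\<^sup>2 / (2 * (1
            - \<beta> * ?m))) = exp (0 * y + a' * y\<^sup>2 / 2)"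
          by (simp only: exp_add[symmetric])
        then show ?thesis by (simp only: mult.assoc times_divide_eq_right times_divide_eq_left)
      qed
      also have "ennreal \<dots> = ennreal (?C / sqrt (1 - \<beta> * ?m)) * ennreal (exp (0 * y
          + a' * y\<^sup>2 / 2))"
        by (rule ennreal_mult'') simp
      finally show ?thesis .
    qed
    have "(\<integral>\<^sup>+y. (\<integral>\<^sup>+z. f r y (sqrt ?m * z) \<partial>SN) \<partial>SN)
       = ennreal (?C / sqrt (1 - \<beta> * ?m)) * ennreal (exp (0\<^sup>2 / (2 * (1 - a'))) / sqrt (1 - a'))"
      unfolding z by (subst nn_integral_cmult, simp, subst gaussian_integral[OF a']) (rule refl)
    also have "\<dots> = ennreal (?C / sqrt ((1 - \<beta> * ?m) * (1 - a')))"
      using beta b1 a' by (simp add: ennreal_mult'[symmetric] real_sqrt_mult)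
    also have "?C / sqrt ((1 - \<beta> * ?m) * (1 - a'))
        = 1 / sqrt (1 + \<beta>\<^sup>2 * ?m / (1 - \<beta> * real n) * (1 - 4 * s\<^sup>2))"
      unfolding Q using beta by (simp add: real_sqrt_mult)
    finally show "(\<integral>\<^sup>+y. (\<integral>\<^sup>+z. f r y (sqrt ?m * z) \<partial>SN) \<partial>SN)
      = ennreal (1 / sqrt (1 + \<beta>\<^sup>2 * ?m / (1 - \<beta> * real n) * (1 - 4 * s\<^sup>2)))" .
  qed
  also have "\<dots> = ennreal ((1 / sqrt (1 + \<beta>\<^sup>2 * ?m / (1 - \<beta> * real n) * (1 - 4 * s\<^sup>2))) ^ p)"
  proof -
    have "0 \<le> 1 / sqrt (1 + \<beta>\<^sup>2 * ?m / (1 - \<beta> * real n) * (1 - 4 * s\<^sup>2))"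
      using beta s m0 by (intro divide_nonneg_nonneg real_sqrt_ge_zero add_nonneg_nonneg
          mult_nonneg_nonneg) auto
    then show ?thesis by (simp add: ennreal_power)
  qed
  finally show ?thesis .
qed

section \<open>Impossibility below the critical separation\<close>

lemma eucl_norm_vec: "eucl_norm (vec p f) = sqrt (\<Sum>r<p. (f r)\<^sup>2)"
  unfolding eucl_norm_def scalar_prod_def
  by (simp add: power2_eq_square atLeast0LessThan)

lemma measurable_scaled_estimator:
  assumes "T \<in> estimators p n"
  shows "(\<lambda>x. T (mat p n (\<lambda>ij. \<sigma> * x ij))) \<in> noise p n \<rightarrow>\<^sub>M count_space (sign_vecs n)"
proof -
  have "(\<lambda>x. mat p n (\<lambda>ij. \<sigma> * x ij)) \<in> noise p n \<rightarrow>\<^sub>M data_space p n"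
    by (rule measurable_mat) (intro borel_measurable_times borel_measurable_const
        measurable_noise_entry)
  then show ?thesis
    using assms unfolding estimators_def by (rule measurable_compose)
qed

lemma risk_le_max_risk:
  assumes "\<theta> \<in> carrier_vec p" "\<Delta> \<le> eucl_norm \<theta>" "\<eta> \<in> sign_vecs n"
  shows "risk p n \<sigma> T \<theta> \<eta> \<le> max_risk p n \<sigma> \<Delta> T"
proof -
  have "(\<theta>, \<eta>) \<in> param_space p n \<Delta>" using assms by (simp add: param_space_def)
  then have "(case (\<theta>, \<eta>) of (\<theta>, \<eta>) \<Rightarrow> risk p n \<sigma> T \<theta> \<eta>) \<le> max_risk p n \<sigma> \<Delta> T"
    unfolding max_risk_def by (rule SUP_upper)
  then show ?thesis by simp
qed

lemma risk_le:
  assumes "T \<in> estimators p n" "\<theta> \<in> carrier_vec p" "\<eta> \<in> sign_vecs n"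
  shows "risk p n \<sigma> T \<theta> \<eta> \<le> ennreal (2 * real n)"
proof -
  interpret prob_space "noise p n" by (rule prob_space_noise)
  have "risk p n \<sigma> T \<theta> \<eta> \<le> (\<integral>\<^sup>+x. ennreal (2 * real n) \<partial>noise p n)"
    unfolding risk_noise[OF assms(1,2)]
    by (intro nn_integral_mono ennreal_leI loss_le estimator_sign[OF assms(1)] assms(3)) simp
  also have "\<dots> = ennreal (2 * real n)" by (simp add: emeasure_space_1)
  finally show ?thesis .
qed

lemma sign_vecs_nonempty: "sign_vecs n \<noteq> {}"
proof -
  have "vec n (\<lambda>_. 1) \<in> sign_vecs n" by (simp add: sign_vecs_def)
  then show ?thesis by blast
qed

lemma card_sign_vecs_pos: "0 < real (card (sign_vecs n))"
  using finite_sign_vecs sign_vecs_nonempty by (simp add: card_gt_0_iff)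

lemma cancel_card:
  assumes "ennreal (N * a) \<le> ennreal N * b" "N > 0" "a \<ge> 0"
  shows "ennreal a \<le> b"
proof -
  have "ennreal N * ennreal a \<le> ennreal N * b"
    using assms by (simp add: ennreal_mult)
  then show ?thesis using assms(2) by (subst (asm) ennreal_mult_le_mult_iff) simp_all
qed

text \<open>The centre is known and points in the first coordinate direction.\<close>

lemma max_risk_ge_low_dim:
  assumes n: "n \<ge> 2" and p: "p > 0" and sig: "\<sigma> > 0" and T: "T \<in> estimators p n" and Delta: "\<Delta> > 0"
    and l: "ln (real n) \<ge> 2" and X: "(\<Delta> / \<sigma>)\<^sup>2 \<le> 2 * c * ln (real n)" and c: "c \<le> 1"
  shows "ennreal ((real n - 1) / 2 * (exp (- 2 * sqrt (2 * ln (real n))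
      - c * ln (real n)) / 2)) \<le> max_risk p n \<sigma> \<Delta> T"
proof -
  let ?N = "real (card (sign_vecs n))" and ?l = "ln (real n)"
  define t where "t r = (if r = (0::nat) then \<Delta> / \<sigma> else 0)" for r
  define u where "u \<eta> x = (\<Sum>r<p. t r * (\<Sum>j<n. vec_index \<eta> j * x (r, j))
      - real n * (t r)\<^sup>2 / 2)" for \<eta> x
  define R where "R = (\<Delta> / \<sigma>)\<^sup>2"
  have tR: "(\<Sum>r<p. (t r)\<^sup>2) = R"
  proof -
    have "(\<Sum>r<p. (t r)\<^sup>2) = (\<Sum>r<p. if r = 0 then R else 0)"
      by (intro sum.cong) (auto simp: t_def R_def)
    then show ?thesis using p by simp
  qed
  have "(\<Sum>r<p. (\<sigma> * t r)\<^sup>2) = \<Delta>\<^sup>2"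
    using tR sig by (simp add: power_mult_distrib sum_distrib_left[symmetric] R_def power_divide)
  then have norm: "eucl_norm (vec p (\<lambda>r. \<sigma> * t r)) = \<Delta>"
    using Delta by (simp add: eucl_norm_vec)
  have um: "u \<eta> \<in> borel_measurable (noise p n)" for \<eta>
    unfolding u_def by (intro borel_measurable_sum borel_measurable_diff borel_measurable_times
        borel_measurable_const measurable_row_sum) auto
  have "c * ?l \<le> 1 * ?l" using c l by (intro mult_right_mono) auto
  then have R: "R \<le> 2 * ?l" using X by (simp add: R_def)
  have key: "ennreal (exp (- 2 * sqrt (2 * ?l) - c * ?l) / 2)
    \<le> (\<integral>\<^sup>+x. min (ennreal (exp (u \<eta> x))) (ennreal (exp (u (flip i \<eta>) x))) \<partial>noise p n)"
    if eta: "\<eta> \<in> sign_vecs n" and i: "i < n" for \<eta> i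
  proof -
    define G where "G s = exp (- (1 - 4 * s\<^sup>2) * R / 2)" for s
    have "exp (- 2 * sqrt (2 * ?l) - c * ?l) / 2 \<le> exp (- 2 * sqrt (2 * ?l) - R / 2) / 2"
      using X by (simp add: R_def)
    then have "ennreal (exp (- 2 * sqrt (2 * ?l) - c * ?l) / 2)
        \<le> ennreal (exp (- 2 * sqrt (2 * ?l) - R / 2) / 2)"
      by (rule ennreal_leI)
    also have "\<dots> \<le> (\<integral>\<^sup>+x. ennreal (min (exp (u \<eta> x)) (exp (u (flip i \<eta>) x))) \<partial>noise p n)"
    proof (rule min_density_bound[where G = G])
      show "(\<integral>\<^sup>+x. ennreal (exp ((1/2 + s) * u \<eta> x + (1/2 - s) * u (flip i \<eta>) x)) \<partial>noise p n)
          = ennreal (G s)" for s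
        unfolding u_def G_def tR[symmetric] by (rule affinity_fixed_center[OF eta i])
      show "G s \<le> G 0 * exp (2 * s\<^sup>2 * R)" for s
        unfolding G_def exp_add[symmetric] by (simp add: field_simps)
    qed (use l R um in \<open>simp_all add: G_def\<close>)
    also have "\<dots> = (\<integral>\<^sup>+x. min (ennreal (exp (u \<eta> x))) (ennreal (exp (u (flip i \<eta>) x))) \<partial>noise p n)"
      by (intro nn_integral_cong) (simp add: min_def)
    finally show ?thesis .
  qed
  have "ennreal (?N * ((real n - 1) / 2 * (exp (- 2 * sqrt (2 * ?l) - c * ?l) / 2)))
      \<le> (\<Sum>\<eta>\<in>sign_vecs n. \<integral>\<^sup>+x. ennreal (exp (u \<eta> x))
          * ennreal (loss n (T (mat p n (\<lambda>ij. \<sigma> * x ij))) \<eta>) \<partial>noise p n)"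
    using n key measurable_scaled_estimator[OF T] um
    by (intro sum_loss_ge_min_density estimator_sign[OF T]) (simp_all add: measurable_compose[OF
        um])
  also have "\<dots> = (\<Sum>\<eta>\<in>sign_vecs n. risk p n \<sigma> T (vec p (\<lambda>r. \<sigma> * t r)) \<eta>)"
    unfolding u_def by (intro sum.cong refl risk_log_density[OF T, symmetric])
  also have "\<dots> \<le> (\<Sum>\<eta>\<in>sign_vecs n. max_risk p n \<sigma> \<Delta> T)"
    using norm by (intro sum_mono risk_le_max_risk) simp_all
  also have "\<dots> = ennreal ?N * max_risk p n \<sigma> \<Delta> T"
    by (simp add: ennreal_of_nat_eq_real_of_nat)
  finally show ?thesis
    by (rule cancel_card[OF _ card_sign_vecs_pos]) (use n in simp)
qed

text \<open>The affinities under a Gaussian prior satisfy the hypotheses of \<open>min_density_bound\<close> with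
\<open>R = p * \<rho>\<close>.\<close>

lemma gaussian_affinity_bounds:
  fixes \<rho> s :: real and p :: nat
  assumes rho: "0 \<le> \<rho>"
  defines "G \<equiv> \<lambda>s. (1 / sqrt (1 + \<rho> * (1 - 4 * s\<^sup>2))) ^ p"
  shows "exp (- (real p * \<rho>) / 2) \<le> G 0"
    and "4 * s\<^sup>2 \<le> 1 \<Longrightarrow> 0 \<le> G s"
    and "4 * s\<^sup>2 \<le> 1 \<Longrightarrow> G s \<le> G 0 * exp (2 * s\<^sup>2 * (real p * \<rho>))"
proof -
  have "sqrt (1 + \<rho>) \<le> exp (\<rho> / 2)"
    using exp_ge_add_one_self[of \<rho>]
        by (intro real_le_lsqrt) (simp_all add: exp_double[symmetric] power2_eq_square
          exp_add[symmetric])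
  then have "1 / exp (\<rho> / 2) \<le> 1 / sqrt (1 + \<rho>)"
    using rho by (intro divide_left_mono) simp_all
  then have "exp (- \<rho> / 2) ^ p \<le> (1 / sqrt (1 + \<rho>)) ^ p"
    by (intro power_mono) (simp_all add: exp_minus inverse_eq_divide)
  then show "exp (- (real p * \<rho>) / 2) \<le> G 0"
    by (simp add: G_def exp_of_nat_mult[symmetric] power_divide)
  assume s: "4 * s\<^sup>2 \<le> 1"
  define q where "q = 1 + \<rho> * (1 - 4 * s\<^sup>2)"
  have q: "q \<ge> 1" using rho s unfolding q_def by simp
  show "0 \<le> G s" using q unfolding G_def q_def[symmetric] by simp
  have "1 + \<rho> \<le> q * (1 + 4 * s\<^sup>2 * \<rho>)"
  proof -
    have "1 * (4 * s\<^sup>2 * \<rho>) \<le> q * (4 * s\<^sup>2 * \<rho>)" using q rho by (intro mult_right_mono) simp_all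
    then show ?thesis unfolding distrib_left by (simp add: q_def algebra_simps)
  qed
  also have "\<dots> \<le> q * exp (4 * s\<^sup>2 * \<rho>)"
    using q exp_ge_add_one_self by (intro mult_left_mono) simp_all
  finally have "sqrt (1 + \<rho>) \<le> sqrt (q * exp (4 * s\<^sup>2 * \<rho>))" by (rule real_sqrt_le_mono)
  also have "\<dots> = sqrt q * exp (2 * s\<^sup>2 * \<rho>)"
  proof -
    have "exp (4 * s\<^sup>2 * \<rho>) = (exp (2 * s\<^sup>2 * \<rho>))\<^sup>2" by (simp add: exp_double[symmetric] mult_ac)
    then show ?thesis by (simp add: real_sqrt_mult)
  qed
  finally have "1 / sqrt q \<le> 1 / sqrt (1 + \<rho>) * exp (2 * s\<^sup>2 * \<rho>)"
    using q rho by (simp add: field_simps)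
  then have "(1 / sqrt q) ^ p \<le> (1 / sqrt (1 + \<rho>) * exp (2 * s\<^sup>2 * \<rho>)) ^ p"
    using q by (intro power_mono) simp_all
  also have "\<dots> = (1 / sqrt (1 + \<rho>)) ^ p * exp (2 * s\<^sup>2 * (real p * \<rho>))"
  proof -
    have "exp (2 * s\<^sup>2 * \<rho>) ^ p = exp (2 * s\<^sup>2 * (real p * \<rho>))"
      by (simp add: exp_of_nat_mult[symmetric] mult_ac)
    then show ?thesis by (simp only: power_mult_distrib)
  qed
  finally show "G s \<le> G 0 * exp (2 * s\<^sup>2 * (real p * \<rho>))"
    by (simp add: G_def q_def)
qed

text \<open>The centre is \<open>\<sigma> * \<alpha> * g\<close> with \<open>g\<close> standard normal and \<open>\<alpha>\<^sup>2 * p = x'\<close>, which exceeds \<open>(\<Delta> / \<sigma>)\<^sup>2\<close>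
by the factor \<open>1 + \<delta>\<close>; the last term accounts for the centres shorter than \<open>\<Delta>\<close>, on which the risk is
at most \<open>2 * n\<close>.\<close>

lemma max_risk_ge_high_dim:
  assumes n: "n \<ge> 2" and p: "p > 0" and sig: "\<sigma> > 0" and T: "T \<in> estimators p n" and Delta: "\<Delta> > 0"
    and l: "ln (real n) \<ge> 2" and \<delta>: "\<delta> > 0" and x': "x' = (1 + \<delta>) * (\<Delta> / \<sigma>)\<^sup>2"
    and X: "x'\<^sup>2 \<le> 2 * c * ln (real n) * (x' + real p / real n)" and c: "c \<le> 1"
  shows "ennreal ((real n - 1) / 2 * (exp (- 2 * sqrt (2 * ln (real n)) - c * ln (real n)) / 2))
    \<le> max_risk p n \<sigma> \<Delta> T + ennreal (2 * real n * exp (- real p * (1 - 1 / (1 + \<delta>))\<^sup>2 / 8))"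
proof -
  let ?N = "real (card (sign_vecs n))" and ?l = "ln (real n)"
  define \<alpha> where "\<alpha> = sqrt (x' / real p)"
  define \<beta> where "\<beta> = \<alpha>\<^sup>2 / (1 + real n * \<alpha>\<^sup>2)"
  define u where "u \<eta> x = (\<Sum>r<p. \<beta> / 2 * (\<Sum>j<n. vec_index \<eta> j * x (r, j))\<^sup>2
      + ln (1 - \<beta> * real n) / 2)" for \<eta> x
  define \<rho> where "\<rho> = \<beta>\<^sup>2 * (real n - 1) / (1 - \<beta> * real n)"
  define prior where "prior = PiM {..<p} (\<lambda>_. SN)"
  define L where "L \<eta> x = ennreal (loss n (T (mat p n (\<lambda>ij. \<sigma> * x ij))) \<eta>)" for \<eta> x
  define A where "A = {g \<in> space prior. (\<Sum>r<p. (g r)\<^sup>2) < real p * (1 / (1 + \<delta>))}"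
  let ?\<theta> = "\<lambda>g. vec p (\<lambda>r. \<sigma> * (\<alpha> * g r))"
  let ?tail = "2 * real n * exp (- real p * (1 - 1 / (1 + \<delta>))\<^sup>2 / 8)"
  interpret P: prob_space prior unfolding prior_def by (intro prob_space_PiM prob_space_SN)
  interpret Q: prob_space "noise p n" by (rule prob_space_noise)
  \<comment> \<open>\<open>\<beta>\<close> and the logarithmic term in \<open>u\<close> result from integrating the centre out of the density.\<close>
  interpret PQ: pair_sigma_finite prior "noise p n" ..
  have x'0: "x' > 0" unfolding x' using \<delta> Delta sig by (intro mult_pos_pos) simp_all
  have a2: "\<alpha>\<^sup>2 = x' / real p" "\<alpha>\<^sup>2 > 0" using x'0 p by (simp_all add: \<alpha>_def)
  have d0: "1 + real n * \<alpha>\<^sup>2 > 0"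
  proof -
    have "0 \<le> real n * \<alpha>\<^sup>2" by simp
    then show ?thesis by linarith
  qed
  have beta_n: "1 - \<beta> * real n = 1 / (1 + real n * \<alpha>\<^sup>2)"
    using d0 unfolding \<beta>_def by (simp add: field_simps)
  have b: "0 \<le> \<beta>" "\<beta> * real n < 1"
  proof -
    show "0 \<le> \<beta>" unfolding \<beta>_def by (intro divide_nonneg_pos d0) simp
    have "1 / (1 + real n * \<alpha>\<^sup>2) > 0" using d0 by simp
    then show "\<beta> * real n < 1" using beta_n by linarith
  qed
  have rho: "\<rho> \<ge> 0" unfolding \<rho>_def using b n
      by (intro divide_nonneg_nonneg mult_nonneg_nonneg) auto
  have R: "real p * \<rho> \<le> 2 * (c * ?l)"
  proof -
    have "\<rho> = \<beta>\<^sup>2 * (1 + real n * \<alpha>\<^sup>2) * (real n - 1)"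
      unfolding \<rho>_def beta_n using d0 by (simp add: field_simps)
    also have "\<beta>\<^sup>2 * (1 + real n * \<alpha>\<^sup>2) = (\<alpha>\<^sup>2)\<^sup>2 / (1 + real n * \<alpha>\<^sup>2)"
      using d0 unfolding \<beta>_def by (simp add: power2_eq_square)
    also have "(\<alpha>\<^sup>2)\<^sup>2 / (1 + real n * \<alpha>\<^sup>2) * (real n - 1) \<le> (\<alpha>\<^sup>2)\<^sup>2 / (1 + real n * \<alpha>\<^sup>2) * real n"
      by (intro mult_left_mono divide_nonneg_pos d0) simp_all
    also have "\<dots> = (x'\<^sup>2 / (x' + real p / real n)) / real p"
    proof -
      have "(x' / P)\<^sup>2 / (N / P * y) * N = x'\<^sup>2 / y / P" if "P > 0" "N > 0" "y > 0"
          for P N y :: real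
        using that by (simp add: power2_eq_square field_simps)
      moreover have "1 + real n * (x' / real p) = real n / real p * (x' + real p / real n)"
        using n p by (simp add: distrib_left)
      ultimately show ?thesis unfolding a2(1) using n p x'0 by (simp add: add_pos_nonneg)
    qed
    finally have "real p * \<rho> \<le> real p * ((x'\<^sup>2 / (x' + real p / real n)) / real p)"
      by (rule mult_left_mono) simp
    also have "\<dots> = x'\<^sup>2 / (x' + real p / real n)" using p by simp
    also have "\<dots> \<le> 2 * (c * ?l)"
    proof -
      have "x' + real p / real n > 0" using x'0 by (simp add: add_pos_nonneg)
      then show ?thesis using X by (simp only: pos_divide_le_eq mult_ac)
    qed
    finally show ?thesis .
  qed
  have um: "u \<eta> \<in> borel_measurable (noise p n)" for \<eta>
    unfolding u_def by (intro borel_measurable_sum borel_measurable_add borel_measurable_times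
        borel_measurable_const borel_measurable_power measurable_row_sum) auto
  have "c * ?l \<le> 1 * ?l" using c l by (intro mult_right_mono) auto
  then have R2: "real p * \<rho> \<le> 2 * ?l" using R by simp
  have key: "ennreal (exp (- 2 * sqrt (2 * ?l) - c * ?l) / 2)
    \<le> (\<integral>\<^sup>+x. min (ennreal (exp (u \<eta> x))) (ennreal (exp (u (flip i \<eta>) x))) \<partial>noise p n)"
    if eta: "\<eta> \<in> sign_vecs n" and i: "i < n" for \<eta> i
  proof -
    define G where "G s = (1 / sqrt (1 + \<rho> * (1 - 4 * s\<^sup>2))) ^ p" for s
    have "exp (- 2 * sqrt (2 * ?l) - c * ?l) / 2 \<le> exp (- 2 * sqrt (2 * ?l) - (real p * \<rho>) / 2) / 2"
      using R by simp
    then have "ennreal (exp (- 2 * sqrt (2 * ?l) - c * ?l) / 2)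
        \<le> ennreal (exp (- 2 * sqrt (2 * ?l) - (real p * \<rho>) / 2) / 2)"
      by (rule ennreal_leI)
    also have "\<dots> \<le> (\<integral>\<^sup>+x. ennreal (min (exp (u \<eta> x)) (exp (u (flip i \<eta>) x))) \<partial>noise p n)"
    proof (rule min_density_bound[where G = G])
      show "(\<integral>\<^sup>+x. ennreal (exp ((1/2 + s) * u \<eta> x + (1/2 - s) * u (flip i \<eta>) x)) \<partial>noise p n)
          = ennreal (G s)"
        if "4 * s\<^sup>2 \<le> 1" for s
        unfolding u_def G_def \<rho>_def by (rule affinity_gaussian_center[OF eta i b that])
      show "G s \<le> G 0 * exp (2 * s\<^sup>2 * (real p * \<rho>))" if "4 * s\<^sup>2 \<le> 1" for s
        unfolding G_def by (rule gaussian_affinity_bounds(3)[OF rho that])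
      show "exp (- (real p * \<rho>) / 2) \<le> G 0"
        unfolding G_def by (rule gaussian_affinity_bounds(1)[OF rho])
      show "0 \<le> G s" if "4 * s\<^sup>2 \<le> 1" for s
        unfolding G_def by (rule gaussian_affinity_bounds(2)[OF rho that])
    qed (use l R2 um in \<open>simp_all add: G_def\<close>)
    also have "\<dots> = (\<integral>\<^sup>+x. min (ennreal (exp (u \<eta> x))) (ennreal (exp (u (flip i \<eta>) x))) \<partial>noise p n)"
      by (intro nn_integral_cong) (simp add: min_def)
    finally show ?thesis .
  qed
  have Lm: "L \<eta> \<in> borel_measurable (noise p n)" for \<eta>
    unfolding L_def by (rule measurable_compose[OF measurable_scaled_estimator[OF T]
        borel_measurable_count_space])
  have gm: "(\<lambda>g. g r) \<in> borel_measurable prior" if "r < p" for r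
    using measurable_component_singleton[of r "{..<p}" "\<lambda>_. SN"] that by (simp add: prior_def)
  have mixture: "(\<integral>\<^sup>+g. risk p n \<sigma> T (?\<theta> g) \<eta> \<partial>prior)
      = (\<integral>\<^sup>+x. ennreal (exp (u \<eta> x)) * L \<eta> x \<partial>noise p n)" if eta: "\<eta> \<in> sign_vecs n" for \<eta>
  proof -
    define s where "s r x = (\<Sum>j<n. vec_index \<eta> j * x (r, j))" for r and x :: "nat \<times> nat \<Rightarrow> real"
    have sm: "s r \<in> borel_measurable (noise p n)" if "r < p" for r
      unfolding s_def using that by (intro measurable_row_sum) auto
    let ?h = "\<lambda>g x. exp (\<Sum>r<p. \<alpha> * g r * s r x - real n * (\<alpha> * g r)\<^sup>2 / 2)"
    have jm: "(\<lambda>(g, x). ennreal (?h g x) * L \<eta> x)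
        \<in> borel_measurable (prior \<Otimes>\<^sub>M noise p n)"
      unfolding case_prod_beta
      by (intro borel_measurable_times_ennreal measurable_compose[OF _ measurable_ennreal]
          measurable_compose[OF _ borel_measurable_exp] borel_measurable_sum
              borel_measurable_diff borel_measurable_times
          borel_measurable_divide borel_measurable_power
          borel_measurable_const measurable_compose[OF measurable_fst gm]
          measurable_compose[OF measurable_snd sm] measurable_compose[OF measurable_snd Lm]) auto
    have inner: "(\<integral>\<^sup>+g. ennreal (?h g x) \<partial>prior) = ennreal (exp (u \<eta> x))" for x
    proof -
      have "(\<integral>\<^sup>+g. ennreal (?h g x) \<partial>prior)
          = (\<integral>\<^sup>+g. (\<Prod>r<p. ennreal (exp ((\<alpha> * s r x) * g r
              + (- real n * \<alpha>\<^sup>2) * (g r)\<^sup>2 / 2))) \<partial>prior)"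
        by (intro nn_integral_cong)
          (simp add: exp_sum prod_ennreal power_mult_distrib mult_ac)
      also have "\<dots> = (\<Prod>r<p. \<integral>\<^sup>+z. ennreal (exp ((\<alpha> * s r x) * z + (- real n * \<alpha>\<^sup>2) * z\<^sup>2 / 2)) \<partial>SN)"
        unfolding prior_def by (subst SN.product_nn_integral_prod) auto
      also have "\<dots> = (\<Prod>r<p. ennreal (exp (\<beta> / 2 * (s r x)\<^sup>2 + ln (1 - \<beta> * real n) / 2)))"
      proof (intro prod.cong refl)
        fix r
        have "exp (ln (1 - \<beta> * real n) / 2) = sqrt (1 - \<beta> * real n)"
          using b by (simp add: ln_sqrt[symmetric])
        also have "\<dots> = 1 / sqrt (1 + real n * \<alpha>\<^sup>2)" unfolding beta_n by (simp add: real_sqrt_divide)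
        finally have e: "exp (ln (1 - \<beta> * real n) / 2) = 1 / sqrt (1 + real n * \<alpha>\<^sup>2)" .
        have "(\<integral>\<^sup>+z. ennreal (exp ((\<alpha> * s r x) * z + (- real n * \<alpha>\<^sup>2) * z\<^sup>2 / 2)) \<partial>SN)
            = ennreal (exp ((\<alpha> * s r x)\<^sup>2 / (2 * (1 - (- real n * \<alpha>\<^sup>2)))) / sqrt (1
                - (- real n * \<alpha>\<^sup>2)))"
          using d0 by (intro gaussian_integral) linarith
        also have "(\<alpha> * s r x)\<^sup>2 / (2 * (1 - (- real n * \<alpha>\<^sup>2))) = \<beta> / 2 * (s r x)\<^sup>2"
          unfolding \<beta>_def using d0 by (simp add: power_mult_distrib)
        also have "exp (\<beta> / 2 * (s r x)\<^sup>2) / sqrt (1 - (- real n * \<alpha>\<^sup>2))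
            = exp (\<beta> / 2 * (s r x)\<^sup>2 + ln (1 - \<beta> * real n) / 2)"
          unfolding exp_add e by simp
        finally show "(\<integral>\<^sup>+z. ennreal (exp ((\<alpha> * s r x) * z + (- real n * \<alpha>\<^sup>2) * z\<^sup>2 / 2)) \<partial>SN)
            = ennreal (exp (\<beta> / 2 * (s r x)\<^sup>2 + ln (1 - \<beta> * real n) / 2))" .
      qed
      also have "\<dots> = ennreal (exp (u \<eta> x))"
        unfolding u_def s_def[symmetric] by (simp add: prod_ennreal exp_sum)
      finally show ?thesis .
    qed
    have "(\<integral>\<^sup>+g. risk p n \<sigma> T (?\<theta> g) \<eta> \<partial>prior)
       = (\<integral>\<^sup>+g. (\<integral>\<^sup>+x. ennreal (?h g x) * L \<eta> x \<partial>noise p n) \<partial>prior)"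
      unfolding s_def L_def by (intro nn_integral_cong risk_log_density[OF T eta])
    also have "\<dots> = (\<integral>\<^sup>+x. (\<integral>\<^sup>+g. ennreal (?h g x) * L \<eta> x \<partial>prior) \<partial>noise p n)"
      by (rule PQ.Fubini'[OF jm, symmetric])
    also have "\<dots> = (\<integral>\<^sup>+x. ennreal (exp (u \<eta> x)) * L \<eta> x \<partial>noise p n)"
    proof (intro nn_integral_cong)
      fix x
      have "(\<lambda>g. ennreal (?h g x)) \<in> borel_measurable prior"
        by (intro measurable_compose[OF _ measurable_ennreal]
          measurable_compose[OF _ borel_measurable_exp] borel_measurable_sum
              borel_measurable_diff borel_measurable_times
          borel_measurable_divide borel_measurable_power borel_measurable_const gm) auto
      then show "(\<integral>\<^sup>+g. ennreal (?h g x) * L \<eta> x \<partial>prior)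
          = ennreal (exp (u \<eta> x)) * L \<eta> x"
        by (subst nn_integral_multc) (simp_all only: inner)
    qed
    finally show ?thesis .
  qed
  have truncated: "(\<integral>\<^sup>+g. risk p n \<sigma> T (?\<theta> g) \<eta> \<partial>prior)
      \<le> max_risk p n \<sigma> \<Delta> T + ennreal (?tail)"
    if eta: "\<eta> \<in> sign_vecs n" for \<eta>
  proof -
    have Am: "A \<in> sets prior"
    proof -
      have "(\<lambda>g. \<Sum>r<p. (g r)\<^sup>2) \<in> borel_measurable prior"
        by (intro borel_measurable_sum borel_measurable_power gm) auto
      then show ?thesis unfolding A_def by measurable
    qed
    have "(\<integral>\<^sup>+g. risk p n \<sigma> T (?\<theta> g) \<eta> \<partial>prior)
        \<le> (\<integral>\<^sup>+g. max_risk p n \<sigma> \<Delta> T + ennreal (2 * real n) * indicator A g \<partial>prior)"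
    proof (intro nn_integral_mono)
      fix g assume g: "g \<in> space prior"
      show "risk p n \<sigma> T (?\<theta> g) \<eta> \<le> max_risk p n \<sigma> \<Delta> T + ennreal (2 * real n) * indicator A g"
      proof (cases "g \<in> A")
        case True
        have "risk p n \<sigma> T (?\<theta> g) \<eta> \<le> ennreal (2 * real n)"
          by (rule risk_le[OF T vec_carrier eta])
        then show ?thesis using True by (simp add: add_increasing)
      next
        case False
        then have S: "real p * (1 / (1 + \<delta>)) \<le> (\<Sum>r<p. (g r)\<^sup>2)" using g by (simp add: A_def)
        have "(\<Delta> / \<sigma>)\<^sup>2 = \<alpha>\<^sup>2 * (real p * (1 / (1 + \<delta>)))"
          unfolding a2(1) x' using p \<delta> by simp
        also have "\<dots> \<le> \<alpha>\<^sup>2 * (\<Sum>r<p. (g r)\<^sup>2)" using S by (intro mult_left_mono) auto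
        finally have "\<sigma>\<^sup>2 * (\<Delta> / \<sigma>)\<^sup>2 \<le> \<sigma>\<^sup>2 * (\<alpha>\<^sup>2 * (\<Sum>r<p. (g r)\<^sup>2))"
          by (intro mult_left_mono) auto
        then have "\<Delta>\<^sup>2 \<le> (\<Sum>r<p. (\<sigma> * (\<alpha> * g r))\<^sup>2)"
          using sig by (simp add: power_mult_distrib sum_distrib_left power_divide)
        then have "\<Delta> \<le> eucl_norm (?\<theta> g)"
          unfolding eucl_norm_vec by (rule real_le_rsqrt)
        then have "risk p n \<sigma> T (?\<theta> g) \<eta> \<le> max_risk p n \<sigma> \<Delta> T"
          by (intro risk_le_max_risk eta vec_carrier)
        then show ?thesis using False by simp
      qed
    qed
    also have "\<dots> = max_risk p n \<sigma> \<Delta> T + ennreal (2 * real n) * emeasure prior A"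
      using Am by (subst nn_integral_add) (simp_all add: nn_integral_cmult P.emeasure_space_1)
    also have "\<dots> \<le> max_risk p n \<sigma> \<Delta> T
        + ennreal (2 * real n) * ennreal (exp (- real p * (1 - 1 / (1 + \<delta>))\<^sup>2 / 8))"
      unfolding A_def prior_def using \<delta>
      by (intro add_left_mono mult_left_mono chi_square_lower_tail) auto
    also have "\<dots> = max_risk p n \<sigma> \<Delta> T + ennreal (?tail)"
      by (subst ennreal_mult'[symmetric]) simp_all
    finally show ?thesis .
  qed
  have "ennreal (?N * ((real n - 1) / 2 * (exp (- 2 * sqrt (2 * ?l) - c * ?l) / 2)))
      \<le> (\<Sum>\<eta>\<in>sign_vecs n. \<integral>\<^sup>+x. ennreal (exp (u \<eta> x))
          * ennreal (loss n (T (mat p n (\<lambda>ij. \<sigma> * x ij))) \<eta>) \<partial>noise p n)"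
    using n key measurable_scaled_estimator[OF T] um
    by (intro sum_loss_ge_min_density estimator_sign[OF T]) (simp_all add: measurable_compose[OF
        um])
  also have "\<dots> = (\<Sum>\<eta>\<in>sign_vecs n. \<integral>\<^sup>+g. risk p n \<sigma> T (?\<theta> g) \<eta> \<partial>prior)"
    unfolding L_def[symmetric] by (intro sum.cong refl mixture[symmetric])
  also have "\<dots> \<le> (\<Sum>\<eta>\<in>sign_vecs n. max_risk p n \<sigma> \<Delta> T + ennreal (?tail))"
    by (intro sum_mono truncated)
  also have "\<dots> = ennreal ?N * (max_risk p n \<sigma> \<Delta> T + ennreal (?tail))"
    by (simp only: sum_constant ennreal_of_nat_eq_real_of_nat)
  finally show ?thesis
    by (rule cancel_card[OF _ card_sign_vecs_pos]) (use n in simp)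
qed

lemma impossible_if_max_risk_ge_1:
  assumes "\<forall>\<^sub>F n in sequentially. \<forall>T\<in>estimators (p n) n. 1 \<le> max_risk (p n) n (\<sigma> n) (\<Delta> n) T"
  shows "exact_recovery_impossible p \<sigma> \<Delta>"
proof -
  have "\<forall>\<^sub>F n in sequentially. 1 \<le> (INF T\<in>estimators (p n) n. max_risk (p n) n (\<sigma> n) (\<Delta> n) T)"
    using assms by eventually_elim (auto intro!: INF_greatest)
  then have "1 \<le> liminf (\<lambda>n. INF T\<in>estimators (p n) n. max_risk (p n) n (\<sigma> n) (\<Delta> n) T)"
    by (rule Liminf_bounded)
  then show ?thesis
    unfolding exact_recovery_impossible_def by (rule less_le_trans[rotated]) simp
qed

text \<open>Both choices of the prior lose a factor \<open>1 + \<delta>\<close> in \<open>X\<close>; with \<open>\<kappa> = (1 - \<epsilon>)\<^sup>2\<close> and \<open>\<delta> = 1 - \<kappa>\<close> the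
resulting constant \<open>c = (1 + \<delta>) * \<kappa> = 1 - \<delta>\<^sup>2\<close> is still below \<open>1\<close>, and the bound \<open>n powr (1 - c)\<close>, up
to subpolynomial factors, is unbounded.\<close>

theorem impossible_below_crit:
  fixes p :: "nat \<Rightarrow> nat" and \<sigma> \<Delta> :: "nat \<Rightarrow> real"
  assumes p: "\<And>n. n \<ge> 2 \<Longrightarrow> p n > 0" and sig: "\<And>n. n \<ge> 2 \<Longrightarrow> \<sigma> n > 0"
    and Delta: "\<And>n. n \<ge> 2 \<Longrightarrow> \<Delta> n > 0"
    and eps: "\<epsilon> > 0" and le: "\<And>n. n \<ge> 2 \<Longrightarrow> \<Delta> n \<le> critical_sep (p n) n (\<sigma> n) * (1 - \<epsilon>)"
  shows "exact_recovery_impossible p \<sigma> \<Delta>"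
proof (rule impossible_if_max_risk_ge_1)
  define \<kappa> where "\<kappa> = (1 - \<epsilon>)\<^sup>2"
  have eps1: "\<epsilon> < 1"
  proof (rule ccontr)
    assume "\<not> \<epsilon> < 1"
    then have "critical_sep (p 2) 2 (\<sigma> 2) * (1 - \<epsilon>) \<le> 0"
      using crit_pos[of 2 "p 2"] by (intro mult_nonneg_nonpos) (simp_all add: critical_sep_crit)
    then show False using le[of 2] Delta[of 2] by simp
  qed
  have k: "0 < \<kappa>" "\<kappa> < 1" using eps eps1 by (simp_all add: \<kappa>_def abs_square_less_1)
  define \<delta> where "\<delta> = 1 - \<kappa>"
  define c where "c = (1 + \<delta>) * \<kappa>"
  have d: "0 < \<delta>" "\<delta> < 1" using k by (simp_all add: \<delta>_def)
  have c: "0 < c" "c < 1"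
  proof -
    have "c = 1 - \<delta>\<^sup>2" by (simp add: c_def \<delta>_def power2_eq_square algebra_simps)
    moreover have "0 < \<delta>\<^sup>2" "\<delta>\<^sup>2 < 1" using d by (simp_all add: abs_square_less_1)
    ultimately show "0 < c" "c < 1" by simp_all
  qed
  define \<gamma> where "\<gamma> = (1 - 1 / (1 + \<delta>))\<^sup>2 / 8 * \<delta>"
  have g: "\<gamma> > 0" unfolding \<gamma>_def using d by (intro mult_pos_pos) simp_all
  have "filterlim (\<lambda>n::nat. (real n - 1) / 2 * (exp (- 2 * sqrt (2 * ln (real n))
      - c * ln (real n)) / 2)) at_top sequentially"
    using c by real_asymp
  then have "\<forall>\<^sub>F n in sequentially. 2
      \<le> (real n - 1) / 2 * (exp (- 2 * sqrt (2 * ln (real n)) - c * ln (real n)) / 2)"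
    unfolding filterlim_at_top by (rule spec)
  moreover have "(\<lambda>n::nat. 2 * real n * exp (- (\<gamma> * (real n * ln (real n))))) \<longlonglongrightarrow> 0"
    using g by real_asymp
  then have "\<forall>\<^sub>F n in sequentially. 2 * real n * exp (- (\<gamma> * (real n * ln (real n)))) < 1"
    by (rule order_tendstoD) simp
  moreover have "filterlim (\<lambda>n::nat. ln (real n)) at_top sequentially" by real_asymp
  then have "\<forall>\<^sub>F n in sequentially. 2 \<le> ln (real n)" unfolding filterlim_at_top by (rule spec)
  moreover have "\<forall>\<^sub>F n in sequentially. n \<ge> (2::nat)" by (rule eventually_ge_at_top)
  ultimately show "\<forall>\<^sub>F n in sequentially. \<forall>T\<in>estimators (p n) n. 1 \<le> max_risk (p n) n (\<sigma> n) (\<Delta> n) T"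
  proof eventually_elim
    case (elim n)
    note n = elim(4)
    let ?l = "ln (real n)" and ?X = "(\<Delta> n / \<sigma> n)\<^sup>2"
    let ?b = "(real n - 1) / 2 * (exp (- 2 * sqrt (2 * ?l) - c * ?l) / 2)"
    have X: "?X \<le> \<kappa> * crit (p n) n"
    proof -
      have "(\<Delta> n)\<^sup>2 \<le> (critical_sep (p n) n (\<sigma> n) * (1 - \<epsilon>))\<^sup>2"
        using le[OF n] Delta[OF n] by (intro power_mono) simp_all
      also have "\<dots> = (\<sigma> n)\<^sup>2 * crit (p n) n * \<kappa>"
        using crit_pos[OF n, of "p n"] by (simp add: critical_sep_crit power_mult_distrib \<kappa>_def)
      finally show ?thesis using sig[OF n] by (simp add: power_divide divide_le_eq mult_ac)
    qed
    show ?case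
    proof
      fix T assume T: "T \<in> estimators (p n) n"
      show "1 \<le> max_risk (p n) n (\<sigma> n) (\<Delta> n) T"
      proof (cases "real (p n) \<le> \<delta> * (real n * ?l)")
        case True
        have "?X \<le> \<kappa> * ((2 + \<delta>) * ?l)"
          using X crit_le_low_dim[OF n _ True] d k
          by (intro order.trans[OF X] mult_left_mono) simp_all
        also have "\<dots> \<le> \<kappa> * ((2 + 2 * \<delta>) * ?l)"
          using d k elim(3) by (intro mult_left_mono mult_right_mono) simp_all
        finally have X2: "?X \<le> 2 * c * ?l" by (simp add: c_def algebra_simps)
        have "1 \<le> ennreal ?b" using elim(1) by (simp add: ennreal_1[symmetric] del: ennreal_1)
        also have "\<dots> \<le> max_risk (p n) n (\<sigma> n) (\<Delta> n) T"
          using c by (intro max_risk_ge_low_dim n p[OF n] sig[OF n] Delta[OF n] T elim(3) X2) simp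
        finally show ?thesis .
      next
        case False
        define x' where "x' = (1 + \<delta>) * ?X"
        have "x' \<le> c * crit (p n) n"
          unfolding x'_def c_def mult.assoc using X d by (intro mult_left_mono) simp_all
        then have X2: "x'\<^sup>2 \<le> 2 * c * ?l * (x' + real (p n) / real n)"
          using c d by (intro below_crit[OF n]) (simp_all add: x'_def)
        have "\<gamma> * (real n * ?l) \<le> (1 - 1 / (1 + \<delta>))\<^sup>2 / 8 * real (p n)"
          unfolding \<gamma>_def mult.assoc using False by (intro mult_left_mono) simp_all
        then have "2 * real n * exp (- real (p n) * (1 - 1 / (1 + \<delta>))\<^sup>2 / 8)
            \<le> 2 * real n * exp (- (\<gamma> * (real n * ?l)))"
          by (intro mult_left_mono) (simp_all add: mult.commute)
        then have tail: "2 * real n * exp (- real (p n) * (1 - 1 / (1 + \<delta>))\<^sup>2 / 8) \<le> 1"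
          using elim(2) by linarith
        have "1 + 1 \<le> ennreal ?b"
        proof -
          have "ennreal (1 + 1) \<le> ennreal ?b" using elim(1) by (intro ennreal_leI) simp
          then show ?thesis by simp
        qed
        also have "\<dots> \<le> max_risk (p n) n (\<sigma> n) (\<Delta> n) T
            + ennreal (2 * real n * exp (- real (p n) * (1 - 1 / (1 + \<delta>))\<^sup>2 / 8))"
          using c by (intro max_risk_ge_high_dim[OF n p[OF n] sig[OF n] T Delta[OF n] elim(3)
              d(1) x'_def X2]) simp
        also have "\<dots> \<le> 1 + max_risk (p n) n (\<sigma> n) (\<Delta> n) T"
          using tail by (subst add.commute, intro add_right_mono) (simp add: ennreal_le_1)
        finally show ?thesis unfolding ennreal_add_left_cancel_le by simp
      qed
    qed
  qed
qed

section \<open>Quadratic forms\<close>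

text \<open>Vectors and matrices of size \<open>n\<close> are functions here, of which only the values at indices
below \<open>n\<close> matter; this keeps sums over coordinates and entries explicit.\<close>

definition dot :: "nat \<Rightarrow> (nat \<Rightarrow> real) \<Rightarrow> (nat \<Rightarrow> real) \<Rightarrow> real" where
  "dot n x y = (\<Sum>i<n. x i * y i)"

definition app :: "nat \<Rightarrow> (nat \<Rightarrow> nat \<Rightarrow> real) \<Rightarrow> (nat \<Rightarrow> real) \<Rightarrow> nat \<Rightarrow> real" where
  "app n M x = (\<lambda>i. \<Sum>j<n. M i j * x j)"

definition symmetric_on :: "nat \<Rightarrow> (nat \<Rightarrow> nat \<Rightarrow> real) \<Rightarrow> bool" where
  "symmetric_on n M \<longleftrightarrow> (\<forall>i<n. \<forall>j<n. M i j = M j i)"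

text \<open>For symmetric matrices this is the bound \<open>B\<close> on the operator norm (lemma \<open>app_norm_bound\<close>), in
the form in which it is accessible to union bounds.\<close>

definition form_bounded :: "nat \<Rightarrow> (nat \<Rightarrow> nat \<Rightarrow> real) \<Rightarrow> real \<Rightarrow> bool" where
  "form_bounded n M B \<longleftrightarrow> (\<forall>x. \<bar>dot n x (app n M x)\<bar> \<le> B * dot n x x)"

lemma dot_linear:
  "dot n (\<lambda>i. x i + y i) z = dot n x z + dot n y z"
  "dot n (\<lambda>i. x i - y i) z = dot n x z - dot n y z"
  "dot n (\<lambda>i. c * x i) z = c * dot n x z"
  "dot n z (\<lambda>i. x i + y i) = dot n z x + dot n z y"
  "dot n z (\<lambda>i. x i - y i) = dot n z x - dot n z y"
  "dot n z (\<lambda>i. c * x i) = c * dot n z x"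
  by (simp_all add: dot_def sum.distrib sum_subtractf sum_distrib_left algebra_simps)

lemma app_linear:
  "app n M (\<lambda>i. x i + y i) = (\<lambda>i. app n M x i + app n M y i)"
  "app n M (\<lambda>i. x i - y i) = (\<lambda>i. app n M x i - app n M y i)"
  "app n M (\<lambda>i. c * x i) = (\<lambda>i. c * app n M x i)"
  by (simp_all add: app_def fun_eq_iff sum.distrib sum_subtractf sum_distrib_left algebra_simps)

lemma dot_commute: "dot n x y = dot n y x"
  by (simp add: dot_def mult.commute)

lemma dot_nonneg: "0 \<le> dot n x x"
  by (simp add: dot_def sum_nonneg)

lemma dot_self: "dot n x x = (\<Sum>i<n. (x i)\<^sup>2)"
  by (simp add: dot_def power2_eq_square)

lemma dot_app_symmetric:
  assumes "symmetric_on n M"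
  shows "dot n x (app n M y) = dot n y (app n M x)"
proof -
  have "dot n x (app n M y) = (\<Sum>i<n. \<Sum>j<n. x i * (M i j * y j))"
    by (simp add: dot_def app_def sum_distrib_left)
  also have "\<dots> = (\<Sum>j<n. \<Sum>i<n. x i * (M i j * y j))" by (rule sum.swap)
  also have "\<dots> = (\<Sum>j<n. \<Sum>i<n. y j * (M j i * x i))"
    using assms by (intro sum.cong refl) (simp add: symmetric_on_def)
  also have "\<dots> = dot n y (app n M x)"
    by (simp add: dot_def app_def sum_distrib_left)
  finally show ?thesis .
qed

lemma form_add_diff:
  assumes "symmetric_on n M"
  shows "dot n (\<lambda>i. x i + y i) (app n M (\<lambda>i. x i
      + y i)) - dot n (\<lambda>i. x i - y i) (app n M (\<lambda>i. x i - y i))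
    = 4 * dot n y (app n M x)"
  using dot_app_symmetric[OF assms, of x y] by (simp add: dot_linear app_linear)

lemma parallelogram:
  "dot n (\<lambda>i. x i + y i) (\<lambda>i. x i + y i) + dot n (\<lambda>i. x i - y i) (\<lambda>i. x i - y i)
      = 2 * (dot n x x + dot n y y)"
  by (simp add: dot_linear)

lemma bilinear_bound:
  assumes "symmetric_on n M" "form_bounded n M B"
  shows "\<bar>dot n y (app n M x)\<bar> \<le> B / 2 * (dot n x x + dot n y y)"
proof -
  let ?p = "\<lambda>i. x i + y i" and ?m = "\<lambda>i. x i - y i"
  have "\<bar>dot n ?p (app n M ?p)\<bar> \<le> B * dot n ?p ?p" "\<bar>dot n ?m (app n M ?m)\<bar> \<le> B * dot n ?m ?m"
    using assms(2) by (simp_all only: form_bounded_def)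
  then have "\<bar>4 * dot n y (app n M x)\<bar> \<le> B * (dot n ?p ?p + dot n ?m ?m)"
    unfolding form_add_diff[OF assms(1), symmetric] distrib_left by linarith
  then show ?thesis unfolding parallelogram by linarith
qed

text \<open>Insert \<open>y = M x / B\<close> into the bilinear bound obtained from polarization.\<close>

lemma app_norm_bound:
  assumes "symmetric_on n M" "form_bounded n M B" "B \<ge> 0"
  shows "dot n (app n M x) (app n M x) \<le> B\<^sup>2 * dot n x x"
proof -
  let ?w = "dot n (app n M x) (app n M x)"
  have *: "c * ?w \<le> B / 2 * (dot n x x + c\<^sup>2 * ?w)" for c
    using bilinear_bound[OF assms(1,2), of "\<lambda>i. c * app n M x i" x]
    by (simp add: dot_linear power2_eq_square mult.assoc)
  show ?thesis
  proof (cases "B = 0")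
    case True
    then show ?thesis using *[of 1] by simp
  next
    case False
    then have B: "B > 0" using assms(3) by simp
    have "1 / B * ?w \<le> B / 2 * dot n x x + 1 / (2 * B) * ?w"
      using *[of "1 / B"] B by (simp add: distrib_left power2_eq_square)
    then have "1 / (2 * B) * ?w \<le> B / 2 * dot n x x" by (simp add: field_simps)
    then have "2 * B * (1 / (2 * B) * ?w) \<le> 2 * B * (B / 2 * dot n x x)"
      using B by (intro mult_left_mono) auto
    then show ?thesis using B by (simp add: power2_eq_square)
  qed
qed

text \<open>Evaluate the nonnegative form at \<open>x - N x / C\<close>.\<close>

lemma psd_app_norm_bound:
  assumes sym: "symmetric_on n N" and psd: "\<And>x. 0 \<le> dot n x (app n N x)"
    and C: "C > 0" "\<And>x. dot n x (app n N x) \<le> C * dot n x x"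
  shows "dot n (app n N x) (app n N x) \<le> C * dot n x (app n N x)"
proof -
  let ?w = "app n N x"
  have e: "dot n (\<lambda>i. x i - c * ?w i) (app n N (\<lambda>i. x i - c * ?w i))
      = dot n x ?w - (2 * c) * dot n ?w ?w + c * (c * dot n ?w (app n N ?w))" for c
    using dot_app_symmetric[OF sym, of x ?w] by (simp add: dot_linear app_linear algebra_simps)
  have "0 \<le> dot n (\<lambda>i. x i - (1 / C) * ?w i) (app n N (\<lambda>i. x i - (1 / C) * ?w i))" by (rule psd)
  also have "\<dots> = dot n x ?w - 2 / C * dot n ?w ?w + 1 / C * (1 / C * dot n ?w (app n N ?w))"
    unfolding e by simp
  also have "\<dots> \<le> dot n x ?w - 2 / C * dot n ?w ?w + 1 / C * (1 / C * (C * dot n ?w ?w))"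
    using C by (intro add_left_mono mult_left_mono) auto
  also have "\<dots> = dot n x ?w - 1 / C * dot n ?w ?w" using C by (simp add: field_simps)
  finally have "C * (1 / C * dot n ?w ?w) \<le> C * dot n x ?w" using C by (intro mult_left_mono) auto
  then show ?thesis using C by simp
qed

lemma app_crude_bound:
  "\<exists>C>0. \<forall>x. dot n (app n M x) (app n M x) \<le> C * dot n x x"
proof -
  define C where "C = (\<Sum>i<n. \<Sum>j<n. (M i j)\<^sup>2) + 1"
  have "C > 0" unfolding C_def by (intro add_nonneg_pos sum_nonneg) auto
  moreover have "dot n (app n M x) (app n M x) \<le> C * dot n x x" for x
  proof -
    have "dot n (app n M x) (app n M x) = (\<Sum>i<n. (\<Sum>j<n. M i j * x j)\<^sup>2)"
      by (simp add: dot_self app_def)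
    also have "\<dots> \<le> (\<Sum>i<n. (\<Sum>j<n. (M i j)\<^sup>2) * (\<Sum>j<n. (x j)\<^sup>2))"
      by (intro sum_mono Cauchy_Schwarz_ineq_sum)
    also have "\<dots> = (\<Sum>i<n. \<Sum>j<n. (M i j)\<^sup>2) * dot n x x"
      by (simp add: sum_distrib_right dot_self)
    also have "\<dots> \<le> C * dot n x x" unfolding C_def by (intro mult_right_mono dot_nonneg) simp
    finally show ?thesis .
  qed
  ultimately show ?thesis by blast
qed

lemma form_crude_bound: "\<exists>C>0. form_bounded n M C"
proof -
  obtain C where C: "C > 0" "\<And>x. dot n (app n M x) (app n M x) \<le> C * dot n x x"
    using app_crude_bound by blast
  have "\<bar>dot n x (app n M x)\<bar> \<le> (1 + C) * dot n x x" for x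
  proof -
    let ?w = "app n M x"
    have "0 \<le> dot n (\<lambda>i. x i - ?w i) (\<lambda>i. x i - ?w i)" "0 \<le> dot n (\<lambda>i. x i + ?w i) (\<lambda>i. x i + ?w i)"
      by (rule dot_nonneg)+
    then have "\<bar>2 * dot n x ?w\<bar> \<le> dot n x x + dot n ?w ?w"
      unfolding dot_linear dot_commute[of n ?w x] by linarith
    also have "\<dots> \<le> dot n x x + C * dot n x x" using C by simp
    finally show ?thesis using dot_nonneg[of n x] C by (simp add: distrib_right)
  qed
  then show ?thesis unfolding form_bounded_def using C by (intro exI[of _ "1 + C"]) auto
qed

text \<open>The supremum \<open>S\<close> of the Rayleigh quotient is an eigenvalue. If it were not, \<open>N = S I - A\<close>
would be invertible, so that \<open>\<parallel>N x\<parallel>\<close> is bounded below on unit vectors; as \<open>N\<close> is positive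
semidefinite, \<open>\<parallel>N x\<parallel>\<^sup>2\<close> is at most a multiple of \<open>S - x \<bullet> A x\<close>, and this keeps the Rayleigh quotient
away from its supremum.\<close>

lemma rayleigh_le_top_eigenvalue:
  fixes A :: "real mat"
  assumes A: "A \<in> carrier_mat n n" and n: "n > 0"
    and sym: "symmetric_on n (\<lambda>i j. A $$ (i, j))"
    and top: "\<And>m. eigenvalue A m \<Longrightarrow> m \<le> l"
  shows "dot n x (app n (\<lambda>i j. A $$ (i, j)) x) \<le> l * dot n x x"
proof -
  let ?M = "\<lambda>i j. A $$ (i, j)"
  let ?Q = "\<lambda>x. dot n x (app n ?M x)"
  define S where "S = (SUP x\<in>{x. dot n x x = 1}. ?Q x)"
  obtain C0 where C0: "form_bounded n ?M C0" using form_crude_bound by blast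
  have bdd: "bdd_above (?Q ` {x. dot n x x = 1})"
  proof (rule bdd_aboveI2)
    fix x assume "x \<in> {x. dot n x x = 1}"
    then have "dot n x x = 1" by (rule CollectD)
    moreover have "\<bar>?Q x\<bar> \<le> C0 * dot n x x" using C0 unfolding form_bounded_def by (rule spec)
    ultimately have "\<bar>?Q x\<bar> \<le> C0" by (simp only: mult_1_right)
    then show "?Q x \<le> C0" by (rule abs_le_D1)
  qed
  have ne: "{x. dot n x x = 1} \<noteq> {}"
  proof -
    have "dot n (\<lambda>i. if i = 0 then 1 else 0) (\<lambda>i. if i = 0 then 1 else 0) = 1"
    proof -
      have "dot n (\<lambda>i. if i = 0 then 1 else 0) (\<lambda>i. if i = 0 then 1 else 0) = (\<Sum>i<n. if i
          = 0 then 1 else (0::real))"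
        unfolding dot_def by (intro sum.cong) auto
      then show ?thesis using n by simp
    qed
    then show ?thesis by blast
  qed
  have QS: "?Q x \<le> S * dot n x x" for x
  proof (cases "dot n x x = 0")
    case True
    then have "x i = 0" if "i < n" for i
      using that by (simp add: dot_self sum_nonneg_eq_0_iff)
    then have "?Q x = 0" by (simp add: dot_def)
    then show ?thesis using True by simp
  next
    case False
    define c where "c = 1 / sqrt (dot n x x)"
    have pos: "dot n x x > 0" using False dot_nonneg[of n x] by linarith
    then have c: "c\<^sup>2 * dot n x x = 1" by (simp add: c_def power_divide)
    then have "dot n (\<lambda>i. c * x i) (\<lambda>i. c * x i) = 1"
        by (simp add: dot_linear power2_eq_square mult.assoc)
    then have "?Q (\<lambda>i. c * x i) \<le> S" unfolding S_def by (intro cSUP_upper[OF _ bdd]) simp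
    then have "c\<^sup>2 * ?Q x \<le> S" by (simp add: dot_linear app_linear power2_eq_square mult.assoc)
    then have "dot n x x * (c\<^sup>2 * ?Q x) \<le> dot n x x * S" using pos by (intro mult_left_mono) auto
    moreover have "dot n x x * (c\<^sup>2 * ?Q x) = ?Q x" using c by (simp add: mult_ac)
    ultimately show ?thesis by (simp add: mult.commute)
  qed
  have "eigenvalue A S"
    \<comment> \<open>\<open>N\<close> below is \<open>S I - A\<close>, the negative of the characteristic matrix, and \<open>B\<close> is the inverse of the latter.\<close>
  proof (rule ccontr)
    assume "\<not> eigenvalue A S"
    then have "det (char_matrix A S) \<noteq> 0" using eigenvalue_det[OF A] by simp
    moreover have CA: "char_matrix A S \<in> carrier_mat n n" using A by simp
    ultimately obtain B where B: "B \<in> carrier_mat n n" "B * char_matrix A S = 1\<^sub>m n"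
      using det_non_zero_imp_unit[OF CA] unfolding Units_def ring_mat_def by auto
    let ?N = "\<lambda>i j. (if i = j then S else 0) - A $$ (i, j)"
    have appN: "app n ?N x i = S * x i - app n ?M x i" if "i < n" for x i
    proof -
      have "(\<Sum>j<n. (if i = j then S else 0) * x j) = (\<Sum>j<n. if j = i then S * x j else 0)"
        by (intro sum.cong) auto
      then show ?thesis using that unfolding app_def by (simp add: left_diff_distrib sum_subtractf)
    qed
    have QN: "dot n x (app n ?N x) = S * dot n x x - ?Q x" for x
    proof -
      have "dot n x (app n ?N x) = dot n x (\<lambda>i. S * x i - app n ?M x i)"
        unfolding dot_def by (intro sum.cong) (simp_all add: appN)
      then show ?thesis by (simp add: dot_linear)
    qed
    have symN: "symmetric_on n ?N" using sym by (auto simp: symmetric_on_def)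
    have psd: "0 \<le> dot n x (app n ?N x)" for x unfolding QN using QS[of x] by simp
    obtain C1 where C1: "C1 > 0" "form_bounded n ?N C1" using form_crude_bound by blast
    have N1: "dot n (app n ?N x) (app n ?N x) \<le> C1 * dot n x (app n ?N x)" for x
      using C1 by (intro psd_app_norm_bound[OF symN psd]) (auto simp: form_bounded_def intro:
          abs_le_D1)
    obtain C2 where C2: "C2 > 0" "\<And>x. dot n (app n (\<lambda>i j. B $$ (i, j)) x) (app n (\<lambda>i j. B $$ (i,
        j)) x) \<le> C2 * dot n x x"
      using app_crude_bound by blast
    have inv: "dot n x x \<le> C2 * dot n (app n ?N x) (app n ?N x)" for x
    proof -
      let ?v = "vec n x"
      have 1: "vec_index (char_matrix A S *\<^sub>v ?v) i = - app n ?N x i" if "i < n" for i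
      proof -
        have "vec_index (char_matrix A S *\<^sub>v ?v) i = (\<Sum>j<n. char_matrix A S $$ (i, j) * x j)"
          using CA that by (simp add: scalar_prod_def atLeast0LessThan)
        also have "\<dots> = (\<Sum>j<n. - (?N i j * x j))"
          using A that by (intro sum.cong refl) (simp add: char_matrix_def algebra_simps)
        finally show ?thesis by (simp only: sum_negf app_def)
      qed
      have "?v = (B * char_matrix A S) *\<^sub>v ?v" unfolding B(2) by simp
      also have "\<dots> = B *\<^sub>v (char_matrix A S *\<^sub>v ?v)" using B CA by (intro assoc_mult_mat_vec) auto
      finally have v: "?v = B *\<^sub>v (char_matrix A S *\<^sub>v ?v)" .
      have "x i = - app n (\<lambda>i j. B $$ (i, j)) (app n ?N x) i" if "i < n" for i
      proof -
        have "x i = vec_index (B *\<^sub>v (char_matrix A S *\<^sub>v ?v)) i"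
          using that arg_cong[OF v, of "\<lambda>w. vec_index w i"] by simp
        also have "\<dots> = (\<Sum>j<n. B $$ (i, j) * vec_index (char_matrix A S *\<^sub>v ?v) j)"
          using B that CA by (simp add: scalar_prod_def atLeast0LessThan)
        also have "\<dots> = (\<Sum>j<n. B $$ (i, j) * - app n ?N x j)"
          by (intro sum.cong refl) (simp only: 1 lessThan_iff)
        also have "\<dots> = - app n (\<lambda>i j. B $$ (i, j)) (app n ?N x) i"
          by (simp add: app_def[of n "\<lambda>i j. B $$ (i, j)"] sum_negf)
        finally show ?thesis .
      qed
      then have "dot n x x = dot n (app n (\<lambda>i j. B $$ (i, j)) (app n ?N x)) (app n (\<lambda>i j. B $$
          (i, j)) (app n ?N x))"
        unfolding dot_def by (intro sum.cong) simp_all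
      then show ?thesis using C2 by simp
    qed
    have "?Q x \<le> S - 1 / (C1 * C2)" if "dot n x x = 1" for x
    proof -
      have "1 \<le> C2 * dot n (app n ?N x) (app n ?N x)" using inv[of x] that by simp
      also have "\<dots> \<le> C2 * (C1 * (S - ?Q x))" using N1[of x] C2(1) that
          by (intro mult_left_mono) (simp_all add: QN)
      finally have "1 / (C1 * C2) \<le> S - ?Q x" using C1 C2 by (simp add: divide_le_eq mult_ac)
      then show ?thesis by simp
    qed
    then have "S \<le> S - 1 / (C1 * C2)" unfolding S_def[symmetric]
      by (subst (1) S_def, intro cSUP_least[OF ne]) simp
    moreover have "1 / (C1 * C2) > 0" using C1 C2 by simp
    ultimately show False by linarith
  qed
  then have "S \<le> l" by (rule top)
  then show ?thesis using QS[of x] dot_nonneg[of n x] by (meson mult_right_mono order.trans)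
qed

text \<open>Integer points with squared norm at most \<open>33 n\<close>. Divided by \<open>4 * sqrt n\<close> they are a net of the
unit ball of mesh \<open>1 / 8\<close>, and there are only exponentially many of them (lemma \<open>card_grid_le\<close>).\<close>

definition grid :: "nat \<Rightarrow> (nat \<Rightarrow> int) set" where
  "grid n = {z \<in> {..<n} \<rightarrow>\<^sub>E {- int (33 * n)..int (33 * n)}. (\<Sum>i<n. (real_of_int (z i))\<^sup>2)
      \<le> 33 * real n}"

definition grid_point :: "nat \<Rightarrow> (nat \<Rightarrow> int) \<Rightarrow> nat \<Rightarrow> real" where
  "grid_point n z i = real_of_int (z i) / (4 * sqrt (real n))"

lemma grid_point_norm:
  assumes "n > 0" "z \<in> grid n"
  shows "dot n (grid_point n z) (grid_point n z) \<le> 33 / 16"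
proof -
  have "dot n (grid_point n z) (grid_point n z) = (\<Sum>i<n. (real_of_int (z i))\<^sup>2) / (16 * real n)"
    using assms(1) by (simp add: dot_self grid_point_def power_divide power_mult_distrib
        sum_divide_distrib)
  also have "\<dots> \<le> 33 * real n / (16 * real n)"
    using assms by (intro divide_right_mono) (simp_all add: grid_def)
  finally show ?thesis using assms(1) by simp
qed

lemma grid_approximation:
  assumes n: "n > 0" and x: "dot n x x \<le> 1"
  obtains z where "z \<in> grid n"
    "dot n (\<lambda>i. x i - grid_point n z i) (\<lambda>i. x i - grid_point n z i) \<le> 1 / 64"
proof -
  let ?q = "4 * sqrt (real n)"
  define z where "z = (\<lambda>i\<in>{..<n}. round (?q * x i))"
  have q: "?q > 0" "?q\<^sup>2 = 16 * real n" using n by (simp_all add: power_mult_distrib)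
  have d: "(x i - grid_point n z i)\<^sup>2 \<le> 1 / (64 * real n)" if "i < n" for i
  proof -
    have "\<bar>real_of_int (z i) - ?q * x i\<bar> \<le> 1 / 2"
      using that of_int_round_abs_le[of "?q * x i"] by (simp add: z_def)
    then have "\<bar>real_of_int (z i) - ?q * x i\<bar>\<^sup>2 \<le> (1 / 2)\<^sup>2" by (intro power_mono) auto
    then have "(?q * x i - real_of_int (z i))\<^sup>2 \<le> 1 / 4" by (simp add: power2_commute power_divide)
    moreover have "?q * x i - real_of_int (z i) = ?q * (x i - grid_point n z i)"
      using q(1) by (simp add: grid_point_def right_diff_distrib)
    ultimately have "16 * real n * (x i - grid_point n z i)\<^sup>2 \<le> 1 / 4"
      by (simp only: power_mult_distrib[of ?q] q(2))
    then show ?thesis using n by (simp add: field_simps)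
  qed
  have D: "dot n (\<lambda>i. x i - grid_point n z i) (\<lambda>i. x i - grid_point n z i) \<le> 1 / 64"
  proof -
    have "dot n (\<lambda>i. x i - grid_point n z i) (\<lambda>i. x i - grid_point n z i)
        \<le> (\<Sum>i<n. 1 / (64 * real n))"
      unfolding dot_self by (intro sum_mono d) simp
    then show ?thesis using n by simp
  qed
  have Z: "(\<Sum>i<n. (real_of_int (z i))\<^sup>2) \<le> 33 * real n"
  proof -
    have g: "dot n (grid_point n z) (grid_point n z)
        = (\<Sum>i<n. (real_of_int (z i))\<^sup>2) / (16 * real n)"
      using n by (simp add: dot_self grid_point_def power_divide power_mult_distrib
          sum_divide_distrib)
    have "dot n (grid_point n z) (grid_point n z) \<le> 2 * dot n x x
        + 2 * dot n (\<lambda>i. x i - grid_point n z i) (\<lambda>i. x i - grid_point n z i)"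
    proof -
      have "0 \<le> dot n (\<lambda>i. 2 * x i - grid_point n z i) (\<lambda>i. 2 * x i - grid_point n z i)"
          by (rule dot_nonneg)
      then show ?thesis by (simp add: dot_linear dot_commute[of n "grid_point n z" x])
    qed
    also have "\<dots> \<le> 33 / 16" using D x by linarith
    finally show ?thesis unfolding g using n by (simp add: divide_le_eq)
  qed
  have "z i \<in> {- int (33 * n)..int (33 * n)}" if "i < n" for i
  proof -
    have "(real_of_int (z i))\<^sup>2 \<le> (\<Sum>i<n. (real_of_int (z i))\<^sup>2)"
      using that by (intro member_le_sum) auto
    then have "real_of_int ((z i)\<^sup>2) \<le> real_of_int (33 * int n)" using Z by simp
    then have "(z i)\<^sup>2 \<le> 33 * int n" by (simp only: of_int_le_iff)
    moreover have "\<bar>z i\<bar> \<le> (z i)\<^sup>2"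
    proof (cases "z i = 0")
      case False
      then have "1 \<le> \<bar>z i\<bar>" by linarith
      from mult_left_mono[OF this, of "\<bar>z i\<bar>"] show ?thesis by (simp add: power2_eq_square)
    qed simp
    ultimately have "\<bar>z i\<bar> \<le> 33 * int n" by linarith
    then show ?thesis by (simp add: abs_le_iff)
  qed
  then have "z \<in> {..<n} \<rightarrow>\<^sub>E {- int (33 * n)..int (33 * n)}"
    by (intro PiE_I) (simp_all add: z_def)
  then have "z \<in> grid n" using Z unfolding grid_def by (intro CollectI conjI)
  then show ?thesis using D by (rule that)
qed

text \<open>Let \<open>S\<close> be the supremum of the form on the unit ball. Moving from a point to its nearest
grid point changes the form by at most \<open>S / 2\<close>, hence \<open>S \<le> D + S / 2\<close>.\<close>

lemma form_bounded_if_grid: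
  assumes n: "n > 0" and sym: "symmetric_on n M"
    and D: "\<And>z. z \<in> grid n \<Longrightarrow> \<bar>dot n (grid_point n z) (app n M (grid_point n z))\<bar> \<le> D"
  shows "form_bounded n M (2 * D)"
proof -
  let ?Q = "\<lambda>x. dot n x (app n M x)"
  let ?U = "{x. dot n x x \<le> 1}"
  define S where "S = (SUP x\<in>?U. \<bar>?Q x\<bar>)"
  obtain C0 where C0: "C0 > 0" "form_bounded n M C0" using form_crude_bound by blast
  have bdd: "bdd_above ((\<lambda>x. \<bar>?Q x\<bar>) ` ?U)"
  proof (rule bdd_aboveI2)
    fix x assume "x \<in> ?U"
    then have "C0 * dot n x x \<le> C0 * 1" using C0 by (intro mult_left_mono) auto
    moreover have "\<bar>?Q x\<bar> \<le> C0 * dot n x x" using C0(2) unfolding form_bounded_def by (rule spec)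
    ultimately show "\<bar>?Q x\<bar> \<le> C0" by linarith
  qed
  have ne: "?U \<noteq> {}"
  proof -
    have "dot n (\<lambda>_. 0) (\<lambda>_. 0) \<le> 1" by (simp add: dot_def)
    then show ?thesis by blast
  qed
  have US: "\<bar>?Q x\<bar> \<le> S" if "dot n x x \<le> 1" for x
    unfolding S_def using that by (intro cSUP_upper[OF _ bdd]) simp
  have FS: "form_bounded n M S"
    unfolding form_bounded_def
  proof
    fix x
    show "\<bar>?Q x\<bar> \<le> S * dot n x x"
    proof (cases "dot n x x = 0")
      case True
      then have "x i = 0" if "i < n" for i
        using that by (simp add: dot_self sum_nonneg_eq_0_iff)
      then have "?Q x = 0" by (simp add: dot_def)
      then show ?thesis using True by simp
    next
      case False
      define c where "c = 1 / sqrt (dot n x x)"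
      have pos: "dot n x x > 0" using False dot_nonneg[of n x] by linarith
      then have c: "c\<^sup>2 * dot n x x = 1" by (simp add: c_def power_divide)
      then have "dot n (\<lambda>i. c * x i) (\<lambda>i. c * x i) \<le> 1"
          by (simp add: dot_linear power2_eq_square mult.assoc)
      then have "\<bar>?Q (\<lambda>i. c * x i)\<bar> \<le> S" by (rule US)
      moreover have "?Q (\<lambda>i. c * x i) = c\<^sup>2 * ?Q x"
          by (simp add: dot_linear app_linear power2_eq_square mult.assoc)
      ultimately have "c\<^sup>2 * \<bar>?Q x\<bar> \<le> S" by (simp add: abs_mult)
      then have "dot n x x * (c\<^sup>2 * \<bar>?Q x\<bar>) \<le> dot n x x * S" using pos
          by (intro mult_left_mono) auto
      moreover have "dot n x x * (c\<^sup>2 * \<bar>?Q x\<bar>) = \<bar>?Q x\<bar>" using c by (simp add: mult_ac)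
      ultimately show ?thesis by (simp add: mult.commute)
    qed
  qed
  have S0: "S \<ge> 0" using US[of "\<lambda>_. 0"] by (simp add: dot_def)
  have "\<bar>?Q x\<bar> \<le> D + S / 2" if x: "dot n x x \<le> 1" for x
  proof -
    obtain z where z: "z \<in> grid n"
      and d: "dot n (\<lambda>i. x i - grid_point n z i) (\<lambda>i. x i - grid_point n z i) \<le> 1 / 64"
      using grid_approximation[OF n x] by blast
    let ?y = "grid_point n z"
    let ?d = "\<lambda>i. x i - ?y i" and ?p = "\<lambda>i. x i + ?y i"
    have "?Q x - ?Q ?y = dot n ?p (app n M ?d)"
      using dot_app_symmetric[OF sym, of x ?y] by (simp add: dot_linear app_linear)
    \<comment> \<open>The difference is short and the sum is not: the factor \<open>20\<close> balances the two squared norms.\<close>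
    moreover have "\<bar>20 * dot n ?p (app n M ?d)\<bar> \<le> S / 2 * (400 * dot n ?d ?d + dot n ?p ?p)"
      using bilinear_bound[OF sym FS, of ?p "\<lambda>i. 20 * ?d i"]
          by (simp only: dot_linear app_linear mult.assoc[symmetric]) simp
    moreover have "dot n ?p ?p \<le> 8 + 1 / 32 + 1 / 2"
    proof -
      have "dot n ?p ?p = 2 * (dot n x x + dot n ?y ?y) - dot n ?d ?d"
        using parallelogram[of n x ?y] by linarith
      also have "\<dots> \<le> 2 * (1 + 33 / 16)"
      proof -
        have le: "2 * (a + b) - c \<le> 2 * (1 + 33 / 16)" if "a \<le> 1" "b \<le> 33 / 16" "0 \<le> c"
            for a b c :: real
          using that by simp
        show ?thesis by (rule le[OF x grid_point_norm[OF n z] dot_nonneg])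
      qed
      finally show ?thesis by simp
    qed
    then have "S / 2 * (400 * dot n ?d ?d + dot n ?p ?p)
        \<le> S / 2 * (400 / 64 + (8 + 1 / 32 + 1 / 2))"
      using d S0 by (intro mult_left_mono add_mono) auto
    moreover have "S / 2 * (400 / 64 + (8 + 1 / 32 + 1 / 2)) \<le> 20 * (S / 2)"
      using S0 by simp
    ultimately have "\<bar>?Q x - ?Q ?y\<bar> \<le> S / 2" by linarith
    then show ?thesis using D[OF z] by linarith
  qed
  then have "S \<le> D + S / 2" unfolding S_def[symmetric]
      by (subst (1) S_def, intro cSUP_least[OF ne]) simp
  then have "S \<le> 2 * D" by simp
  then show ?thesis
    using FS unfolding form_bounded_def by (meson dot_nonneg mult_right_mono order.trans)
qed



section \<open>Spectral initialization and sign iteration\<close>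

text \<open>The noise part of a hollow matrix \<open>H\<close> with signal \<open>\<kappa> (e e\<^sup>T - I)\<close>.\<close>

definition centred :: "nat \<Rightarrow> (nat \<Rightarrow> nat \<Rightarrow> real) \<Rightarrow> real \<Rightarrow> (nat \<Rightarrow> real) \<Rightarrow> nat \<Rightarrow> nat \<Rightarrow> real" where
  "centred n H \<kappa> e = (\<lambda>i j. H i j - (if i = j then 0 else \<kappa> * e i * e j))"

lemma app_signal:
  assumes e: "\<And>i. i < n \<Longrightarrow> (e i)\<^sup>2 = 1" and i: "i < n"
  shows "app n H x i = \<kappa> * dot n e x * e i - \<kappa> * x i + app n (centred n H \<kappa> e) x i"
proof -
  have "(\<Sum>j<n. (if i = j then 0 else \<kappa> * e i * e j) * x j)
      = (\<Sum>j<n. \<kappa> * e i * (e j * x j) - (if j = i then \<kappa> * x i else 0))"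
    using e[OF i] by (intro sum.cong refl) (simp add: power2_eq_square)
  also have "\<dots> = \<kappa> * e i * dot n e x - \<kappa> * x i"
    using i by (simp add: sum_subtractf sum_distrib_left[symmetric] dot_def)
  finally show ?thesis
    unfolding app_def centred_def by (simp add: left_diff_distrib sum_subtractf)
qed

text \<open>The eigenvalue equation reads \<open>Z v = (l + \<kappa>) v - a e\<close> with \<open>a = \<kappa> * (e \<bullet> v)\<close>. As \<open>l\<close> is at least
the Rayleigh quotient of \<open>e\<close>, the vector \<open>v\<close> is close to a multiple of \<open>e\<close>, and every coordinate where
the signs disagree costs \<open>a\<^sup>2\<close> in \<open>\<parallel>Z v\<parallel>\<^sup>2\<close>.\<close>

lemma spectral_sign_errors:
  assumes n: "n > 0" and e: "\<And>i. i < n \<Longrightarrow> (e i)\<^sup>2 = 1" and kappa: "\<kappa> > 0"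
    and sym: "symmetric_on n H" and Z: "form_bounded n (centred n H \<kappa> e) B"
    and B: "0 \<le> B" "B \<le> \<tau> * (n * \<kappa>)" and tau: "\<tau> \<le> 1/4"
    and ev: "\<And>i. i < n \<Longrightarrow> app n H v i = l * v i" and v: "dot n v v > 0"
    and top: "\<And>x. dot n x (app n H x) \<le> l * dot n x x"
  shows "\<exists>\<nu>\<in>{-1, 1::real}. real (card {i. i < n \<and> \<nu> * e i * v i \<le> 0}) \<le> 5 * \<tau>\<^sup>2 * n"
proof -
  let ?Z = "centred n H \<kappa> e"
  define a where "a = \<kappa> * dot n e v"
  define L where "L = l + \<kappa>"
  have nk: "real n * \<kappa> > 0" using n kappa by simp
  have tau0: "\<tau> \<ge> 0"
  proof -
    have "0 \<le> \<tau> * (n * \<kappa>)" using B by linarith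
    then show ?thesis using nk by (simp add: zero_le_mult_iff)
  qed
  have symZ: "symmetric_on n ?Z"
    using sym unfolding symmetric_on_def centred_def by (simp add: mult_ac eq_commute)
  have ee: "dot n e e = n" using e by (simp add: dot_self)
  have L: "L \<ge> 3/4 * (n * \<kappa>)"
  proof -
    have "dot n e (app n H e) = dot n e (\<lambda>i. (\<kappa> * real n - \<kappa>) * e i + app n ?Z e i)"
      unfolding dot_def[of n e "app n H e"] dot_def[of n e "\<lambda>i. (\<kappa> * real n - \<kappa>) * e i
          + app n ?Z e i"]
    proof (intro sum.cong refl)
      fix i assume "i \<in> {..<n}"
      then have i: "i < n" by simp
      show "e i * app n H e i = e i * ((\<kappa> * real n - \<kappa>) * e i + app n ?Z e i)"
      proof -
        have "app n H e i = \<kappa> * dot n e e * e i - \<kappa> * e i + app n ?Z e i"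
            by (rule app_signal[OF e i])
        then show ?thesis by (simp only: ee left_diff_distrib)
      qed
    qed
    also have "\<dots> = (\<kappa> * real n - \<kappa>) * n + dot n e (app n ?Z e)"
      by (simp add: dot_linear ee)
    also have "\<dots> \<ge> (\<kappa> * real n - \<kappa>) * n - B * n"
    proof -
      have "\<bar>dot n e (app n ?Z e)\<bar> \<le> B * dot n e e" using Z unfolding form_bounded_def
          by (rule spec)
      then show ?thesis unfolding ee by linarith
    qed
    finally have "(\<kappa> * real n - \<kappa>) * n - B * n \<le> l * n" using top[of e] unfolding ee by linarith
    then have "(\<kappa> * real n - \<kappa> - B) * n \<le> l * n" by (simp add: left_diff_distrib)
    then have "\<kappa> * real n - \<kappa> - B \<le> l" using n by simp
    moreover have "B \<le> 1/4 * (n * \<kappa>)"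
      using B(2) tau nk mult_right_mono[OF tau, of "n * \<kappa>"] by linarith
    ultimately show ?thesis unfolding L_def by (simp add: mult.commute)
  qed
  have Zv: "app n ?Z v i = L * v i - a * e i" if "i < n" for i
  proof -
    have "app n H v i = \<kappa> * dot n e v * e i - \<kappa> * v i + app n ?Z v i"
        by (rule app_signal[OF e that])
    then show ?thesis using ev[OF that] by (simp add: a_def L_def algebra_simps)
  qed
  let ?w = "\<lambda>i. L * v i - a * e i"
  have W: "dot n ?w ?w \<le> B\<^sup>2 * dot n v v"
  proof -
    have "dot n ?w ?w = dot n (app n ?Z v) (app n ?Z v)"
      unfolding dot_def by (intro sum.cong refl) (simp add: Zv)
    also have "\<dots> \<le> B\<^sup>2 * dot n v v" by (rule app_norm_bound[OF symZ Z B(1)])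
    finally show ?thesis .
  qed
  have B2: "B\<^sup>2 \<le> \<tau>\<^sup>2 * (n * \<kappa>)\<^sup>2"
    using B power_mono[of B "\<tau> * (n * \<kappa>)" 2] by (simp add: power_mult_distrib)
  have a2: "7/32 * (n * \<kappa>)\<^sup>2 * dot n v v \<le> a\<^sup>2 * n"
  proof -
    have expand: "dot n (\<lambda>i. L * v i - c * e i) (\<lambda>i. L * v i - c * e i)
        = L\<^sup>2 * dot n v v - 2 * (L * c * dot n v e) + c\<^sup>2 * n" for c
      by (simp add: dot_linear dot_commute[of n e v] ee power2_eq_square algebra_simps)
    have "0 \<le> L\<^sup>2 * dot n v v - 2 * (L * (2 * a) * dot n v e) + (2 * a)\<^sup>2 * n"
      unfolding expand[symmetric] by (rule dot_nonneg)
    then have "L\<^sup>2 * dot n v v \<le> 2 * dot n ?w ?w + 2 * (a\<^sup>2 * n)"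
      unfolding expand by (simp add: power_mult_distrib algebra_simps)
    also have "\<dots> \<le> 2 * (B\<^sup>2 * dot n v v) + 2 * (a\<^sup>2 * n)" using W by simp
    finally have 1: "L\<^sup>2 * dot n v v \<le> 2 * (B\<^sup>2 * dot n v v) + 2 * (a\<^sup>2 * n)" .
    have "(3/4 * (n * \<kappa>))\<^sup>2 \<le> L\<^sup>2" using L nk by (intro power_mono) auto
    then have "9/16 * (n * \<kappa>)\<^sup>2 * dot n v v \<le> L\<^sup>2 * dot n v v"
      using v by (intro mult_right_mono) (auto simp: power_mult_distrib power_divide)
    moreover have "B\<^sup>2 * dot n v v \<le> 1/16 * (n * \<kappa>)\<^sup>2 * dot n v v"
    proof (intro mult_right_mono)
      have "\<tau>\<^sup>2 \<le> (1/4)\<^sup>2" using tau tau0 by (intro power_mono) auto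
      then have "\<tau>\<^sup>2 * (n * \<kappa>)\<^sup>2 \<le> 1/16 * (n * \<kappa>)\<^sup>2"
          by (intro mult_right_mono) (auto simp: power_divide)
      then show "B\<^sup>2 \<le> 1/16 * (n * \<kappa>)\<^sup>2" using B2 by linarith
    qed (use v in simp)
    ultimately show ?thesis using 1 by linarith
  qed
  have apos: "a\<^sup>2 > 0"
  proof -
    have "0 < 7/32 * (n * \<kappa>)\<^sup>2 * dot n v v"
      by (intro mult_pos_pos v zero_less_power nk) simp
    then have "0 < a\<^sup>2 * n" using a2 by linarith
    then show ?thesis by (simp add: zero_less_mult_iff)
  qed
  let ?E = "{i. i < n \<and> sgn a * e i * v i \<le> 0}"
  have "real (card ?E) * a\<^sup>2 = (\<Sum>i\<in>?E. a\<^sup>2)" by simp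
  also have "\<dots> \<le> (\<Sum>i\<in>?E. (?w i)\<^sup>2)"
  proof (intro sum_mono)
    fix i assume i: "i \<in> ?E"
    have "a = \<bar>a\<bar> * sgn a" by (simp add: sgn_if)
    then have "a * (e i * v i) = (\<bar>a\<bar> * sgn a) * (e i * v i)"
      by (rule arg_cong[where f = "\<lambda>z. z * (e i * v i)"])
    also have "\<dots> = \<bar>a\<bar> * (sgn a * e i * v i)" by (simp only: mult.assoc)
    also have "\<dots> \<le> 0" by (rule mult_nonneg_nonpos) (use i in auto)
    finally have "L * (a * (e i * v i)) \<le> 0"
        by (rule mult_nonneg_nonpos[rotated]) (use L nk in linarith)
    moreover have "(?w i)\<^sup>2 = L\<^sup>2 * (v i)\<^sup>2 - 2 * (L * (a * (e i * v i))) + a\<^sup>2 * (e i)\<^sup>2"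
      by (simp add: power2_eq_square algebra_simps)
    moreover have "(e i)\<^sup>2 = 1" using e i by simp
    moreover have "0 \<le> L\<^sup>2 * (v i)\<^sup>2" by simp
    ultimately show "a\<^sup>2 \<le> (?w i)\<^sup>2" by (simp only:)
  qed
  also have "\<dots> \<le> (\<Sum>i<n. (?w i)\<^sup>2)" by (intro sum_mono2) auto
  also have "\<dots> \<le> B\<^sup>2 * dot n v v" using W by (simp only: dot_self)
  also have "\<dots> \<le> \<tau>\<^sup>2 * (n * \<kappa>)\<^sup>2 * dot n v v" using B2 v by (intro mult_right_mono) auto
  also have "\<dots> = 32/7 * \<tau>\<^sup>2 * (7/32 * (n * \<kappa>)\<^sup>2 * dot n v v)" by simp
  also have "\<dots> \<le> 32/7 * \<tau>\<^sup>2 * (a\<^sup>2 * n)" using a2 by (intro mult_left_mono) auto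
  finally have "real (card ?E) * a\<^sup>2 \<le> (32/7 * \<tau>\<^sup>2 * n) * a\<^sup>2" by (simp add: mult_ac)
  then have "real (card ?E) \<le> 32/7 * \<tau>\<^sup>2 * n" using apos by (rule mult_right_le_imp_le)
  also have "\<dots> \<le> 5 * \<tau>\<^sup>2 * n" by (intro mult_right_mono) auto
  finally have "real (card ?E) \<le> 5 * \<tau>\<^sup>2 * n" .
  moreover have "sgn a \<in> {-1, 1}" using apos by (auto simp: sgn_if)
  ultimately show ?thesis by blast
qed

text \<open>Write \<open>x = e - 2 d\<close>, with \<open>d\<close> supported on the errors. If label \<open>i\<close> has a large margin and is
nevertheless wrong after the step, then \<open>(H d)\<^sub>i\<close> is of the order of the margin. The signal part
of \<open>H d\<close> is too small for this, hence \<open>(Z d)\<^sub>i\<close> is large, and since \<open>\<parallel>Z d\<parallel>\<^sup>2 \<le> B\<^sup>2 h\<close> for \<open>h\<close> errors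
this happens for at most \<open>h / 9\<close> labels.\<close>

lemma sign_power_iteration_step:
  assumes e: "\<And>i. i < n \<Longrightarrow> (e i)\<^sup>2 = 1" and kappa: "\<kappa> > 0" and n: "n > 0"
    and sym: "symmetric_on n H" and Z: "form_bounded n (centred n H \<kappa> e) B" and B: "0 \<le> B" "B
        \<le> t / 12 * (n * \<kappa>)"
    and t: "t > 0"
    and x: "\<And>i. i < n \<Longrightarrow> x i \<in> {-1, 1}"
    and few: "real (card {i. i < n \<and> x i \<noteq> e i}) \<le> t / 4 * n"
  shows "real (card {i. i < n \<and> e i * app n H x i \<le> 0})
    \<le> real (card {i. i < n \<and> e i * app n H e i
        \<le> t * (n * \<kappa>)}) + 1 / 9 * real (card {i. i < n \<and> x i \<noteq> e i})"
proof -
  let ?Z = "centred n H \<kappa> e"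
  let ?E = "{i. i < n \<and> x i \<noteq> e i}"
  let ?N = "{i. i < n \<and> e i * app n H e i \<le> t * (n * \<kappa>)}"
  let ?F = "{i. i < n \<and> e i * app n H x i \<le> 0} - ?N"
  let ?T = "t * (n * \<kappa>)"
  define d where "d i = (if x i \<noteq> e i then e i else 0)" for i
  have T: "?T > 0" using t n kappa by simp
  have e1: "e i \<in> {-1, 1}" if "i < n" for i
    using e[OF that] by (simp add: power2_eq_1_iff) blast
  have xd: "x i = e i - 2 * d i" if "i < n" for i
    using x[OF that] e1[OF that] unfolding d_def by (elim insertE emptyE) simp_all
  have cE: "(\<Sum>i<n. if x i \<noteq> e i then 1 else (0::real)) = real (card ?E)"
  proof -
    have "(\<Sum>i<n. if x i \<noteq> e i then 1 else (0::real)) = (\<Sum>i\<in>?E. 1)"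
      by (intro sum.mono_neutral_cong_right) auto
    then show ?thesis by simp
  qed
  have ed: "dot n e d = real (card ?E)"
    unfolding cE[symmetric] dot_def
    by (intro sum.cong refl) (use e in \<open>simp add: d_def power2_eq_square\<close>)
  have dd: "dot n d d = real (card ?E)"
    unfolding cE[symmetric] dot_def
    by (intro sum.cong refl) (use e in \<open>simp add: d_def power2_eq_square\<close>)
  have symZ: "symmetric_on n ?Z"
    using sym unfolding symmetric_on_def centred_def by (simp add: mult_ac eq_commute)
  have big: "(?T / 4)\<^sup>2 \<le> (app n ?Z d i)\<^sup>2" if i: "i \<in> ?F" for i
  proof -
    have i': "i < n" "e i * app n H x i \<le> 0" "?T < e i * app n H e i" using i by auto
    have "app n H x i = app n H (\<lambda>i. e i - 2 * d i) i"
      unfolding app_def by (intro sum.cong refl) (simp add: xd)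
    then have "app n H x i = app n H e i - 2 * app n H d i" by (simp only: app_linear)
    then have "e i * app n H x i = e i * app n H e i - 2 * (e i * app n H d i)"
      by (simp only: right_diff_distrib mult.left_commute)
    then have 1: "?T < 2 * (e i * app n H d i)" using i' by linarith
    have hd: "app n H d i = \<kappa> * real (card ?E) * e i - \<kappa> * d i + app n ?Z d i"
      unfolding ed[symmetric] by (rule app_signal[OF e i'(1)])
    have "e i * app n H d i = \<kappa> * real (card ?E) * (e i)\<^sup>2 - \<kappa> * (e i * d i) + e i * app n ?Z d i"
      unfolding hd by (simp add: algebra_simps power2_eq_square)
    also have "\<dots> \<le> \<kappa> * real (card ?E) + e i * app n ?Z d i"
      using e[OF i'(1)] kappa by (simp add: d_def power2_eq_square)
    also have "\<dots> \<le> ?T / 4 + e i * app n ?Z d i"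
      using mult_left_mono[OF few, of \<kappa>] kappa by (simp add: mult_ac)
    finally have "?T / 4 < e i * app n ?Z d i" using 1 by linarith
    then have "(?T / 4)\<^sup>2 \<le> (e i * app n ?Z d i)\<^sup>2" using T by (intro power_mono) auto
    then show ?thesis using e[OF i'(1)] by (simp add: power_mult_distrib)
  qed
  have "real (card ?F) * (?T / 4)\<^sup>2 = (\<Sum>i\<in>?F. (?T / 4)\<^sup>2)" by simp
  also have "\<dots> \<le> (\<Sum>i\<in>?F. (app n ?Z d i)\<^sup>2)" by (intro sum_mono big)
  also have "\<dots> \<le> (\<Sum>i<n. (app n ?Z d i)\<^sup>2)" by (intro sum_mono2) auto
  also have "\<dots> \<le> B\<^sup>2 * dot n d d" using app_norm_bound[OF symZ Z B(1), of d]
      by (simp only: dot_self)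
  also have "\<dots> \<le> (t / 12 * (n * \<kappa>))\<^sup>2 * real (card ?E)"
    unfolding dd using B by (intro mult_right_mono power_mono) auto
  also have "\<dots> = (1 / 9 * real (card ?E)) * (?T / 4)\<^sup>2"
      by (simp add: power_mult_distrib power_divide)
  finally have F: "real (card ?F) \<le> 1 / 9 * real (card ?E)"
    by (rule mult_right_le_imp_le[OF _ zero_less_power]) (use T in linarith)
  have "card {i. i < n \<and> e i * app n H x i \<le> 0} \<le> card (?N \<union> ?F)"
    by (intro card_mono) auto
  also have "\<dots> \<le> card ?N + card ?F" by (rule card_Un_le)
  finally show ?thesis using F by linarith
qed

lemma sign_conv_values: "s \<in> {-1, 1} \<Longrightarrow> sign_conv s x \<in> {-1, 1}"
  unfolding sign_conv_def by (simp add: sgn_if)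

lemma sign_conv_error:
  assumes "e \<in> {-1, 1}" "sign_conv s x \<noteq> e" shows "e * x \<le> 0"
  using assms unfolding sign_conv_def by (elim insertE emptyE) (auto simp: sgn_if split: if_splits)

text \<open>The second conjunct of the induction keeps the number of errors in the range where the
step applies.\<close>

lemma sign_power_iteration:
  assumes e: "\<And>i. i < n \<Longrightarrow> (e i)\<^sup>2 = 1" and kappa: "\<kappa> > 0" and n: "n > 0"
    and sym: "symmetric_on n H" and Z: "form_bounded n (centred n H \<kappa> e) B" and B: "0 \<le> B" "B
        \<le> t / 12 * (n * \<kappa>)"
    and t: "t > 0" "t \<le> 1" and s: "s \<in> {-1, 1}"
    and x: "\<And>k i. i < n \<Longrightarrow> x k i \<in> {-1, 1}"
    and step: "\<And>k i. i < n \<Longrightarrow> x (Suc k) i = sign_conv s (app n H (x k) i)"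
    and init: "real (card {i. i < n \<and> x 0 i \<noteq> e i}) \<le> 5 * (t / 12)\<^sup>2 * n"
    and N: "real (card {i. i < n \<and> e i * app n H e i \<le> t * (n * \<kappa>)}) \<le> t / 8 * n"
  shows "real (card {i. i < n \<and> x k i \<noteq> e i})
    \<le> 2 * real (card {i. i < n \<and> e i * app n H e i \<le> t * (n * \<kappa>)}) + n * (1 / 9) ^ k"
proof -
  let ?N = "real (card {i. i < n \<and> e i * app n H e i \<le> t * (n * \<kappa>)})"
  let ?h = "\<lambda>k. real (card {i. i < n \<and> x k i \<noteq> e i})"
  have "?h k \<le> 2 * ?N + n * (1 / 9) ^ k \<and> ?h k \<le> t / 4 * n"
  proof (induction k)
    case 0
    have "5 * (t / 12)\<^sup>2 = t / 4 * (5 * t / 36)" by (simp add: power2_eq_square)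
    also have "\<dots> \<le> t / 4 * 1" using t by (intro mult_left_mono) auto
    finally have "5 * (t / 12)\<^sup>2 * n \<le> t / 4 * n" by (intro mult_right_mono) auto
    moreover have "t / 4 * n \<le> 1 * real n" using t by (intro mult_right_mono) auto
    moreover have "0 \<le> 2 * ?N" by simp
    ultimately show ?case using init by (simp only: power_0 mult_1_right mult_1) linarith
  next
    case (Suc k)
    have "{i. i < n \<and> x (Suc k) i \<noteq> e i} \<subseteq> {i. i < n \<and> e i * app n H (x k) i \<le> 0}"
    proof
      fix i assume "i \<in> {i. i < n \<and> x (Suc k) i \<noteq> e i}"
      then have i: "i < n" "sign_conv s (app n H (x k) i) \<noteq> e i" using step by auto
      moreover have "e i \<in> {-1, 1}" using e[OF i(1)] by (simp add: power2_eq_1_iff) blast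
      ultimately show "i \<in> {i. i < n \<and> e i * app n H (x k) i \<le> 0}" using sign_conv_error by blast
    qed
    then have "?h (Suc k) \<le> real (card {i. i < n \<and> e i * app n H (x k) i \<le> 0})"
      by (intro of_nat_mono card_mono) auto
    also have "\<dots> \<le> ?N + 1 / 9 * ?h k"
      using Suc.IH by (intro sign_power_iteration_step[OF e kappa n sym Z B t(1) x]) auto
    finally have h: "?h (Suc k) \<le> ?N + 1 / 9 * ?h k" .
    have "1 / 9 * ?h k \<le> 1 / 9 * (2 * ?N + n * (1 / 9) ^ k)" "1 / 9 * ?h k \<le> 1 / 9 * (t / 4 * n)"
      using Suc.IH by (intro mult_left_mono; simp)+
    moreover have "0 \<le> ?N" "0 \<le> t / 4 * n" using t by simp_all
    moreover have "1 / 9 * (2 * ?N + n * (1 / 9) ^ k) = 2 / 9 * ?N + n * (1 / 9) ^ Suc k" by simp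
    ultimately have "?h (Suc k) \<le> 2 * ?N + n * (1 / 9) ^ Suc k" using h by linarith
    moreover have "?h (Suc k) \<le> t / 4 * n"
      using h N \<open>1 / 9 * ?h k \<le> 1 / 9 * (t / 4 * n)\<close> \<open>0 \<le> t / 4 * n\<close> by linarith
    ultimately show ?case by blast
  qed
  then show ?thesis by blast
qed

lemma hollow_gram_carrier:
  assumes "Y \<in> carrier_mat p n"
  shows "hollow_gram Y \<in> carrier_mat n n"
  using assms unfolding hollow_gram_def hollow_def
      by (intro minus_carrier_mat) (simp add: mat_diag_def)

lemma hollow_gram_index:
  assumes "Y \<in> carrier_mat p n" "i < n" "j < n"
  shows "hollow_gram Y $$ (i, j) = (if i = j then 0 else \<Sum>r<p. Y $$ (r, i) * Y $$ (r, j))"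
proof -
  have "dim_col Y = n" "dim_row Y = p" using assms(1) by auto
  then show ?thesis
    using assms(2,3) unfolding hollow_gram_def hollow_def
    by (simp add: mat_diag_def scalar_prod_def atLeast0LessThan)
qed

lemma symmetric_hollow_gram:
  assumes "Y \<in> carrier_mat p n"
  shows "symmetric_on n (\<lambda>i j. hollow_gram Y $$ (i, j))"
  unfolding symmetric_on_def by (simp add: hollow_gram_index[OF assms] mult.commute)

lemma hollow_gram_mult_index:
  assumes "Y \<in> carrier_mat p n" "x \<in> carrier_vec n" "i < n"
  shows "vec_index (hollow_gram Y *\<^sub>v x) i = app n (\<lambda>i j. hollow_gram Y $$ (i, j)) (vec_index x) i"
  using hollow_gram_carrier[OF assms(1)] assms(2,3)
      by (simp add: app_def scalar_prod_def atLeast0LessThan)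

lemma top_eigenvector_carrier:
  assumes "Y \<in> carrier_mat p n" "top_eigenvector (hollow_gram Y) v"
  shows "v \<in> carrier_vec n"
  using assms(2) hollow_gram_carrier[OF assms(1)]
      unfolding top_eigenvector_def eigenvector_def by auto

lemma map_sign_conv_sign_vecs:
  assumes "s \<in> {-1, 1}" "v \<in> carrier_vec n"
  shows "map_vec (sign_conv s) v \<in> sign_vecs n"
proof -
  have "vec_index (map_vec (sign_conv s) v) j \<in> {-1, 1}" if "j < n" for j
    using sign_conv_values[OF assms(1), of "vec_index v j"] that assms(2) by simp
  moreover have "map_vec (sign_conv s) v \<in> carrier_vec n" using assms(2) by simp
  ultimately show ?thesis unfolding sign_vecs_def by blast
qed

lemma sign_vecs_carrier: "v \<in> sign_vecs n \<Longrightarrow> v \<in> carrier_vec n"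
  unfolding sign_vecs_def by blast

lemma eta_iter_sign_vecs:
  assumes "Y \<in> carrier_mat p n" "s \<in> {-1, 1}" "v Y \<in> carrier_vec n"
  shows "eta_iter s v k Y \<in> sign_vecs n"
proof (cases k)
  case 0
  then show ?thesis using map_sign_conv_sign_vecs[OF assms(2,3)] by simp
next
  case (Suc k')
  have "hollow_gram Y *\<^sub>v eta_iter s v k' Y \<in> carrier_vec n"
    using hollow_gram_carrier[OF assms(1)]
        by (metis carrier_matD(1) carrier_vec_dim_vec dim_mult_mat_vec)
  from map_sign_conv_sign_vecs[OF assms(2) this] show ?thesis using Suc by simp
qed

lemma eta_iter_estimator:
  assumes v: "spectral_choice p n v" and s: "s \<in> {-1, 1}"
  shows "eta_iter s v k \<in> estimators p n"
proof -
  have vc: "v Y \<in> carrier_vec n" if "Y \<in> carrier_mat p n" for Y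
    using v that unfolding spectral_choice_def by (intro top_eigenvector_carrier[OF that]) blast
  have sc: "sign_conv s \<in> borel_measurable borel"
    unfolding sign_conv_def by measurable
  show ?thesis
  proof (rule measurable_estimator)
    show "eta_iter s v k Y \<in> sign_vecs n" if "Y \<in> carrier_mat p n" for Y
      by (rule eta_iter_sign_vecs[of Y p n s v, OF that s vc[OF that]])
    show "(\<lambda>Y. vec_index (eta_iter s v k Y) j) \<in> borel_measurable (data_space p n)" if "j < n" for j
      using that
    proof (induction k arbitrary: j)
      case 0
      have "(\<lambda>Y. vec_index (v Y) j) \<in> borel_measurable (data_space p n)"
        using v 0 unfolding spectral_choice_def by blast
      then have "(\<lambda>Y. sign_conv s (vec_index (v Y) j)) \<in> borel_measurable (data_space p n)"
        by (rule measurable_compose[OF _ sc])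
      moreover have "vec_index (eta_iter s v 0 Y) j = sign_conv s (vec_index (v Y) j)"
        if "Y \<in> space (data_space p n)" for Y
        using vc[of Y] that 0 by (simp add: space_data_space)
      ultimately show ?case by (simp cong: measurable_cong)
    next
      case (Suc k)
      let ?H = "\<lambda>Y i j. if i = j then 0 else \<Sum>r<p. Y $$ (r, i) * Y $$ (r, j) :: real"
      have "(\<lambda>Y. \<Sum>l<n. ?H Y j l
          * vec_index (eta_iter s v k Y) l) \<in> borel_measurable (data_space p n)"
      proof (intro borel_measurable_sum borel_measurable_times)
        fix l assume l: "l \<in> {..<n}"
        show "(\<lambda>Y. vec_index (eta_iter s v k Y) l) \<in> borel_measurable (data_space p n)"
          using l by (intro Suc.IH) simp
        show "(\<lambda>Y. ?H Y j l) \<in> borel_measurable (data_space p n)"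
        proof (cases "j = l")
          case False
          have "(\<lambda>Y. \<Sum>r<p. Y $$ (r, j) * Y $$ (r, l)) \<in> borel_measurable (data_space p n)"
            using l Suc.prems by (intro borel_measurable_sum borel_measurable_times
                measurable_entry) auto
          then show ?thesis using False by simp
        qed simp
      qed
      then have "(\<lambda>Y. sign_conv s (\<Sum>l<n. ?H Y j l
          * vec_index (eta_iter s v k Y) l)) \<in> borel_measurable (data_space p n)"
        by (rule measurable_compose[OF _ sc])
      moreover have "vec_index (eta_iter s v (Suc k) Y) j
          = sign_conv s (\<Sum>l<n. ?H Y j l * vec_index (eta_iter s v k Y) l)"
        if "Y \<in> space (data_space p n)" for Y
      proof -
        have Y: "Y \<in> carrier_mat p n" using that by (simp add: space_data_space)
        have c: "eta_iter s v k Y \<in> carrier_vec n"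
          by (rule sign_vecs_carrier[OF eta_iter_sign_vecs[of Y p n s v, OF Y s vc[OF Y]]])
        have "vec_index (eta_iter s v (Suc k) Y) j
            = sign_conv s (vec_index (hollow_gram Y *\<^sub>v eta_iter s v k Y) j)"
          using hollow_gram_carrier[OF Y] Suc.prems by simp
        also have "vec_index (hollow_gram Y *\<^sub>v eta_iter s v k Y) j
            = (\<Sum>l<n. ?H Y j l * vec_index (eta_iter s v k Y) l)"
          unfolding hollow_gram_mult_index[OF Y c Suc.prems] app_def
          using Suc.prems by (intro sum.cong refl) (simp add: hollow_gram_index[OF Y])
        finally show ?thesis .
      qed
      ultimately show ?case by (simp cong: measurable_cong)
    qed
  qed
qed

lemma loss_le_errors:
  assumes a: "a \<in> sign_vecs n" and b: "b \<in> sign_vecs n" and nu: "\<nu> \<in> {-1, 1}"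
  shows "loss n a b \<le> 2 * real (card {i. i < n \<and> vec_index a i \<noteq> \<nu> * vec_index b i})"
proof -
  let ?E = "{i. i < n \<and> vec_index a i \<noteq> \<nu> * vec_index b i}"
  have "(\<Sum>j<n. \<bar>vec_index a j - \<nu> * vec_index b j\<bar>) = (\<Sum>j\<in>?E. \<bar>vec_index a j - \<nu> * vec_index b j\<bar>)"
    by (intro sum.mono_neutral_right) auto
  also have "\<dots> \<le> (\<Sum>j\<in>?E. 2)"
  proof (intro sum_mono)
    fix j assume "j \<in> ?E"
    then have "vec_index a j \<in> {-1, 1}" "vec_index b j \<in> {-1, 1}"
      using a b by (auto simp: sign_vecs_def)
    moreover have "\<bar>x - w * y\<bar> \<le> 2" if "x \<in> {-1, 1}" "w \<in> {-1, 1}" "y \<in> {-1, 1}" for x w y :: real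
      using that by (elim insertE emptyE) simp_all
    ultimately show "\<bar>vec_index a j - \<nu> * vec_index b j\<bar> \<le> 2" using nu by blast
  qed
  also have "\<dots> = 2 * real (card ?E)" by simp
  finally show ?thesis using loss_le_sum[OF nu, of n a b] by linarith
qed

text \<open>If more than \<open>t * n / 8\<close> labels have a small margin, the bound holds since the loss never
exceeds \<open>2 * n\<close>. Otherwise the iteration contracts, starting from the global sign that the
eigenvector happens to have.\<close>

theorem eta_iter_loss_bound:
  assumes Y: "Y \<in> carrier_mat p n" and n: "n > 0" and top: "top_eigenvector (hollow_gram Y) (v Y)"
    and s: "s \<in> {-1, 1}" and eta: "\<eta> \<in> sign_vecs n" and kappa: "\<kappa> > 0" and t: "0 < t" "t \<le> 1"
  defines "H \<equiv> \<lambda>i j. hollow_gram Y $$ (i, j)" and "e \<equiv> vec_index \<eta>"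
  assumes Z: "form_bounded n (centred n H \<kappa> e) B" and B: "0 \<le> B" "B \<le> t / 12 * (n * \<kappa>)"
  shows "loss n (eta_iter s v k Y) \<eta>
    \<le> 16 / t * real (card {i. i < n \<and> e i * app n H e i \<le> t * (n * \<kappa>)}) + 2 * (n * (1 / 9) ^ k)"
proof -
  let ?N = "real (card {i. i < n \<and> e i * app n H e i \<le> t * (n * \<kappa>)})"
  have vc: "v Y \<in> carrier_vec n" by (rule top_eigenvector_carrier[OF Y top])
  have it: "eta_iter s v k Y \<in> sign_vecs n" for k
    by (rule eta_iter_sign_vecs[of Y p n s v, OF Y s vc])
  have e2: "(e i)\<^sup>2 = 1" if "i < n" for i
    unfolding e_def by (rule sign_square[OF eta that])
  have sym: "symmetric_on n H" unfolding H_def by (rule symmetric_hollow_gram[OF Y])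
  obtain l where l: "eigenvector (hollow_gram Y) (v Y) l" "\<And>m. eigenvalue (hollow_gram Y) m \<Longrightarrow> m \<le> l"
    using top unfolding top_eigenvector_def by blast
  have ray: "dot n x (app n H x) \<le> l * dot n x x" for x
    unfolding H_def
    by (rule rayleigh_le_top_eigenvalue[OF hollow_gram_carrier[OF Y] n symmetric_hollow_gram[OF
        Y] l(2)])
  have ev: "app n H (vec_index (v Y)) i = l * vec_index (v Y) i" if "i < n" for i
  proof -
    have "hollow_gram Y *\<^sub>v v Y = l \<cdot>\<^sub>v v Y" using l(1) by (simp add: eigenvector_def)
    then have "vec_index (hollow_gram Y *\<^sub>v v Y) i = l * vec_index (v Y) i" using vc that by simp
    then show ?thesis unfolding hollow_gram_mult_index[OF Y vc that] H_def .
  qed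
  have vpos: "dot n (vec_index (v Y)) (vec_index (v Y)) > 0"
  proof (rule ccontr)
    assume "\<not> ?thesis"
    then have "dot n (vec_index (v Y)) (vec_index (v Y)) = 0"
        using dot_nonneg[of n "vec_index (v Y)"] by linarith
    then have "vec_index (v Y) i = 0" if "i < n" for i
      using that by (simp add: dot_self sum_nonneg_eq_0_iff)
    then have "v Y = 0\<^sub>v n" using vc by (intro eq_vecI) auto
    then show False using l(1) hollow_gram_carrier[OF Y] by (simp add: eigenvector_def)
  qed
  have "\<exists>\<nu>\<in>{-1, 1::real}. real (card {i. i < n \<and> \<nu> * e i * vec_index (v Y) i \<le> 0})
      \<le> 5 * (t / 12)\<^sup>2 * n"
    using t by (intro spectral_sign_errors[OF n e2 kappa sym Z B _ ev vpos ray]) auto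
  then obtain \<nu> where nu: "\<nu> \<in> {-1, 1::real}"
    and h0: "real (card {i. i < n \<and> \<nu> * e i * vec_index (v Y) i \<le> 0}) \<le> 5 * (t / 12)\<^sup>2 * n" by blast
  have nn: "\<nu> * \<nu> = 1" using nu by auto
  define f where "f i = \<nu> * e i" for i
  have f2: "(f i)\<^sup>2 = 1" if "i < n" for i
  proof -
    have "(f i)\<^sup>2 = (\<nu> * \<nu>) * (e i)\<^sup>2" by (simp add: f_def power2_eq_square)
    then show ?thesis using e2[OF that] nn by simp
  qed
  have f1: "f i \<in> {-1, 1}" if "i < n" for i
  proof -
    have "e i \<in> {-1, 1}" using eta that unfolding e_def sign_vecs_def by blast
    moreover have "w * y \<in> {-1, 1}" if "w \<in> {-1, 1}" "y \<in> {-1, 1}" for w y :: real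
      using that by (elim insertE emptyE) simp_all
    ultimately show ?thesis unfolding f_def using nu by blast
  qed
  have cf: "centred n H \<kappa> f = centred n H \<kappa> e"
  proof -
    have "\<kappa> * (\<nu> * e i) * (\<nu> * e j) = \<kappa> * e i * e j" for i j
    proof -
      have "\<kappa> * (\<nu> * e i) * (\<nu> * e j) = (\<nu> * \<nu>) * (\<kappa> * e i * e j)" by (simp only: mult_ac)
      then show ?thesis by (simp only: nn mult_1)
    qed
    then show ?thesis unfolding centred_def f_def by (simp only:)
  qed
  have Nf: "{i. i < n \<and> f i * app n H f i \<le> t * (n * \<kappa>)} = {i. i < n \<and> e i * app n H e i
      \<le> t * (n * \<kappa>)}"
  proof -
    have "f i * app n H f i = (\<nu> * \<nu>) * (e i * app n H e i)" for i
      unfolding f_def[abs_def] app_linear by (simp only: mult_ac)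
    then show ?thesis unfolding nn by simp
  qed
  show ?thesis
  proof (cases "?N \<le> t / 8 * n")
    case True
    define x where "x k = vec_index (eta_iter s v k Y)" for k
    have h: "real (card {i. i < n \<and> x k i \<noteq> f i})
      \<le> 2 * real (card {i. i < n \<and> f i * app n H f i \<le> t * (n * \<kappa>)}) + n * (1 / 9) ^ k"
    proof (rule sign_power_iteration[OF f2 kappa n sym _ B t s])
      show "form_bounded n (centred n H \<kappa> f) B" unfolding cf by (rule Z)
      show "x k i \<in> {-1, 1}" if "i < n" for k i
        using it[of k] that unfolding x_def sign_vecs_def by blast
      show "x (Suc k) i = sign_conv s (app n H (x k) i)" if "i < n" for k i
        unfolding x_def H_def hollow_gram_mult_index[OF Y sign_vecs_carrier[OF it] that, symmetric]
        using that hollow_gram_carrier[OF Y] by simp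
      show "real (card {i. i < n \<and> f i * app n H f i \<le> t * (n * \<kappa>)}) \<le> t / 8 * n"
        unfolding Nf by (rule True)
      have "{i. i < n \<and> x 0 i \<noteq> f i} \<subseteq> {i. i < n \<and> \<nu> * e i * vec_index (v Y) i \<le> 0}"
      proof
        fix i assume "i \<in> {i. i < n \<and> x 0 i \<noteq> f i}"
        then have i: "i < n" "x 0 i \<noteq> f i" by auto
        have "x 0 i = sign_conv s (vec_index (v Y) i)" using i(1) vc by (simp add: x_def)
        then have "f i * vec_index (v Y) i \<le> 0" using sign_conv_error[OF f1[OF i(1)]] i(2) by simp
        then show "i \<in> {i. i < n \<and> \<nu> * e i * vec_index (v Y) i \<le> 0}" using i(1) by (simp add: f_def)
      qed
      then have "real (card {i. i < n \<and> x 0 i \<noteq> f i})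
          \<le> real (card {i. i < n \<and> \<nu> * e i * vec_index (v Y) i \<le> 0})"
        by (intro of_nat_mono card_mono) auto
      then show "real (card {i. i < n \<and> x 0 i \<noteq> f i}) \<le> 5 * (t / 12)\<^sup>2 * n" using h0 by linarith
    qed
    have "loss n (eta_iter s v k Y) \<eta> \<le> 2 * real (card {i. i < n \<and> x k i \<noteq> f i})"
      using loss_le_errors[OF it eta nu, of k] by (simp only: x_def f_def e_def)
    also have "\<dots> \<le> 4 * ?N + 2 * (n * (1 / 9) ^ k)" using h unfolding Nf by linarith
    also have "4 * ?N \<le> 16 / t * ?N" using t by (intro mult_right_mono) (simp_all add: le_divide_eq)
    finally show ?thesis by simp
  next
    case False
    have "loss n (eta_iter s v k Y) \<eta> \<le> 16 / t * (t / 8 * n)"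
        using loss_le[OF it eta, of k] t by simp
    also have "\<dots> \<le> 16 / t * ?N" using False t by (intro mult_left_mono) auto
    finally show ?thesis by (simp add: add_increasing2)
  qed
qed

section \<open>Concentration of the noise\<close>

text \<open>Weigh each grid point \<open>z\<close> by \<open>exp (33 * n - \<parallel>z\<parallel>\<^sup>2) \<ge> 1\<close>; the sum over the whole cube
factorizes.\<close>

lemma card_grid_le: "real (card (grid n)) \<le> (3 * exp 33) ^ n"
proof -
  let ?K = "int (33 * n)"
  let ?P = "{..<n} \<rightarrow>\<^sub>E {- ?K..?K}"
  have geo: "(\<Sum>k\<in>{- int m..int m}. (1/2::real) ^ nat \<bar>k\<bar>) \<le> 3 - 2 * (1/2) ^ m" for m :: nat
  proof (induction m)
    case (Suc m)
    have "{- int (Suc m)..int (Suc m)}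
        = insert (int (Suc m)) (insert (- int (Suc m)) {- int m..int m})"
      by auto
    then have "(\<Sum>k\<in>{- int (Suc m)..int (Suc m)}. (1/2) ^ nat \<bar>k\<bar>)
        = 2 * (1/2) ^ Suc m + (\<Sum>k\<in>{- int m..int m}. (1/2::real) ^ nat \<bar>k\<bar>)"
      by (simp add: nat_add_distrib)
    also have "\<dots> \<le> 2 * (1/2) ^ Suc m + (3 - 2 * (1/2) ^ m)" using Suc.IH by simp
    finally show ?case by simp
  qed simp
  have one: "exp (- (real_of_int k)\<^sup>2) \<le> (1/2) ^ nat \<bar>k\<bar>" for k
  proof -
    have "real (nat \<bar>k\<bar>) \<le> (real_of_int k)\<^sup>2"
    proof (cases "k = 0")
      case False
      then have "1 \<le> \<bar>real_of_int k\<bar>" by linarith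
      from mult_left_mono[OF this, of "\<bar>real_of_int k\<bar>"] show ?thesis
          by (simp add: power2_eq_square)
    qed simp
    then have "exp (- (real_of_int k)\<^sup>2) \<le> exp (- real (nat \<bar>k\<bar>))" by simp
    also have "\<dots> = exp (- 1) ^ nat \<bar>k\<bar>" by (simp add: exp_of_nat_mult[symmetric])
    also have "\<dots> \<le> (1/2) ^ nat \<bar>k\<bar>"
    proof (intro power_mono)
      have "2 \<le> exp (1::real)" using exp_ge_add_one_self[of 1] by simp
      then show "exp (- 1) \<le> (1/2 :: real)" by (simp add: exp_minus field_simps)
    qed simp
    finally show ?thesis .
  qed
  have "real (card (grid n)) = (\<Sum>z\<in>grid n. 1)" by simp
  also have "\<dots> \<le> (\<Sum>z\<in>grid n. exp 33 ^ n * (\<Prod>i<n. exp (- (real_of_int (z i))\<^sup>2)))"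
  proof (intro sum_mono)
    fix z assume "z \<in> grid n"
    then have "0 \<le> 33 * real n - (\<Sum>i<n. (real_of_int (z i))\<^sup>2)" by (simp add: grid_def)
    then have "1 \<le> exp (33 * real n - (\<Sum>i<n. (real_of_int (z i))\<^sup>2))" by simp
    also have "\<dots> = exp (real n * 33) * exp (\<Sum>i<n. - (real_of_int (z i))\<^sup>2)"
      by (simp add: exp_add[symmetric] sum_negf)
    also have "\<dots> = exp 33 ^ n * (\<Prod>i<n. exp (- (real_of_int (z i))\<^sup>2))"
      by (simp only: exp_of_nat_mult exp_sum finite_lessThan)
    finally show "1 \<le> exp 33 ^ n * (\<Prod>i<n. exp (- (real_of_int (z i))\<^sup>2))" .
  qed
  also have "\<dots> \<le> (\<Sum>z\<in>?P. exp 33 ^ n * (\<Prod>i<n. exp (- (real_of_int (z i))\<^sup>2)))"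
    by (intro sum_mono2 finite_PiE mult_nonneg_nonneg prod_nonneg) (auto simp: grid_def)
  also have "\<dots> = exp 33 ^ n * (\<Prod>i<n. \<Sum>k\<in>{- ?K..?K}. exp (- (real_of_int k)\<^sup>2))"
    by (simp only: sum_distrib_left[symmetric]) (subst prod_sum_PiE, simp_all)
  also have "\<dots> \<le> exp 33 ^ n * (\<Prod>i<n. 3)"
  proof (intro mult_left_mono prod_mono conjI)
    have "(\<Sum>k\<in>{- ?K..?K}. exp (- (real_of_int k)\<^sup>2)) \<le> (\<Sum>k\<in>{- ?K..?K}. (1/2) ^ nat \<bar>k\<bar>)"
      by (intro sum_mono one)
    also have "\<dots> \<le> 3 - 2 * (1/2) ^ (33 * n)" by (rule geo)
    also have "\<dots> \<le> 3" by simp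
    finally show "(\<Sum>k\<in>{- ?K..?K}. exp (- (real_of_int k)\<^sup>2)) \<le> 3" .
  qed (simp_all add: sum_nonneg)
  also have "\<dots> = (3 * exp 33) ^ n" by (simp add: power_mult_distrib mult.commute)
  finally show ?thesis .
qed

lemma finite_grid: "finite (grid n)"
  by (rule finite_subset[of _ "{..<n} \<rightarrow>\<^sub>E {- int (33 * n)..int (33
      * n)}"]) (auto simp: grid_def intro!: finite_PiE)

text \<open>The diagonal entries are values of the form at unit vectors, so removing them at most
doubles the bound.\<close>

lemma form_bounded_hollow:
  assumes n: "n > 0" and M: "form_bounded n M b"
  shows "form_bounded n (\<lambda>i j. if i = j then 0 else M i j) (2 * b)"
proof -
  have diag: "\<bar>M i i\<bar> \<le> b" if i: "i < n" for i
  proof -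
    let ?u = "\<lambda>j. if j = i then 1 else (0::real)"
    have "app n M ?u k = M k i" for k
    proof -
      have "app n M ?u k = (\<Sum>j<n. if j = i then M k i else 0)"
        unfolding app_def by (intro sum.cong) auto
      then show ?thesis using i by simp
    qed
    moreover have "dot n ?u y = y i" for y
    proof -
      have "dot n ?u y = (\<Sum>j<n. if j = i then y i else 0)"
        unfolding dot_def by (intro sum.cong) auto
      then show ?thesis using i by simp
    qed
    moreover have "\<bar>dot n ?u (app n M ?u)\<bar> \<le> b * dot n ?u ?u"
      using M unfolding form_bounded_def by (rule spec)
    ultimately show ?thesis by simp
  qed
  show ?thesis
    unfolding form_bounded_def
  proof
    fix x
    let ?Z = "\<lambda>i j. if i = j then 0 else M i j"
    have "app n ?Z x i = app n M x i - M i i * x i" if "i < n" for i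
    proof -
      have "app n ?Z x i = (\<Sum>j<n. M i j * x j - (if j = i then M i i * x i else 0))"
        unfolding app_def by (intro sum.cong) auto
      then show ?thesis using that by (simp add: sum_subtractf app_def)
    qed
    then have "dot n x (app n ?Z x) = dot n x (\<lambda>i. app n M x i - M i i * x i)"
      unfolding dot_def by (intro sum.cong refl) simp
    also have "\<dots> = dot n x (app n M x) - dot n x (\<lambda>i. M i i * x i)" by (simp add: dot_linear)
    finally have 1: "dot n x (app n ?Z x) = dot n x (app n M x) - dot n x (\<lambda>i. M i i * x i)" .
    have "\<bar>dot n x (\<lambda>i. M i i * x i)\<bar> \<le> (\<Sum>i<n. \<bar>x i * (M i i * x i)\<bar>)"
      unfolding dot_def by (rule sum_abs)
    also have "\<dots> \<le> (\<Sum>i<n. b * (x i * x i))"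
    proof (intro sum_mono)
      fix i assume "i \<in> {..<n}"
      then have "\<bar>M i i\<bar> * (x i * x i) \<le> b * (x i * x i)" using diag by (intro mult_right_mono) auto
      moreover have "\<bar>x i * (M i i * x i)\<bar> = \<bar>M i i\<bar> * (x i * x i)" by (simp add: abs_mult)
      ultimately show "\<bar>x i * (M i i * x i)\<bar> \<le> b * (x i * x i)" by linarith
    qed
    also have "\<dots> = b * dot n x x" by (simp add: dot_def sum_distrib_left)
    finally have "\<bar>dot n x (\<lambda>i. M i i * x i)\<bar> \<le> b * dot n x x" .
    moreover have "\<bar>dot n x (app n M x)\<bar> \<le> b * dot n x x" using M unfolding form_bounded_def
        by (rule spec)
    ultimately show "\<bar>dot n x (app n ?Z x)\<bar> \<le> 2 * b * dot n x x" unfolding 1 by linarith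
  qed
qed

lemma gaussian_mgf_bound:
  fixes A :: real
  assumes "\<bar>A\<bar> \<le> 1/2"
  shows "exp (- A / 2) * (exp (b\<^sup>2 / (2 * (1 - A))) / sqrt (1 - A)) \<le> exp (A\<^sup>2 + b\<^sup>2)"
proof -
  have A: "1 - A \<ge> 1/2" using assms by linarith
  have "\<bar>ln (1 + - A) - - A\<bar> \<le> 2 * (- A)\<^sup>2"
    using assms by (intro abs_ln_one_plus_x_minus_x_bound) simp
  then have "- A - 2 * A\<^sup>2 \<le> ln (1 - A)" by simp
  then have "exp (- A / 2 - A\<^sup>2) \<le> exp (ln (1 - A) / 2)" by simp
  also have "\<dots> = sqrt (1 - A)" using A by (simp add: ln_sqrt[symmetric])
  finally have s: "exp (- A / 2 - A\<^sup>2) \<le> sqrt (1 - A)" .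
  have "exp (- A / 2) / sqrt (1 - A) \<le> exp (- A / 2) / exp (- A / 2 - A\<^sup>2)"
    using s A by (intro divide_left_mono mult_pos_pos) auto
  also have "\<dots> = exp (A\<^sup>2)" by (simp add: exp_diff[symmetric])
  finally have 1: "exp (- A / 2) / sqrt (1 - A) \<le> exp (A\<^sup>2)" .
  have "b\<^sup>2 * 1 \<le> b\<^sup>2 * (2 * (1 - A))" using A by (intro mult_left_mono) auto
  then have "b\<^sup>2 / (2 * (1 - A)) \<le> b\<^sup>2" using A by (subst pos_divide_le_eq) auto
  then have 2: "exp (b\<^sup>2 / (2 * (1 - A))) \<le> exp (b\<^sup>2)" by simp
  have "exp (- A / 2) * (exp (b\<^sup>2 / (2 * (1 - A))) / sqrt (1 - A))
      = exp (- A / 2) / sqrt (1 - A) * exp (b\<^sup>2 / (2 * (1 - A)))"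
    by simp
  also have "\<dots> \<le> exp (A\<^sup>2) * exp (b\<^sup>2)" using 1 2 A by (intro mult_mono) auto
  finally show ?thesis by (simp add: exp_add)
qed

text \<open>In units of \<open>\<sigma>\<^sup>2\<close>, the form at \<open>y\<close> of \<open>Y\<^sup>T Y - \<kappa> e e\<^sup>T - \<sigma>\<^sup>2 p I\<close>, which agrees with the noise
part of the hollow Gram matrix off the diagonal.\<close>

definition noise_form :: "nat \<Rightarrow> nat \<Rightarrow> (nat \<Rightarrow> real) \<Rightarrow> (nat \<Rightarrow> real) \<Rightarrow> (nat \<Rightarrow> real) \<Rightarrow> (nat \<times> nat \<Rightarrow>
    real) \<Rightarrow> real" where
  "noise_form p n t e y x = (\<Sum>r<p. 2 * t r * dot n e y * (\<Sum>j<n. y j * x (r, j))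
      + (\<Sum>j<n. y j * x (r, j))\<^sup>2 - dot n y y)"

lemma noise_form_mgf:
  assumes e: "dot n e e = n" and y: "dot n y y \<le> 33 / 16" and mu: "\<bar>\<mu>\<bar> \<le> 1 / 9"
  shows "(\<integral>\<^sup>+x. ennreal (exp (\<mu> * noise_form p n t e y x)) \<partial>noise p n)
    \<le> ennreal (exp (18 * \<mu>\<^sup>2 * (real p + real n * (\<Sum>r<p. (t r)\<^sup>2))))"
proof -
  define a where "a = dot n y y"
  define c where "c = dot n e y"
  have a: "0 \<le> a" "a \<le> 33 / 16" using y dot_nonneg by (simp_all add: a_def)
  have c: "c\<^sup>2 \<le> real n * a"
    using Cauchy_Schwarz_ineq_sum[of e y "{..<n}"] e unfolding c_def a_def dot_self
        by (simp add: dot_def)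
  have sy: "sqrt (\<Sum>j<n. (y j)\<^sup>2) = sqrt a" by (simp add: a_def dot_self)
  define f where "f r w = ennreal (exp (\<mu> * (2 * t r * c * w + w\<^sup>2 - a)))" for r and w :: real
  have A: "\<bar>2 * \<mu> * a\<bar> \<le> 1 / 2"
  proof -
    have "\<bar>2 * \<mu> * a\<bar> = 2 * \<bar>\<mu>\<bar> * a" using a by (simp add: abs_mult)
    also have "\<dots> \<le> 2 * (1/9) * (33/16)" using mu a by (intro mult_mono) auto
    finally show ?thesis by simp
  qed
  have "(\<integral>\<^sup>+x. ennreal (exp (\<mu> * noise_form p n t e y x)) \<partial>noise p n)
      = (\<integral>\<^sup>+x. (\<Prod>r<p. f r (\<Sum>j<n. y j * x (r, j))) \<partial>noise p n)"
    unfolding noise_form_def f_def c_def[symmetric] a_def[symmetric] sum_distrib_left[where A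
        = "{..<p}"]
    by (simp only: exp_sum finite_lessThan prod_ennreal[OF exp_ge_zero])
  also have "\<dots> = (\<Prod>r<p. \<integral>\<^sup>+z. f r (sqrt a * z) \<partial>SN)"
    unfolding sy[symmetric] by (rule gaussian_rows) (simp add: f_def)
  also have "\<dots> \<le> (\<Prod>r<p. ennreal (exp (18 * \<mu>\<^sup>2 * (1 + real n * (t r)\<^sup>2))))"
  proof (rule prod_mono_ennreal)
    fix r
    let ?A = "2 * \<mu> * a" and ?b = "2 * \<mu> * t r * c * sqrt a"
    have "(\<integral>\<^sup>+z. f r (sqrt a * z) \<partial>SN)
        = (\<integral>\<^sup>+z. ennreal (exp (- ?A / 2)) * ennreal (exp (?b * z + ?A * z\<^sup>2 / 2)) \<partial>SN)"
    proof (intro nn_integral_cong)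
      fix z
      have "\<mu> * (2 * t r * c * (sqrt a * z) + (sqrt a * z)\<^sup>2 - a)
          = - ?A / 2 + (?b * z + ?A * z\<^sup>2 / 2)"
        using a by (simp add: power_mult_distrib algebra_simps)
      then show "f r (sqrt a * z) = ennreal (exp (- ?A / 2)) * ennreal (exp (?b * z
          + ?A * z\<^sup>2 / 2))"
        unfolding f_def by (simp only: exp_add ennreal_mult'[OF exp_ge_zero])
    qed
    also have "\<dots> = ennreal (exp (- ?A / 2)) * ennreal (exp (?b\<^sup>2 / (2 * (1 - ?A))) / sqrt (1 - ?A))"
      using A by (subst nn_integral_cmult, simp, subst gaussian_integral) auto
    also have "\<dots> = ennreal (exp (- ?A / 2) * (exp (?b\<^sup>2 / (2 * (1 - ?A))) / sqrt (1 - ?A)))"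
      by (rule ennreal_mult'[symmetric]) simp
    also have "\<dots> \<le> ennreal (exp (?A\<^sup>2 + ?b\<^sup>2))"
      by (intro ennreal_leI gaussian_mgf_bound A)
    also have "\<dots> \<le> ennreal (exp (18 * \<mu>\<^sup>2 * (1 + real n * (t r)\<^sup>2)))"
    proof -
      have a2: "a\<^sup>2 \<le> (33/16)\<^sup>2" using a by (intro power_mono) auto
      have "?A\<^sup>2 + ?b\<^sup>2 = 4 * \<mu>\<^sup>2 * (a\<^sup>2 + (t r)\<^sup>2 * (c\<^sup>2 * a))"
        using a by (simp add: power_mult_distrib algebra_simps)
      also have "\<dots> \<le> 4 * \<mu>\<^sup>2 * (a\<^sup>2 + (t r)\<^sup>2 * (real n * a * a))"
        using a c by (intro mult_left_mono add_left_mono mult_right_mono) auto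
      also have "\<dots> = (4 * a\<^sup>2) * (\<mu>\<^sup>2 * (1 + real n * (t r)\<^sup>2))"
          by (simp add: power2_eq_square algebra_simps)
      also have "\<dots> \<le> 18 * (\<mu>\<^sup>2 * (1 + real n * (t r)\<^sup>2))"
        using a2 by (intro mult_right_mono mult_nonneg_nonneg) (auto simp: power_divide)
      finally show ?thesis by (intro ennreal_leI) (simp add: mult.assoc)
    qed
    finally show "(\<integral>\<^sup>+z. f r (sqrt a * z) \<partial>SN)
        \<le> ennreal (exp (18 * \<mu>\<^sup>2 * (1 + real n * (t r)\<^sup>2)))" .
  qed
  also have "\<dots> = ennreal (exp (\<Sum>r<p. 18 * \<mu>\<^sup>2 * (1 + real n * (t r)\<^sup>2)))"
    by (simp add: prod_ennreal exp_sum)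
  also have "(\<Sum>r<p. 18 * \<mu>\<^sup>2 * (1 + real n * (t r)\<^sup>2))
      = 18 * \<mu>\<^sup>2 * (real p + real n * (\<Sum>r<p. (t r)\<^sup>2))"
    by (simp add: sum_distrib_left sum.distrib algebra_simps)
  finally show ?thesis .
qed

text \<open>The margin of label \<open>i\<close>, divided by \<open>\<sigma>\<^sup>2\<close>, is an inner product of two independent Gaussian
vectors, the scaled observation \<open>i\<close> and the signed sum of the others. To leading order its Laplace
transform at \<open>m / (n - 1)\<close> is \<open>exp (- m * X + m\<^sup>2 / 2 * (X + p / n))\<close>: the term \<open>p / n\<close> is the price
for estimating the centre.\<close>

lemma margin_mgf:
  fixes t :: "nat \<Rightarrow> real"
  assumes eta: "\<eta> \<in> sign_vecs n" and i: "i < n" and n: "n \<ge> 3" and lam: "0 \<le> m" "m \<le> 1"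
  shows "(\<integral>\<^sup>+x. ennreal (exp (- (m / (real n - 1)) * (\<Sum>r<p. (t r + vec_index \<eta> i * x (r, i))
      * ((real n - 1) * t r + (\<Sum>j\<in>{..<n}-{i}. vec_index \<eta> j * x (r, j)))))) \<partial>noise p n)
    \<le> ennreal (exp (- m * (\<Sum>r<p. (t r)\<^sup>2)
        + m\<^sup>2 / 2 * ((\<Sum>r<p. (t r)\<^sup>2) + real p / real n) * (real n / (real n - 2))))"
proof -
  let ?S = "\<lambda>x r. \<Sum>j\<in>{..<n}-{i}. vec_index \<eta> j * x (r, j)"
  let ?e = "vec_index \<eta> i" and ?N = "real n - 1"
  define f where "f r y S = ennreal (exp (- (m / ?N) * ((t r + ?e * y) * (?N * t r + S))))"
      for r and y S :: real
  have N: "?N \<ge> 2" using n by simp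
  have e2: "?e\<^sup>2 = 1" by (rule sign_square[OF eta i])
  have sq: "sqrt (\<Sum>j\<in>{..<n} - {i}. (vec_index \<eta> j)\<^sup>2) = sqrt ?N"
    by (simp only: sum_sign_squares[OF eta i])
  have fm: "case_prod (f r) \<in> borel_measurable (borel \<Otimes>\<^sub>M borel)" for r
    unfolding f_def by measurable
  have "(\<integral>\<^sup>+x. ennreal (exp (- (m / ?N) * (\<Sum>r<p. (t r + ?e * x (r, i)) * (?N * t r
      + ?S x r)))) \<partial>noise p n)
      = (\<integral>\<^sup>+x. (\<Prod>r<p. f r (x (r, i)) (?S x r)) \<partial>noise p n)"
    unfolding sum_distrib_left[where A = "{..<p}"] f_def
    by (simp only: exp_sum finite_lessThan prod_ennreal[OF exp_ge_zero])
  also have "\<dots> = (\<Prod>r<p. \<integral>\<^sup>+y. (\<integral>\<^sup>+z. f r y (sqrt ?N * z) \<partial>SN) \<partial>SN)"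
    unfolding sq[symmetric] by (rule gaussian_rows_split[OF i fm])
  also have "\<dots> \<le> (\<Prod>r<p. ennreal (exp (- m * (t r)\<^sup>2 + m\<^sup>2 / 2 * ((t r)\<^sup>2
      + 1 / real n) * (real n / (real n - 2)))))"
  proof (rule prod_mono_ennreal)
    fix r
    let ?t = "t r"
    define a where "a = m\<^sup>2 / ?N"
    have m2: "m\<^sup>2 \<le> 1" "m\<^sup>2 \<le> m" using lam
        by (simp_all add: power2_eq_square mult_le_one mult_left_le)
    have a: "0 \<le> a" "a < 1" "a \<le> m" "a \<le> 1 / ?N" "1 - a \<ge> (?N - 1) / ?N"
    proof -
      show "0 \<le> a" using N by (simp add: a_def)
      show a1: "a \<le> 1 / ?N" unfolding a_def using m2 N by (intro divide_right_mono) auto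
      have g: "(u - 1) / u = 1 - 1 / u" if "u > 0" for u :: real
        using that by (simp add: diff_divide_distrib)
      show "1 - a \<ge> (?N - 1) / ?N" using a1 N by (subst g) linarith+
      have "1 / ?N < 1" using N by simp
      then show "a < 1" using a1 by linarith
      have "a \<le> m\<^sup>2 / 1" unfolding a_def using N by (intro divide_left_mono) auto
      then show "a \<le> m" using m2 by simp
    qed
    define b where "b = ?t * ?e * (a - m)"
    have z: "(\<integral>\<^sup>+z. f r y (sqrt ?N * z) \<partial>SN)
        = ennreal (exp (- m * ?t\<^sup>2 + a * ?t\<^sup>2 / 2)) * ennreal (exp (b * y + a * y\<^sup>2 / 2))" for y
    proof -
      let ?w = "?t + ?e * y"
      have "(\<integral>\<^sup>+z. f r y (sqrt ?N * z) \<partial>SN)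
         = (\<integral>\<^sup>+z. ennreal (exp (- m * ?t * ?w)) * ennreal (exp ((- (m / ?N) * sqrt ?N * ?w)
             * z + 0 * z\<^sup>2 / 2)) \<partial>SN)"
      proof (intro nn_integral_cong)
        fix z
        have "- (m / ?N) * (?w * (?N * ?t + sqrt ?N * z))
            = - m * ?t * ?w + ((- (m / ?N) * sqrt ?N * ?w) * z + 0 * z\<^sup>2 / 2)"
          using N by (simp add: field_simps)
        then show "f r y (sqrt ?N * z) = ennreal (exp (- m * ?t * ?w))
            * ennreal (exp ((- (m / ?N) * sqrt ?N * ?w) * z + 0 * z\<^sup>2 / 2))"
          unfolding f_def by (simp only: exp_add ennreal_mult'[OF exp_ge_zero])
      qed
      also have "\<dots> = ennreal (exp (- m * ?t * ?w)) * ennreal (exp ((- (m / ?N) * sqrt ?N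
          * ?w)\<^sup>2 / 2))"
        by (subst nn_integral_cmult, simp, subst gaussian_integral) simp_all
      also have "\<dots> = ennreal (exp (- m * ?t * ?w + (- (m / ?N) * sqrt ?N * ?w)\<^sup>2 / 2))"
        by (simp only: exp_add ennreal_mult'[OF exp_ge_zero])
      also have "- m * ?t * ?w + (- (m / ?N) * sqrt ?N * ?w)\<^sup>2 / 2
          = (- m * ?t\<^sup>2 + a * ?t\<^sup>2 / 2) + (b * y + a * y\<^sup>2 / 2)"
      proof -
        have "(- (m / ?N) * sqrt ?N * ?w)\<^sup>2 = a * ?w\<^sup>2"
          using N by (simp add: power_mult_distrib power_divide a_def power2_eq_square[of ?N])
        moreover have "?w\<^sup>2 = ?t\<^sup>2 + 2 * ?t * ?e * y + ?e\<^sup>2 * y\<^sup>2"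
            by (simp add: power2_eq_square algebra_simps)
        ultimately show ?thesis unfolding b_def e2 by (simp add: power2_eq_square field_simps)
      qed
      also have "ennreal (exp (- m * ?t\<^sup>2 + a * ?t\<^sup>2 / 2 + (b * y + a * y\<^sup>2 / 2)))
          = ennreal (exp (- m * ?t\<^sup>2 + a * ?t\<^sup>2 / 2)) * ennreal (exp (b * y + a * y\<^sup>2 / 2))"
        unfolding exp_add[of "- m * ?t\<^sup>2 + a * ?t\<^sup>2 / 2" "b * y + a * y\<^sup>2 / 2"]
            by (rule ennreal_mult') simp
      finally show ?thesis .
    qed
    have "(\<integral>\<^sup>+y. (\<integral>\<^sup>+z. f r y (sqrt ?N * z) \<partial>SN) \<partial>SN)
        = ennreal (exp (- m * ?t\<^sup>2
            + a * ?t\<^sup>2 / 2)) * ennreal (exp (b\<^sup>2 / (2 * (1 - a))) / sqrt (1 - a))"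
      unfolding z using a by (subst nn_integral_cmult, simp, subst gaussian_integral) simp_all
    also have "\<dots> = ennreal (exp (- m * ?t\<^sup>2
        + a * ?t\<^sup>2 / 2) * (exp (b\<^sup>2 / (2 * (1 - a))) / sqrt (1 - a)))"
      by (rule ennreal_mult'[symmetric]) simp
    also have "\<dots> \<le> ennreal (exp (- m * ?t\<^sup>2 + m\<^sup>2 / 2 * (?t\<^sup>2
        + 1 / real n) * (real n / (real n - 2))))"
    proof (intro ennreal_leI)
      have pos: "(?N - 1) / ?N > 0" using N by simp
      have inv: "1 / (1 - a) \<le> ?N / (?N - 1)"
        using a(5) pos by (metis divide_divide_eq_right frac_le mult_1 order_refl zero_le_one)
      have s1: "1 / sqrt (1 - a) \<le> exp (m\<^sup>2 / (2 * (?N - 1)))"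
      proof -
        have "1 / (1 - a) = 1 + a * (1 / (1 - a))" using a by (simp add: field_simps)
        also have "\<dots> \<le> 1 + a * (?N / (?N - 1))" using inv a
            by (intro add_left_mono mult_left_mono) auto
        also have "\<dots> = 1 + m\<^sup>2 / (?N - 1)" using N by (simp add: a_def)
        also have "\<dots> \<le> exp (m\<^sup>2 / (?N - 1))" by (rule exp_ge_add_one_self)
        also have "\<dots> = (exp (m\<^sup>2 / (2 * (?N - 1))))\<^sup>2"
        proof -
          have h: "u / w = 2 * (u / (2 * w))" for u w :: real by simp
          have "m\<^sup>2 / (?N - 1) = 2 * (m\<^sup>2 / (2 * (?N - 1)))" by (rule h)
          then show ?thesis by (simp only: exp_double)
        qed
        finally have "sqrt (1 / (1 - a)) \<le> exp (m\<^sup>2 / (2 * (?N - 1)))" by (intro real_le_lsqrt) auto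
        then show ?thesis by (simp add: real_sqrt_divide)
      qed
      have s2: "b\<^sup>2 / (2 * (1 - a)) \<le> ?t\<^sup>2 * m\<^sup>2 / 2 * (?N / (?N - 1))"
      proof -
        have "(a - m)\<^sup>2 \<le> m\<^sup>2" using a lam by (intro abs_le_square_iff[THEN iffD1]) simp
        then have "b\<^sup>2 \<le> ?t\<^sup>2 * m\<^sup>2" unfolding b_def
            by (simp add: power_mult_distrib e2 mult_left_mono)
        then have "b\<^sup>2 / 2 * (1 / (1 - a)) \<le> ?t\<^sup>2 * m\<^sup>2 / 2 * (?N / (?N - 1))"
          using inv a by (intro mult_mono) auto
        then show ?thesis by simp
      qed
      have "exp (- m * ?t\<^sup>2 + a * ?t\<^sup>2 / 2) * (exp (b\<^sup>2 / (2 * (1 - a))) / sqrt (1 - a))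
          = exp (- m * ?t\<^sup>2 + a * ?t\<^sup>2 / 2) * exp (b\<^sup>2 / (2 * (1 - a))) * (1 / sqrt (1
              - a))" by simp
      also have "\<dots> \<le> exp (- m * ?t\<^sup>2
          + a * ?t\<^sup>2 / 2) * exp (?t\<^sup>2 * m\<^sup>2 / 2 * (?N / (?N - 1))) * exp (m\<^sup>2 / (2 * (?N - 1)))"
        using s1 s2 a by (intro mult_mono) auto
      also have "\<dots> = exp (- m * ?t\<^sup>2 + m\<^sup>2 / 2 * (?t\<^sup>2 * (1 / ?N + ?N / (?N - 1)) + 1 / (?N - 1)))"
      proof -
        have "u + v / N * T / 2 + T * v / 2 * Q + v / (2 * K)
            = u + v / 2 * (T * (1 / N + Q) + 1 / K)"
          for u v N T Q K :: real by (simp add: algebra_simps)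
        then show ?thesis by (simp only: exp_add[symmetric] a_def)
      qed
      also have "\<dots> \<le> exp (- m * ?t\<^sup>2 + m\<^sup>2 / 2 * (?t\<^sup>2 * (real n / (real n - 2))
          + 1 / (real n - 2)))"
      proof -
        have "1 / ?N \<le> 1 / (?N - 1)" using N by (intro divide_left_mono) auto
        moreover have "?N / (?N - 1) + 1 / (?N - 1) = real n / (real n - 2)" using N
            by (simp add: add_divide_distrib[symmetric])
        ultimately have "?t\<^sup>2 * (1 / ?N + ?N / (?N - 1)) \<le> ?t\<^sup>2 * (real n / (real n - 2))"
          by (intro mult_left_mono) auto
        then have "?t\<^sup>2 * (1 / ?N + ?N / (?N - 1)) + 1 / (?N - 1)
            \<le> ?t\<^sup>2 * (real n / (real n - 2)) + 1 / (real n - 2)"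
          by (rule add_mono) simp
        then have "m\<^sup>2 / 2 * (?t\<^sup>2 * (1 / ?N + ?N / (?N - 1)) + 1 / (?N - 1))
            \<le> m\<^sup>2 / 2 * (?t\<^sup>2 * (real n / (real n - 2)) + 1 / (real n - 2))"
          by (rule mult_left_mono) simp
        then show ?thesis by simp
      qed
      also have "?t\<^sup>2 * (real n / (real n - 2)) + 1 / (real n - 2)
          = (?t\<^sup>2 + 1 / real n) * (real n / (real n - 2))"
        using n by (simp add: distrib_right add_divide_distrib)
      finally show "exp (- m * ?t\<^sup>2 + a * ?t\<^sup>2 / 2) * (exp (b\<^sup>2 / (2 * (1 - a))) / sqrt (1 - a))
        \<le> exp (- m * ?t\<^sup>2 + m\<^sup>2 / 2 * (?t\<^sup>2
            + 1 / real n) * (real n / (real n - 2)))" by (simp only: mult.assoc)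
    qed
    finally show "(\<integral>\<^sup>+y. (\<integral>\<^sup>+z. f r y (sqrt ?N * z) \<partial>SN) \<partial>SN)
        \<le> ennreal (exp (- m * ?t\<^sup>2 + m\<^sup>2 / 2 * (?t\<^sup>2 + 1 / real n) * (real n / (real n - 2))))" .
  qed
  also have "\<dots> = ennreal (exp (\<Sum>r<p. - m * (t r)\<^sup>2 + m\<^sup>2 / 2 * ((t r)\<^sup>2
      + 1 / real n) * (real n / (real n - 2))))"
    by (simp add: prod_ennreal exp_sum)
  also have "(\<Sum>r<p. - m * (t r)\<^sup>2 + m\<^sup>2 / 2 * ((t r)\<^sup>2 + 1 / real n) * (real n / (real n - 2)))
     = - m * (\<Sum>r<p. (t r)\<^sup>2) + m\<^sup>2 / 2 * ((\<Sum>r<p. (t r)\<^sup>2)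
         + real p / real n) * (real n / (real n - 2))"
    by (simp only: sum.distrib sum_distrib_left[symmetric] sum_distrib_right[symmetric]
        sum_constant card_lessThan) simp
  finally show ?thesis .
qed

lemma form_bounded_cong:
  assumes "\<And>i j. i < n \<Longrightarrow> j < n \<Longrightarrow> M i j = M' i j"
  shows "form_bounded n M B \<longleftrightarrow> form_bounded n M' B"
proof -
  have "dot n x (app n M x) = dot n x (app n M' x)" for x
    unfolding dot_def app_def using assms by (intro sum.cong refl arg_cong2[where f = "(*)"]) auto
  then show ?thesis by (simp only: form_bounded_def)
qed

definition observed :: "nat \<Rightarrow> nat \<Rightarrow> real \<Rightarrow> (nat \<Rightarrow> real) \<Rightarrow> real vec \<Rightarrow> (nat \<times> nat \<Rightarrow> real) \<Rightarrow> real
    mat" where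
  "observed p n \<sigma> t \<eta> x = mat p n (\<lambda>(r, j). \<sigma> * (t r * vec_index \<eta> j + x (r, j)))"

lemma observed_index: "r < p \<Longrightarrow> j < n \<Longrightarrow> observed p n \<sigma> t \<eta> x $$ (r, j)
    = \<sigma> * (t r * vec_index \<eta> j + x (r, j))"
  by (simp add: observed_def)

lemma observed_carrier: "observed p n \<sigma> t \<eta> x \<in> carrier_mat p n"
  by (simp add: observed_def)

text \<open>The diagonal of \<open>Y\<^sup>T Y\<close> is recentred by \<open>\<sigma>\<^sup>2 p\<close> for the grid bound and removed afterwards.\<close>

lemma centred_gram_bounded:
  fixes t :: "nat \<Rightarrow> real"
  assumes n: "n > 0" and eta: "\<eta> \<in> sign_vecs n" and D: "D \<ge> 0"
    and grid: "\<And>z. z \<in> grid n \<Longrightarrow> \<bar>noise_form p n t (vec_index \<eta>) (grid_point n z) x\<bar> \<le> D"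
  shows "form_bounded n (centred n (\<lambda>i j. hollow_gram (observed p n \<sigma> t \<eta> x) $$ (i, j)) (\<sigma>\<^sup>2
      * (\<Sum>r<p. (t r)\<^sup>2)) (vec_index \<eta>)) (4 * \<sigma>\<^sup>2 * D)"
proof -
  let ?Y = "observed p n \<sigma> t \<eta> x" and ?e = "vec_index \<eta>" and ?k = "\<sigma>\<^sup>2 * (\<Sum>r<p. (t r)\<^sup>2)"
  define M where "M i j = (\<Sum>r<p. ?Y $$ (r, i) * ?Y $$ (r, j)) - ?k * ?e i * ?e j - (if i
      = j then \<sigma>\<^sup>2 * real p else 0)" for i j
  have sym: "symmetric_on n M"
    unfolding symmetric_on_def M_def by (simp add: mult_ac eq_commute)
  have form: "dot n y (app n M y) = \<sigma>\<^sup>2 * noise_form p n t ?e y x" for y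
  proof -
    define g where "g r = (\<Sum>j<n. ?Y $$ (r, j) * y j)" for r
    have 1: "app n M y i = (\<Sum>r<p. ?Y $$ (r, i) * g r) - ?k * ?e i * dot n ?e y - \<sigma>\<^sup>2 * real p * y i"
      if "i < n" for i
    proof -
      have "app n M y i = (\<Sum>j<n. (\<Sum>r<p. ?Y $$ (r, i) * (?Y $$ (r, j) * y j))
          - ?k * ?e i * (?e j * y j)
          - (if j = i then \<sigma>\<^sup>2 * real p * y i else 0))"
        unfolding app_def M_def by (intro sum.cong refl) (simp add: left_diff_distrib
            sum_distrib_right mult.assoc)
      also have "\<dots> = (\<Sum>j<n. \<Sum>r<p. ?Y $$ (r, i) * (?Y $$ (r, j) * y j))
          - ?k * ?e i * dot n ?e y - \<sigma>\<^sup>2 * real p * y i"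
        using that by (simp add: sum_subtractf sum_distrib_left[symmetric] dot_def)
      also have "(\<Sum>j<n. \<Sum>r<p. ?Y $$ (r, i) * (?Y $$ (r, j) * y j)) = (\<Sum>r<p. ?Y $$ (r, i) * g r)"
        unfolding g_def sum_distrib_left by (rule sum.swap)
      finally show ?thesis .
    qed
    have "dot n y (app n M y) = (\<Sum>i<n. (\<Sum>r<p. g r * (?Y $$ (r, i) * y i))
        - ?k * dot n ?e y * (?e i * y i) - \<sigma>\<^sup>2 * real p * (y i * y i))"
      unfolding dot_def[of n y] by (intro sum.cong refl) (simp add: 1 right_diff_distrib
          sum_distrib_left mult_ac)
    also have "\<dots> = (\<Sum>i<n. \<Sum>r<p. g r * (?Y $$ (r, i) * y i)) - ?k * dot n ?e y * dot n ?e y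
        - \<sigma>\<^sup>2 * real p * dot n y y"
      by (simp add: sum_subtractf sum_distrib_left[symmetric] dot_def)
    also have "(\<Sum>i<n. \<Sum>r<p. g r * (?Y $$ (r, i) * y i)) = (\<Sum>r<p. (g r)\<^sup>2)"
      by (subst sum.swap) (simp add: sum_distrib_left[symmetric] g_def[symmetric] power2_eq_square)
    also have "\<dots> = (\<Sum>r<p. \<sigma>\<^sup>2 * (t r * dot n ?e y + (\<Sum>j<n. y j * x (r, j)))\<^sup>2)"
    proof (intro sum.cong refl)
      fix r assume r: "r \<in> {..<p}"
      have "g r = (\<Sum>j<n. \<sigma> * (t r * (?e j * y j) + y j * x (r, j)))"
        unfolding g_def using r by (intro sum.cong refl) (simp add: observed_index algebra_simps)
      also have "\<dots> = \<sigma> * (t r * dot n ?e y + (\<Sum>j<n. y j * x (r, j)))"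
        by (simp add: sum_distrib_left[symmetric] sum.distrib dot_def)
      finally show "(g r)\<^sup>2 = \<sigma>\<^sup>2 * (t r * dot n ?e y + (\<Sum>j<n. y j * x (r, j)))\<^sup>2"
        by (simp only: power_mult_distrib)
    qed
    also have "\<dots> = \<sigma>\<^sup>2 * noise_form p n t ?e y x + ?k * dot n ?e y * dot n ?e y
        + \<sigma>\<^sup>2 * real p * dot n y y"
    proof -
      have "(t r * c + w)\<^sup>2 = (2 * t r * c * w + w\<^sup>2 - a) + (t r)\<^sup>2 * (c * c) + a"
          for r and c w a :: real
        by (simp add: power2_eq_square algebra_simps)
      then have "(\<Sum>r<p. \<sigma>\<^sup>2 * (t r * dot n ?e y + (\<Sum>j<n. y j * x (r, j)))\<^sup>2)
        = \<sigma>\<^sup>2 * (noise_form p n t ?e y x + (\<Sum>r<p. (t r)\<^sup>2 * (dot n ?e y * dot n ?e y))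
            + (\<Sum>r<p. dot n y y))"
        unfolding noise_form_def sum.distrib[symmetric] sum_distrib_left[symmetric]
        by (intro arg_cong2[where f = "(*)"] sum.cong refl) blast
      also have "\<dots> = \<sigma>\<^sup>2 * noise_form p n t ?e y x + ?k * dot n ?e y * dot n ?e y
          + \<sigma>\<^sup>2 * real p * dot n y y"
        by (simp add: sum_distrib_right[symmetric] distrib_left mult.assoc)
      finally show ?thesis .
    qed
    finally show ?thesis by simp
  qed
  have "form_bounded n M (2 * (\<sigma>\<^sup>2 * D))"
  proof (rule form_bounded_if_grid[OF n sym])
    fix z assume "z \<in> grid n"
    then have "\<bar>\<sigma>\<^sup>2 * noise_form p n t ?e (grid_point n z) x\<bar> \<le> \<sigma>\<^sup>2 * D"
      using grid[of z] by (simp add: abs_mult mult_left_mono)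
    then show "\<bar>dot n (grid_point n z) (app n M (grid_point n z))\<bar> \<le> \<sigma>\<^sup>2 * D" unfolding form .
  qed
  then have "form_bounded n (\<lambda>i j. if i = j then 0 else M i j) (2 * (2 * (\<sigma>\<^sup>2 * D)))"
    by (rule form_bounded_hollow[OF n])
  moreover have "2 * (2 * (\<sigma>\<^sup>2 * D)) = 4 * \<sigma>\<^sup>2 * D" by simp
  ultimately have F: "form_bounded n (\<lambda>i j. if i = j then 0 else M i j) (4 * \<sigma>\<^sup>2 * D)"
      by (simp only:)
  show ?thesis
    by (rule iffD2[OF form_bounded_cong F])
      (simp add: centred_def hollow_gram_index[OF observed_carrier] M_def)
qed

lemma margin_identity:
  assumes eta: "\<eta> \<in> sign_vecs n" and i: "i < n"
  shows "vec_index \<eta> i * app n (\<lambda>i j. hollow_gram (observed p n \<sigma> t \<eta> x) $$ (i, j)) (vec_index \<eta>) i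
    = \<sigma>\<^sup>2 * (\<Sum>r<p. (t r + vec_index \<eta> i * x (r, i)) * ((real n - 1) * t r
        + (\<Sum>j\<in>{..<n}-{i}. vec_index \<eta> j * x (r, j))))"
proof -
  let ?Y = "observed p n \<sigma> t \<eta> x" and ?e = "vec_index \<eta>"
  have e2: "?e j * ?e j = 1" if "j < n" for j
    using sign_square[OF eta that] by (simp only: power2_eq_square)
  have "app n (\<lambda>i j. hollow_gram ?Y $$ (i, j)) ?e i = (\<Sum>j<n. if j
      = i then 0 else (\<Sum>r<p. ?Y $$ (r, i) * ?Y $$ (r, j)) * ?e j)"
    unfolding app_def using i by (intro sum.cong refl) (simp add: hollow_gram_index[OF
        observed_carrier])
  also have "\<dots> = (\<Sum>j\<in>{..<n}-{i}. (\<Sum>r<p. ?Y $$ (r, i) * ?Y $$ (r, j)) * ?e j)"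
    by (intro sum.mono_neutral_cong_right) auto
  also have "\<dots> = (\<Sum>j\<in>{..<n}-{i}. \<Sum>r<p. ?Y $$ (r, i) * (?e j * ?Y $$ (r, j)))"
    unfolding sum_distrib_right by (intro sum.cong refl) (simp only: mult_ac)
  also have "\<dots> = (\<Sum>r<p. ?Y $$ (r, i) * (\<Sum>j\<in>{..<n}-{i}. ?e j * ?Y $$ (r, j)))"
    unfolding sum_distrib_left by (rule sum.swap)
  finally have "?e i * app n (\<lambda>i j. hollow_gram ?Y $$ (i, j)) ?e i
      = (\<Sum>r<p. (?e i * ?Y $$ (r, i)) * (\<Sum>j\<in>{..<n}-{i}. ?e j * ?Y $$ (r, j)))"
    by (simp only: sum_distrib_left mult.assoc)
  also have "\<dots> = (\<Sum>r<p. \<sigma>\<^sup>2 * ((t r + ?e i * x (r, i)) * ((real n - 1) * t r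
      + (\<Sum>j\<in>{..<n}-{i}. ?e j * x (r, j)))))"
  proof (intro sum.cong refl)
    fix r assume r: "r \<in> {..<p}"
    have h: "?e j * ?Y $$ (r, j) = \<sigma> * (t r + ?e j * x (r, j))" if "j < n" for j
    proof -
      have "?e j * ?Y $$ (r, j) = \<sigma> * (t r * (?e j * ?e j) + ?e j * x (r, j))"
        using r that by (simp add: observed_index algebra_simps)
      then show ?thesis unfolding e2[OF that] by simp
    qed
    have "(\<Sum>j\<in>{..<n}-{i}. ?e j * ?Y $$ (r, j)) = (\<Sum>j\<in>{..<n}-{i}. \<sigma> * (t r + ?e j * x (r, j)))"
      by (intro sum.cong refl) (simp add: h)
    also have "\<dots> = \<sigma> * ((real n - 1) * t r + (\<Sum>j\<in>{..<n}-{i}. ?e j * x (r, j)))"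
      using i by (simp add: sum_distrib_left[symmetric] sum.distrib of_nat_diff)
    finally show "(?e i * ?Y $$ (r, i)) * (\<Sum>j\<in>{..<n}-{i}. ?e j * ?Y $$ (r, j))
        = \<sigma>\<^sup>2 * ((t r + ?e i * x (r, i)) * ((real n - 1) * t r + (\<Sum>j\<in>{..<n}-{i}. ?e j * x (r, j))))"
      unfolding h[OF i] by (simp add: power2_eq_square mult_ac)
  qed
  finally show ?thesis by (simp only: sum_distrib_left)
qed

section \<open>Exact recovery above the critical separation\<close>

lemma nn_integral_scaled_sum_le:
  fixes f :: "'b \<Rightarrow> 'a \<Rightarrow> real"
  assumes c: "c \<ge> 0" and e: "e \<ge> 0" and m: "\<And>i. i \<in> I \<Longrightarrow> f i \<in> borel_measurable M"
    and f: "\<And>i x. 0 \<le> f i x" and le: "\<And>i. i \<in> I \<Longrightarrow> (\<integral>\<^sup>+x. ennreal (f i x) \<partial>M) \<le> ennreal e"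
  shows "(\<integral>\<^sup>+x. ennreal (c * (\<Sum>i\<in>I. f i x)) \<partial>M) \<le> ennreal (c * (real (card I) * e))"
proof -
  have m': "(\<lambda>x. ennreal (f i x)) \<in> borel_measurable M" if "i \<in> I" for i
    by (rule measurable_compose[OF m[OF that] measurable_ennreal])
  have "ennreal (c * (\<Sum>i\<in>I. f i x)) = ennreal c * (\<Sum>i\<in>I. ennreal (f i x))" for x
    unfolding sum_ennreal[OF f] by (rule ennreal_mult'[OF c])
  then have "(\<integral>\<^sup>+x. ennreal (c * (\<Sum>i\<in>I. f i x)) \<partial>M)
      = (\<integral>\<^sup>+x. ennreal c * (\<Sum>i\<in>I. ennreal (f i x)) \<partial>M)"
    by (simp only:)
  also have "\<dots> = ennreal c * (\<integral>\<^sup>+x. (\<Sum>i\<in>I. ennreal (f i x)) \<partial>M)"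
    by (rule nn_integral_cmult) (intro borel_measurable_sum m')
  also have "(\<integral>\<^sup>+x. (\<Sum>i\<in>I. ennreal (f i x)) \<partial>M) = (\<Sum>i\<in>I. \<integral>\<^sup>+x. ennreal (f i x) \<partial>M)"
    by (rule nn_integral_sum[OF m'])
  also have "ennreal c * \<dots> \<le> ennreal c * (\<Sum>i\<in>I. ennreal e)"
    by (intro mult_left_mono sum_mono le) simp_all
  also have "\<dots> = ennreal (c * (real (card I) * e))"
    using c e by (simp add: ennreal_mult ennreal_of_nat_eq_real_of_nat)
  finally show ?thesis .
qed

text \<open>The three terms bound the expected number of small margins, the errors left by \<open>k\<close>
contractions, and the event that some grid point violates the norm bound. The events enter as
exponential upper bounds of their indicators, so that one expectation is taken of one pointwise
inequality.\<close>

lemma risk_bound: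
  fixes t a0 X :: real
  assumes n: "n \<ge> 3" and p: "p > 0" and sig: "\<sigma> > 0" and v: "spectral_choice p n v" and s: "s
      \<in> {-1, 1}"
    and eta: "\<eta> \<in> sign_vecs n" and theta: "\<theta> \<in> carrier_vec p"
    and t: "0 < t" "t \<le> 1/4" and c: "c \<ge> 1"
    and a0: "a0 = 1920 / t" and l: "ln (real n) \<ge> 18 * a0\<^sup>2"
    and X: "X = (eucl_norm \<theta> / \<sigma>)\<^sup>2" "X > 0" "2 * c * ln (real n) * (X + real p / real n) \<le> X\<^sup>2"
  shows "risk p n \<sigma> (eta_iter s v k) \<theta> \<eta>
    \<le> ennreal (16 / t * (real n * exp (- ((1 - 2 * t)\<^sup>2 * c * ln (real n) * ((real n
        - 2) / real n))))
      + (2 * (real n * (1 / 9) ^ k) + 4 * real n * exp (- 4 * real n)))"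
proof -
  let ?T = "eta_iter s v k" and ?e = "vec_index \<eta>" and ?l = "ln (real n)"
  define w where "w r = vec_index \<theta> r / \<sigma>" for r
  define d where "d = t * (n * X) / 48"
  define \<mu> where "\<mu> = a0 / X"
  \<comment> \<open>\<open>lam\<close> minimizes the Chernoff exponent; \<open>\<mu>\<close> makes \<open>\<mu> * d = 40 * n\<close>, which beats the size of the grid,
    while \<open>\<mu>\<close> itself is small because \<open>X\<close> is at least of order \<open>ln n\<close>.\<close>
  define lam where "lam = (1 - 2 * t) * X / (X + real p / real n) * ((real n - 2) / real n)"
  define S where "S i x = (\<Sum>r<p. (w r + ?e i * x (r, i)) * ((real n - 1) * w r
      + (\<Sum>j\<in>{..<n}-{i}. ?e j * x (r, j))))" for i and x :: "nat \<times> nat \<Rightarrow> real"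
  define Q where "Q z x = noise_form p n w ?e (grid_point n z) x" for z x
  define q where "q = real p / real n"
  \<comment> \<open>\<open>?m\<close> and \<open>?b\<close> dominate the indicators of a small margin and of a large form at a grid point.\<close>
  let ?m = "\<lambda>i x. exp (lam / (real n - 1) * (t * (n * X))) * exp (- (lam / (real n - 1)) * S i x)"
  let ?b = "\<lambda>z x. exp (- (\<mu> * d)) * (exp (\<mu> * Q z x) + exp (- \<mu> * Q z x))"
  have T: "?T \<in> estimators p n" by (rule eta_iter_estimator[OF v s])
  have n0: "n > 0" using n by simp
  have q: "q > 0" using p n by (simp add: q_def)
  have Xq: "X + q > 0" using X(2) q by simp
  have X3: "2 * c * ?l * (X + q) \<le> X\<^sup>2" using X(3) by (simp only: q_def)
  have a1: "a0 \<ge> 1" unfolding a0 using t by (simp add: le_divide_eq)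
  have a0sq: "a0 \<le> a0\<^sup>2" "1 \<le> a0\<^sup>2" using a1
      by (simp_all add: power2_eq_square mult_left_le_imp_le mult_le_cancel_left1 order.trans[OF
        a1])
  have l1: "?l \<ge> 18" using l a0sq by linarith
  have wX: "(\<Sum>r<p. (w r)\<^sup>2) = X"
  proof -
    have "eucl_norm \<theta> = sqrt (\<Sum>r<p. (vec_index \<theta> r)\<^sup>2)"
      using theta unfolding eucl_norm_def scalar_prod_def
          by (simp add: power2_eq_square atLeast0LessThan)
    then have "(eucl_norm \<theta>)\<^sup>2 = (\<Sum>r<p. (vec_index \<theta> r)\<^sup>2)" by (simp add: sum_nonneg)
    then show ?thesis unfolding X(1) w_def by (simp add: power_divide sum_divide_distrib)
  qed
  note e2 = sign_square[OF eta]
  have ee: "dot n ?e ?e = n" using e2 by (simp add: dot_self)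
  have d0: "d \<ge> 0" using t X n by (simp add: d_def)
  have lam: "0 \<le> lam" "lam \<le> 1"
  proof -
    have 1: "0 \<le> X / (X + q)" "X / (X + q) \<le> 1" using X(2) q by simp_all
    have 2: "0 \<le> (real n - 2) / real n" "(real n - 2) / real n \<le> 1" using n by simp_all
    define y where "y = X / (X + q) * ((real n - 2) / real n)"
    have y: "0 \<le> y" "y \<le> 1"
      unfolding y_def by (rule mult_nonneg_nonneg[OF 1(1) 2(1)], rule mult_le_one[OF 1(2) 2])
    have "lam = (1 - 2 * t) * y" by (simp add: lam_def q_def y_def)
    moreover have "0 \<le> (1 - 2 * t) * y" by (rule mult_nonneg_nonneg[OF _ y(1)]) (use t in simp)
    moreover have "(1 - 2 * t) * y \<le> 1" by (rule mult_le_one[OF _ y]) (use t in simp)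
    ultimately show "0 \<le> lam" "lam \<le> 1" by simp_all
  qed
  have pointwise: "loss n (?T (observed p n \<sigma> w \<eta> x)) \<eta>
      \<le> 16 / t * (\<Sum>i<n. ?m i x)
        + (2 * (real n * (1 / 9) ^ k)
        + 2 * real n * (\<Sum>z\<in>grid n. ?b z x))" for x
  proof -
    let ?Y = "observed p n \<sigma> w \<eta> x"
    let ?A = "16 / t * (\<Sum>i<n. ?m i x)"
    let ?B = "2 * (real n * (1 / 9) ^ k)"
    let ?C = "2 * real n * (\<Sum>z\<in>grid n. ?b z x)"
    have A0: "?A \<ge> 0" using t by (intro mult_nonneg_nonneg sum_nonneg) auto
    have B0: "?B \<ge> 0" by simp
    have C0: "?C \<ge> 0" by (intro mult_nonneg_nonneg sum_nonneg) auto
    have mu0: "\<mu> \<ge> 0" using a1 X(2) by (simp add: \<mu>_def)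
    show "loss n (?T ?Y) \<eta> \<le> ?A + (?B + ?C)"
    proof (cases "\<forall>z\<in>grid n. \<bar>Q z x\<bar> \<le> d")
      case False
      then obtain z where z: "z \<in> grid n" "d < \<bar>Q z x\<bar>" by auto
      have "loss n (?T ?Y) \<eta> \<le> 2 * real n * 1"
        using loss_le[OF estimator_sign[OF T observed_carrier] eta] by simp
      also have "\<dots> \<le> ?C"
      proof (intro mult_left_mono)
        have "1 \<le> exp (\<mu> * \<bar>Q z x\<bar> - \<mu> * d)"
          using mult_left_mono[of d "\<bar>Q z x\<bar>" \<mu>] mu0 z by simp
        also have "\<dots> = exp (- (\<mu> * d)) * exp (\<mu> * \<bar>Q z x\<bar>)" by (simp add: exp_add[symmetric])
        also have "\<dots> \<le> ?b z x"
          by (intro mult_left_mono) (simp_all add: abs_if)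
        also have "\<dots> \<le> (\<Sum>z\<in>grid n. ?b z x)"
          using z(1) finite_grid by (intro member_le_sum[of z "grid n"]) auto
        finally show "1 \<le> (\<Sum>z\<in>grid n. ?b z x)" .
      qed simp
      finally show ?thesis using A0 B0 by linarith
    next
      case True
      let ?H = "\<lambda>i j. hollow_gram ?Y $$ (i, j)" and ?k = "\<sigma>\<^sup>2 * X"
      have k0: "?k > 0" using sig X(2) by simp
      have Z: "form_bounded n (centred n ?H ?k ?e) (4 * \<sigma>\<^sup>2 * d)"
        unfolding wX[symmetric] using True
            by (intro centred_gram_bounded n0 eta d0) (simp add: Q_def)
      have top: "top_eigenvector (hollow_gram ?Y) (v ?Y)"
        using v observed_carrier unfolding spectral_choice_def by blast
      have Bd: "4 * \<sigma>\<^sup>2 * d \<le> t / 12 * (n * ?k)" by (simp add: d_def)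
      have L1: "loss n (?T ?Y) \<eta> \<le> 16 / t * real (card {i. i < n \<and> ?e i * app n ?H ?e i
          \<le> t * (n * ?k)}) + ?B"
      proof (rule eta_iter_loss_bound[where v = v and Y = ?Y and p = p and \<kappa> = ?k])
        show "?Y \<in> carrier_mat p n" by (rule observed_carrier)
        show "t \<le> 1" using t by simp
        show "0 \<le> 4 * \<sigma>\<^sup>2 * d" using d0 by simp
      qed (fact n0 top s eta k0 t(1) Z Bd)+
      have L2: "real (card {i. i < n \<and> ?e i * app n ?H ?e i \<le> t * (n * ?k)})
          \<le> (\<Sum>i<n. ?m i x)"
      proof -
        let ?G = "{i. i < n \<and> ?e i * app n ?H ?e i \<le> t * (n * ?k)}"
        have "real (card ?G) = (\<Sum>i\<in>?G. 1)" by simp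
        also have "\<dots> \<le> (\<Sum>i\<in>?G. ?m i x)"
        proof (intro sum_mono)
          fix i assume i: "i \<in> ?G"
          have "\<sigma>\<^sup>2 * S i x \<le> t * (n * ?k)"
            using i margin_identity[OF eta, of i p \<sigma> w x] by (simp add: S_def)
          then have "\<sigma>\<^sup>2 * S i x \<le> \<sigma>\<^sup>2 * (t * (n * X))" by (simp add: mult_ac)
          then have "S i x \<le> t * (n * X)" using sig by simp
          then have "0 \<le> lam / (real n - 1) * (t * (n * X) - S i x)"
            using lam n by (intro mult_nonneg_nonneg) auto
          then have "1 \<le> exp (lam / (real n - 1) * (t * (n * X) - S i x))" by simp
          also have "\<dots> = ?m i x"
            unfolding exp_add[symmetric] by (simp add: right_diff_distrib)
          finally show "1 \<le> ?m i x" .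
        qed
        also have "\<dots> \<le> (\<Sum>i<n. ?m i x)"
          by (intro sum_mono2) auto
        finally show ?thesis .
      qed
      have "16 / t * real (card {i. i < n \<and> ?e i * app n ?H ?e i \<le> t * (n * ?k)}) \<le> ?A"
        by (rule mult_left_mono[OF L2]) (use t in simp)
      then show ?thesis using L1 C0 by linarith
    qed
  qed
  let ?E = "exp (- ((1 - 2 * t)\<^sup>2 * c * ?l * ((real n - 2) / real n)))"
  have Sm: "(\<lambda>x. exp (a * S i x)) \<in> borel_measurable (noise p n)" if "i < n" for i a
    unfolding S_def using that
    by (intro measurable_compose[OF _ borel_measurable_exp] borel_measurable_times
        borel_measurable_sum
      borel_measurable_add borel_measurable_const measurable_noise_entry) auto
  have Qm: "(\<lambda>x. exp (a * Q z x)) \<in> borel_measurable (noise p n)" for z a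
    unfolding Q_def noise_form_def
    by (intro measurable_compose[OF _ borel_measurable_exp] borel_measurable_times
        borel_measurable_sum
      borel_measurable_add borel_measurable_diff borel_measurable_power borel_measurable_const
          measurable_noise_entry) auto
  have margin: "(\<integral>\<^sup>+x. ennreal (?m i x) \<partial>noise p n) \<le> ennreal ?E"
    if i: "i < n" for i
  proof -
    let ?F = "- lam * X + lam\<^sup>2 / 2 * (X + q) * (real n / (real n - 2))"
    have "(\<integral>\<^sup>+x. ennreal (?m i x) \<partial>noise p n)
      = ennreal (exp (lam / (real n - 1) * (t * (n * X))))
          * (\<integral>\<^sup>+x. ennreal (exp (- (lam / (real n - 1)) * S i x)) \<partial>noise p n)"
      unfolding ennreal_mult'[OF exp_ge_zero]
      by (rule nn_integral_cmult) (rule measurable_compose[OF Sm[OF i] measurable_ennreal])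
    also have "\<dots> \<le> ennreal (exp (lam / (real n - 1) * (t * (n * X)))) * ennreal (exp ?F)"
      unfolding S_def q_def wX[symmetric] by (intro mult_left_mono margin_mgf[OF eta i n lam]) simp
    also have "\<dots> = ennreal (exp (lam / (real n - 1) * (t * (n * X)) + ?F))"
      by (simp only: exp_add[of "lam / (real n - 1) * (t * (n * X))"] ennreal_mult'[OF exp_ge_zero])
    also have "\<dots> \<le> ennreal ?E"
    proof (intro ennreal_leI, simp only: exp_le_cancel_iff)
      define \<rho> where "\<rho> = (real n - 2) / real n"
      have rho: "\<rho> > 0" "real n / (real n - 2) = 1 / \<rho>" using n by (simp_all add: \<rho>_def)
      have lamE: "lam = (1 - 2 * t) * X / (X + q) * \<rho>" by (simp add: lam_def q_def \<rho>_def)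
      have "lam / (real n - 1) * (t * (n * X)) = lam * X * t * (real n / (real n - 1))" by simp
      also have "\<dots> \<le> lam * X * t * 2"
        using n lam t X(2) by (intro mult_left_mono) (simp_all add: divide_le_eq)
      finally have "lam / (real n - 1) * (t * (n * X)) + ?F
          \<le> - (lam * X * (1 - 2 * t)) + lam\<^sup>2 / 2 * (X + q) * (1 / \<rho>)"
        unfolding rho(2) by (simp add: right_diff_distrib)
      also have "\<dots> = - ((1 - 2 * t)\<^sup>2 * (X\<^sup>2 / (X + q)) * \<rho> / 2)"
      proof -
        have "lam\<^sup>2 / 2 * (X + q) * (1 / \<rho>) = (1 - 2 * t)\<^sup>2 * (X\<^sup>2 / (X + q)) * \<rho> / 2"
          unfolding lamE using Xq rho(1) by (simp add: power_mult_distrib power_divide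
              power2_eq_square)
        moreover have "lam * X * (1 - 2 * t) = (1 - 2 * t)\<^sup>2 * (X\<^sup>2 / (X + q)) * \<rho>"
          unfolding lamE by (simp add: power2_eq_square)
        moreover have "- u + u / 2 = - (u / 2)" for u :: real by simp
        ultimately show ?thesis by (simp only:)
      qed
      also have "\<dots> \<le> - ((1 - 2 * t)\<^sup>2 * (2 * c * ?l) * \<rho> / 2)"
      proof -
        have "2 * c * ?l \<le> X\<^sup>2 / (X + q)" using X3 Xq by (simp add: le_divide_eq)
        then have "(1 - 2 * t)\<^sup>2 * (2 * c * ?l) * \<rho> \<le> (1 - 2 * t)\<^sup>2 * (X\<^sup>2 / (X + q)) * \<rho>"
          using rho(1) by (intro mult_left_mono mult_right_mono) auto
        moreover have "- (y / 2) \<le> - (x / 2)" if "x \<le> y" for x y :: real using that by simp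
        ultimately show ?thesis by blast
      qed
      finally show "lam / (real n - 1) * (t * (n * X)) + ?F
          \<le> - ((1 - 2 * t)\<^sup>2 * c * ?l * ((real n - 2) / real n))"
        by (simp add: \<rho>_def)
    qed
    finally show ?thesis .
  qed
  have X2l: "X \<ge> 36 * a0\<^sup>2"
  proof -
    have "2 * ?l * X \<le> 2 * c * ?l * (X + q)"
      using c l1 X(2) q by (intro mult_mono) auto
    also have "\<dots> \<le> X * X" using X3 by (simp add: power2_eq_square)
    finally have "2 * ?l \<le> X" using X(2) by simp
    then show ?thesis using l by linarith
  qed
  have mu: "0 \<le> \<mu>" "\<mu> \<le> 1 / 9"
  proof -
    show "0 \<le> \<mu>" using a1 X(2) by (simp add: \<mu>_def)
    have "9 * a0 \<le> X" using X2l a0sq by linarith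
    then show "\<mu> \<le> 1 / 9" unfolding \<mu>_def using X(2) by (simp add: divide_le_eq)
  qed
  have mud: "\<mu> * d = 40 * real n" unfolding \<mu>_def d_def a0 using X(2) t by simp
  have mu2: "18 * \<mu>\<^sup>2 * (real p + real n * X) \<le> real n"
  proof -
    have "2 * ?l * (X + q) \<le> 2 * c * ?l * (X + q)" using c l1 Xq by (intro mult_right_mono) auto
    then have h: "36 * a0\<^sup>2 * (X + q) \<le> X\<^sup>2" 
    proof -
      have "36 * a0\<^sup>2 * (X + q) \<le> (2 * ?l) * (X + q)" using l Xq by (intro mult_right_mono) auto
      also have "\<dots> \<le> 2 * c * ?l * (X + q)" by fact
      finally show ?thesis using X3 by linarith
    qed
    have "18 * \<mu>\<^sup>2 * (real p + real n * X) = real n * (18 * a0\<^sup>2 * (X + q) / X\<^sup>2)"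
    proof -
      have "real p + real n * X = real n * (X + q)" using n by (simp add: q_def distrib_left)
      then show ?thesis by (simp add: \<mu>_def power_divide)
    qed
    also have "\<dots> \<le> real n * 1"
    proof (intro mult_left_mono)
      have "18 * a0\<^sup>2 * (X + q) \<le> 36 * a0\<^sup>2 * (X + q)" using Xq by (intro mult_right_mono) auto
      then have "18 * a0\<^sup>2 * (X + q) \<le> X\<^sup>2" using h by (rule order.trans)
      then show "18 * a0\<^sup>2 * (X + q) / X\<^sup>2 \<le> 1" using X(2) by (simp add: divide_le_eq)
    qed simp
    finally show ?thesis by simp
  qed
  have quad: "(\<integral>\<^sup>+x. ennreal (?b z x) \<partial>noise p n)
      \<le> ennreal (2 * exp (- 39 * real n))" if z: "z \<in> grid n" for z
  proof -
    have one: "(\<integral>\<^sup>+x. ennreal (exp (u * Q z x)) \<partial>noise p n)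
        \<le> ennreal (exp (real n))" if u: "\<bar>u\<bar> = \<mu>" for u
    proof -
      have "(\<integral>\<^sup>+x. ennreal (exp (u * Q z x)) \<partial>noise p n)
          \<le> ennreal (exp (18 * u\<^sup>2 * (real p + real n * (\<Sum>r<p. (w r)\<^sup>2))))"
        unfolding Q_def using u mu by (intro noise_form_mgf ee grid_point_norm n0 z) simp
      also have "\<dots> \<le> ennreal (exp (real n))"
      proof -
        have "u\<^sup>2 = \<mu>\<^sup>2" using u by (metis power2_abs)
        then show ?thesis using mu2 by (intro ennreal_leI) (simp add: wX)
      qed
      finally show ?thesis .
    qed
    have "(\<integral>\<^sup>+x. ennreal (?b z x) \<partial>noise p n)
       = ennreal (exp (- (\<mu> * d))) * ((\<integral>\<^sup>+x. ennreal (exp (\<mu> * Q z x)) \<partial>noise p n)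
           + (\<integral>\<^sup>+x. ennreal (exp (- \<mu> * Q z x)) \<partial>noise p n))"
    proof -
      have m: "(\<lambda>x. ennreal (exp (a * Q z x))) \<in> borel_measurable (noise p n)" for a
        by (rule measurable_compose[OF Qm measurable_ennreal])
      have "(\<integral>\<^sup>+x. ennreal (?b z x) \<partial>noise p n)
        = (\<integral>\<^sup>+x. ennreal (exp (- (\<mu> * d))) * (ennreal (exp (\<mu> * Q z x))
            + ennreal (exp (- \<mu> * Q z x))) \<partial>noise p n)"
        by (simp only: ennreal_mult'[OF exp_ge_zero] ennreal_plus[OF exp_ge_zero exp_ge_zero])
      also have "\<dots> = ennreal (exp (- (\<mu> * d))) * (\<integral>\<^sup>+x. ennreal (exp (\<mu> * Q z x))
          + ennreal (exp (- \<mu> * Q z x)) \<partial>noise p n)"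
        by (rule nn_integral_cmult) (intro borel_measurable_add m)
      also have "(\<integral>\<^sup>+x. ennreal (exp (\<mu> * Q z x)) + ennreal (exp (- \<mu> * Q z x)) \<partial>noise p n)
        = (\<integral>\<^sup>+x. ennreal (exp (\<mu> * Q z x)) \<partial>noise p n)
            + (\<integral>\<^sup>+x. ennreal (exp (- \<mu> * Q z x)) \<partial>noise p n)"
        by (rule nn_integral_add[OF m m])
      finally show ?thesis .
    qed
    also have "\<dots> \<le> ennreal (exp (- (\<mu> * d))) * (ennreal (exp (real n)) + ennreal (exp (real n)))"
      using mu by (intro mult_left_mono add_mono one) simp_all
    also have "\<dots> = ennreal (exp (- 40 * real n) * (exp (real n) + exp (real n)))"
      unfolding mud by (simp only: ennreal_mult'[OF exp_ge_zero] ennreal_plus[OF exp_ge_zero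
          exp_ge_zero] mult_minus_left)
    also have "exp (- 40 * real n) * (exp (real n) + exp (real n)) = 2 * exp (- 39 * real n)"
      by (simp add: distrib_left exp_add[symmetric])
    finally show ?thesis .
  qed
  let ?A = "\<lambda>x. 16 / t * (\<Sum>i<n. ?m i x)"
  let ?B = "2 * (real n * (1 / 9) ^ k)"
  let ?C = "\<lambda>x. 2 * real n * (\<Sum>z\<in>grid n. ?b z x)"
  interpret P: prob_space "noise p n" by (rule prob_space_noise)
  have nA: "?A x \<ge> 0" and nC: "?C x \<ge> 0" for x
    using t by (intro mult_nonneg_nonneg sum_nonneg; simp)+
  have mA: "(\<lambda>x. ?m i x) \<in> borel_measurable (noise p n)"
    if "i < n" for i by (intro borel_measurable_times borel_measurable_const Sm that)
  have mC: "(\<lambda>x. ?b z x) \<in> borel_measurable (noise p n)" for z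
    by (intro borel_measurable_times borel_measurable_add borel_measurable_const Qm)
  have IA: "(\<integral>\<^sup>+x. ennreal (?A x) \<partial>noise p n) \<le> ennreal (16 / t * (real n * ?E))"
  proof -
    have "(\<integral>\<^sup>+x. ennreal (?A x) \<partial>noise p n) \<le> ennreal (16 / t * (real (card {..<n}) * ?E))"
    proof (rule nn_integral_scaled_sum_le)
      show "16 / t \<ge> 0" using t by simp
    qed (simp_all only: lessThan_iff mA margin exp_ge_zero mult_nonneg_nonneg)
    then show ?thesis by (simp only: card_lessThan)
  qed
  have IC: "(\<integral>\<^sup>+x. ennreal (?C x) \<partial>noise p n) \<le> ennreal (4 * real n * exp (- 4 * real n))"
  proof -
    have "(\<integral>\<^sup>+x. ennreal (?C x) \<partial>noise p n)
        \<le> ennreal (2 * real n * (real (card (grid n)) * (2 * exp (- 39 * real n))))"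
      by (rule nn_integral_scaled_sum_le)
        (simp_all only: mC quad exp_ge_zero mult_nonneg_nonneg add_nonneg_nonneg of_nat_0_le_iff
            zero_le_numeral)
    also have "\<dots> \<le> ennreal (4 * real n * exp (- 4 * real n))"
    proof (intro ennreal_leI)
      have three: "(3::real) \<le> exp 2" using exp_ge_add_one_self[of 2] by simp
      have "real (card (grid n)) * exp (- 39 * real n) \<le> (3 * exp 33) ^ n * exp (- 39 * real n)"
        by (intro mult_right_mono card_grid_le) simp
      also have "\<dots> \<le> (exp 2 * exp 33) ^ n * exp (- 39 * real n)"
        using three by (intro mult_right_mono power_mono) auto
      also have "(exp 2 * exp 33) ^ n = exp (real n * 35)"
        by (simp add: exp_add[symmetric] exp_of_nat_mult[symmetric])
      also have "exp (real n * 35) * exp (- 39 * real n) = exp (- 4 * real n)"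
          by (simp add: exp_add[symmetric])
      finally have "4 * real n * (real (card (grid n)) * exp (- 39 * real n))
          \<le> 4 * real n * exp (- 4 * real n)"
        by (intro mult_left_mono) simp_all
      then show "2 * real n * (real (card (grid n)) * (2 * exp (- 39 * real n)))
          \<le> 4 * real n * exp (- 4 * real n)" by simp
    qed
    finally show ?thesis .
  qed
  have "risk p n \<sigma> ?T \<theta> \<eta> = (\<integral>\<^sup>+x. ennreal (loss n (?T (observed p n \<sigma> w \<eta> x)) \<eta>) \<partial>noise p n)"
    unfolding risk_noise[OF T theta]
  proof (intro nn_integral_cong arg_cong[where f = "\<lambda>M. ennreal (loss n (?T M) \<eta>)"] eq_matI)
    fix x i j assume "i < dim_row (observed p n \<sigma> w \<eta> x)" "j < dim_col (observed p n \<sigma> w \<eta> x)"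
    then show "mat p n (\<lambda>(i, j). vec_index \<theta> i * vec_index \<eta> j + \<sigma> * x (i, j)) $$ (i, j)
        = observed p n \<sigma> w \<eta> x $$ (i, j)"
      using sig by (simp add: observed_def w_def distrib_left)
  qed (simp_all add: observed_def)
  also have "\<dots> \<le> (\<integral>\<^sup>+x. ennreal (?A x) + (ennreal ?B + ennreal (?C x)) \<partial>noise p n)"
  proof (intro nn_integral_mono)
    fix x
    have "ennreal (loss n (?T (observed p n \<sigma> w \<eta> x)) \<eta>) \<le> ennreal (?A x + (?B + ?C x))"
      by (rule ennreal_leI[OF pointwise])
    also have "\<dots> = ennreal (?A x) + ennreal (?B + ?C x)"
      by (rule ennreal_plus[OF nA]) (intro add_nonneg_nonneg nC, simp)
    also have "ennreal (?B + ?C x) = ennreal ?B + ennreal (?C x)"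
        by (rule ennreal_plus[OF _ nC]) simp
    finally show "ennreal (loss n (?T (observed p n \<sigma> w \<eta> x)) \<eta>)
        \<le> ennreal (?A x) + (ennreal ?B + ennreal (?C x))" .
  qed
  also have "\<dots> = (\<integral>\<^sup>+x. ennreal (?A x) \<partial>noise p n) + (ennreal ?B
      + (\<integral>\<^sup>+x. ennreal (?C x) \<partial>noise p n))"
  proof -
    have 1: "(\<lambda>x. ennreal (?A x)) \<in> borel_measurable (noise p n)"
      by (intro measurable_compose[OF _ measurable_ennreal] borel_measurable_times
          borel_measurable_sum borel_measurable_const Sm) auto
    have 2: "(\<lambda>x. ennreal (?C x)) \<in> borel_measurable (noise p n)"
      by (intro measurable_compose[OF _ measurable_ennreal] borel_measurable_times[of "\<lambda>_. 2
          * real n"] borel_measurable_sum borel_measurable_const mC)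
    have "(\<integral>\<^sup>+x. ennreal (?A x) + (ennreal ?B + ennreal (?C x)) \<partial>noise p n)
        = (\<integral>\<^sup>+x. ennreal (?A x) \<partial>noise p n) + (\<integral>\<^sup>+x. ennreal ?B + ennreal (?C x) \<partial>noise p n)"
      by (rule nn_integral_add[OF 1]) (intro borel_measurable_add 2 borel_measurable_const)
    also have "(\<integral>\<^sup>+x. ennreal ?B + ennreal (?C x) \<partial>noise p n)
        = (\<integral>\<^sup>+x. ennreal ?B \<partial>noise p n) + (\<integral>\<^sup>+x. ennreal (?C x) \<partial>noise p n)"
      by (rule nn_integral_add[OF _ 2]) simp
    also have "(\<integral>\<^sup>+x. ennreal ?B \<partial>noise p n) = ennreal ?B" by (simp add: P.emeasure_space_1)
    finally show ?thesis .
  qed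
  also have "\<dots> \<le> ennreal (16 / t * (real n * ?E)) + (ennreal ?B
      + ennreal (4 * real n * exp (- 4 * real n)))"
    by (intro add_mono IA IC order_refl)
  also have "\<dots> = ennreal (16 / t * (real n * ?E) + (?B + 4 * real n * exp (- 4 * real n)))"
    using t by simp
  finally show ?thesis .
qed

text \<open>With \<open>t = \<epsilon> / (4 * (1 + \<epsilon>))\<close> the Chernoff exponent \<open>(1 - 2 * t)\<^sup>2 * c = (1 + \<epsilon> / 2)\<^sup>2\<close> still
exceeds \<open>1\<close>, and \<open>3 ln n\<close> contractions by \<open>1 / 9 \<le> exp (- 2)\<close> leave \<open>O (n powr (- 5))\<close> errors.\<close>

theorem exact_recovery_above_crit:
  fixes p :: "nat \<Rightarrow> nat" and \<sigma> \<Delta> :: "nat \<Rightarrow> real"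
  assumes p: "\<And>n. n \<ge> 2 \<Longrightarrow> p n > 0" and sig: "\<And>n. n \<ge> 2 \<Longrightarrow> \<sigma> n > 0"
    and eps: "\<epsilon> > 0" and ge: "\<And>n. n \<ge> 2 \<Longrightarrow> critical_sep (p n) n (\<sigma> n) * (1 + \<epsilon>) \<le> \<Delta> n"
    and s: "s \<in> {-1, 1}" and v: "\<And>n. n \<ge> 2 \<Longrightarrow> spectral_choice (p n) n (v n)"
  shows "achieves_exact_recovery p \<sigma> \<Delta> (\<lambda>n. eta_iter s (v n) (nat \<lfloor>3 * ln (real n)\<rfloor>))"
  unfolding achieves_exact_recovery_def
proof (intro conjI allI impI)
  show "eta_iter s (v n) (nat \<lfloor>3 * ln (real n)\<rfloor>) \<in> estimators (p n) n" if "2 \<le> n" for n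
    by (rule eta_iter_estimator[OF v[OF that] s])
  define c where "c = (1 + \<epsilon>)\<^sup>2"
  define t where "t = \<epsilon> / (4 * (1 + \<epsilon>))"
  define g where "g = (1 - 2 * t)\<^sup>2 * c"
  define a0 where "a0 = 1920 / t"
  have t: "0 < t" "t \<le> 1/4" using eps by (simp_all add: t_def field_simps)
  have c: "c \<ge> 1" using eps by (simp add: c_def)
  have g: "g > 1"
  proof -
    have "(1 - 2 * t) * (1 + \<epsilon>) = 1 + \<epsilon> / 2" using eps by (simp add: t_def field_simps)
    then have "g = (1 + \<epsilon> / 2)\<^sup>2" unfolding g_def c_def power_mult_distrib[symmetric] by simp
    then show ?thesis using eps by simp
  qed
  define b where "b n = 16 / t * (real n * exp (- (g * ln (real n) * ((real n - 2) / real n))))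
      + (2 * (real n * (9 * exp (- (6 * ln (real n)))))
          + 4 * real n * exp (- 4 * real n))" for n :: nat
  have "b \<longlonglongrightarrow> 0"
  proof -
    have "(\<lambda>n::nat. real n * exp (- (g * ln (real n) * ((real n - 2) / real n)))) \<longlonglongrightarrow> 0"
      using g by real_asymp
    then have "(\<lambda>n::nat. 16 / t * (real n * exp (- (g * ln (real n) * ((real n
        - 2) / real n))))) \<longlonglongrightarrow> 0"
      by (rule tendsto_mult_right_zero)
    moreover have "(\<lambda>n::nat. 2 * (real n * (9 * exp (- (6 * ln (real n)))))
        + 4 * real n * exp (- 4 * real n)) \<longlonglongrightarrow> 0"
      by real_asymp
    ultimately show ?thesis unfolding b_def by (rule tendsto_add_zero)
  qed
  then have lim: "(\<lambda>n. ennreal (b n)) \<longlonglongrightarrow> 0"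
    using tendsto_ennrealI[of b 0] by simp
  have le: "\<forall>\<^sub>F n in sequentially. max_risk (p n) n (\<sigma> n) (\<Delta> n) (eta_iter s (v n) (nat \<lfloor>3
      * ln (real n)\<rfloor>)) \<le> ennreal (b n)"
  proof -
    have "filterlim (\<lambda>n::nat. ln (real n)) at_top sequentially" by real_asymp
    then have "\<forall>\<^sub>F n in sequentially. 18 * a0\<^sup>2 \<le> ln (real n)" unfolding filterlim_at_top
        by (rule spec)
    moreover have "\<forall>\<^sub>F n in sequentially. n \<ge> (3::nat)" by (rule eventually_ge_at_top)
    ultimately show ?thesis
    proof eventually_elim
      case (elim n)
      let ?k = "nat \<lfloor>3 * ln (real n)\<rfloor>"
      have n2: "n \<ge> 2" and n3: "n \<ge> 3" using elim(2) by auto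
      have xb: "crit (p n) n > 0" by (rule crit_pos[OF n2])
      have power: "(1 / 9 :: real) ^ ?k \<le> 9 * exp (- (6 * ln (real n)))"
      proof -
        have e9: "exp (2::real) \<le> 9"
        proof -
          have "exp (1::real) \<le> 3" by (rule exp_le)
          then have "exp (1::real) * exp 1 \<le> 3 * 3" by (intro mult_mono) auto
          then show ?thesis by (simp add: exp_add[symmetric])
        qed
        have k: "3 * ln (real n) - 1 \<le> real ?k" by linarith
        have "(1 / 9 :: real) ^ ?k \<le> (exp (- 2)) ^ ?k"
          using e9 by (intro power_mono) (simp_all add: exp_minus field_simps)
        also have "\<dots> = exp (real ?k * (- 2))" by (rule exp_of_nat_mult[symmetric])
        also have "\<dots> \<le> exp (2 + - (6 * ln (real n)))" using k by simp
        also have "\<dots> = exp 2 * exp (- (6 * ln (real n)))" by (rule exp_add)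
        also have "\<dots> \<le> 9 * exp (- (6 * ln (real n)))" using e9 by (intro mult_right_mono) auto
        finally show ?thesis .
      qed
      show ?case
        unfolding max_risk_def
      proof (rule SUP_least, clarify)
        fix \<theta> \<eta> assume "(\<theta>, \<eta>) \<in> param_space (p n) n (\<Delta> n)"
        then have th: "\<theta> \<in> carrier_vec (p n)" "\<Delta> n \<le> eucl_norm \<theta>" "\<eta> \<in> sign_vecs n"
          by (auto simp: param_space_def)
        define X where "X = (eucl_norm \<theta> / \<sigma> n)\<^sup>2"
        have cs: "critical_sep (p n) n (\<sigma> n) * (1 + \<epsilon>) \<ge> 0"
          using eps xb by (simp add: critical_sep_crit)
        have "(critical_sep (p n) n (\<sigma> n) * (1 + \<epsilon>))\<^sup>2 \<le> (eucl_norm \<theta>)\<^sup>2"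
          using cs ge[OF n2] th(2) by (intro power_mono) auto
        moreover have "(critical_sep (p n) n (\<sigma> n) * (1 + \<epsilon>))\<^sup>2 = (c * crit (p n) n) * (\<sigma> n)\<^sup>2"
          using xb by (simp add: critical_sep_crit power_mult_distrib c_def)
        ultimately have X: "c * crit (p n) n \<le> X"
          unfolding X_def power_divide using sig[OF n2] by (simp add: le_divide_eq)
        have X0: "X > 0" using X c xb mult_pos_pos[of c "crit (p n) n"] by linarith
        have "risk (p n) n (\<sigma> n) (eta_iter s (v n) ?k) \<theta> \<eta>
          \<le> ennreal (16 / t * (real n * exp (- ((1 - 2 * t)\<^sup>2 * c * ln (real n) * ((real n
              - 2) / real n))))
            + (2 * (real n * (1 / 9) ^ ?k) + 4 * real n * exp (- 4 * real n)))"
          by (rule risk_bound[OF n3 p[OF n2] sig[OF n2] v[OF n2] s th(3,1) t c a0_def elim(1)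
              X_def X0 above_crit[OF n2 X c]])
        also have "\<dots> \<le> ennreal (b n)"
          unfolding b_def g_def by (intro ennreal_leI add_mono mult_left_mono power order_refl)
              simp_all
        finally show "risk (p n) n (\<sigma> n) (eta_iter s (v n) ?k) \<theta> \<eta> \<le> ennreal (b n)" .
      qed
    qed
  qed
  show "(\<lambda>n. max_risk (p n) n (\<sigma> n) (\<Delta> n) (eta_iter s (v n) (nat \<lfloor>3 * ln (real n)\<rfloor>))) \<longlonglongrightarrow> 0"
    by (rule tendsto_sandwich[OF always_eventually[OF allI[OF zero_le]] le tendsto_const lim])
qed

theorem theorem8:
  fixes p :: "nat \<Rightarrow> nat" and \<sigma> \<Delta> :: "nat \<Rightarrow> real"
  assumes "\<And>n. n \<ge> 2 \<Longrightarrow> p n > 0"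
    and "\<And>n. n \<ge> 2 \<Longrightarrow> \<sigma> n > 0"
    and "\<And>n. n \<ge> 2 \<Longrightarrow> \<Delta> n > 0"
  shows "((\<exists>\<epsilon>>0. \<forall>n\<ge>2. \<Delta> n \<ge> critical_sep (p n) n (\<sigma> n) * (1 + \<epsilon>)) \<longrightarrow>
            (\<forall>s\<in>{-1, 1}. \<forall>v. (\<forall>n\<ge>2. spectral_choice (p n) n (v n)) \<longrightarrow>
               achieves_exact_recovery p \<sigma> \<Delta>
                 (\<lambda>n. eta_iter s (v n) (nat \<lfloor>3 * ln (real n)\<rfloor>)))) \<and>
         ((\<exists>\<epsilon>>0. \<forall>n\<ge>2. \<Delta> n \<le> critical_sep (p n) n (\<sigma> n) * (1 - \<epsilon>)) \<longrightarrow>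
            exact_recovery_impossible p \<sigma> \<Delta>)"
proof (intro conjI impI)
  assume "\<exists>\<epsilon>>0. \<forall>n\<ge>2. \<Delta> n \<ge> critical_sep (p n) n (\<sigma> n) * (1 + \<epsilon>)"
  then obtain \<epsilon> where eps: "\<epsilon> > 0"
    and ge: "\<And>n. n \<ge> 2 \<Longrightarrow> critical_sep (p n) n (\<sigma> n) * (1 + \<epsilon>) \<le> \<Delta> n" by blast
  show "\<forall>s\<in>{-1, 1}. \<forall>v. (\<forall>n\<ge>2. spectral_choice (p n) n (v n)) \<longrightarrow>
      achieves_exact_recovery p \<sigma> \<Delta> (\<lambda>n. eta_iter s (v n) (nat \<lfloor>3 * ln (real n)\<rfloor>))"
  proof (intro ballI allI impI)
    fix s :: real and v
    assume s: "s \<in> {-1, 1}" and v: "\<forall>n\<ge>2. spectral_choice (p n) n (v n)"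
    from v have v': "\<And>n. n \<ge> 2 \<Longrightarrow> spectral_choice (p n) n (v n)" by blast
    show "achieves_exact_recovery p \<sigma> \<Delta> (\<lambda>n. eta_iter s (v n) (nat \<lfloor>3 * ln (real n)\<rfloor>))"
      by (rule exact_recovery_above_crit[OF assms(1,2) eps ge s v'])
  qed
next
  assume "\<exists>\<epsilon>>0. \<forall>n\<ge>2. \<Delta> n \<le> critical_sep (p n) n (\<sigma> n) * (1 - \<epsilon>)"
  then obtain \<epsilon> where eps: "\<epsilon> > 0"
    and le: "\<And>n. n \<ge> 2 \<Longrightarrow> \<Delta> n \<le> critical_sep (p n) n (\<sigma> n) * (1 - \<epsilon>)" by blast
  show "exact_recovery_impossible p \<sigma> \<Delta>"
    by (rule impossible_below_crit[OF assms eps le])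
qed

end
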